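(* For every $\varepsilon>0$ and every (fixed) tree $T$ there exists $d_0>0$ such that the following holds. Let $p=p(n)$ satisfy $\frac{d_0}{n}\le p\le 0.99$ and let $q=\frac{1}{1-p}$. Then with high probability (i.e. with probability $1-o(1)$ as $n\to\infty$) the maximum number of vertices of an induced $T$-matching in $G(n,p)$ lies between $(2-\varepsilon)\log_q(np)$ and $(2+\varepsilon)\log_q(np)$.
   Context: $G(n,p)$ denotes the binomial random graph on vertex set $\{1,\dots,n\}$ in which each pair of vertices is an edge independently with probability $p$. For a graph $T$, a $T$-matching is a graph all of whose connected components are isomorphic to $T$; an induced $T$-matching in $G$ is a vertex set $U$ such that the induced subgraph $G[U]$ is a $T$-matching. The order of a graph is its number of vertices. *)

theory Defs
  imports "HOL-Probability.Probability" "Graph_Theory.Digraph_Isomorphism"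
begin

text \<open>
  A finite simple graph is a \<^locale>\<open>pair_graph\<close>: a finite, symmetric, loop-free relation on a
  vertex set, so that every edge is represented by its two opposite arcs.
\<close>

definition gnp :: "nat \<Rightarrow> real \<Rightarrow> nat pair_pre_digraph pmf" where
  "gnp n p =
     map_pmf (\<lambda>X. \<lparr> pverts = {1..n},
                    parcs = {(u, v). u \<in> {1..n} \<and> v \<in> {1..n} \<and> u \<noteq> v \<and> X {u, v}} \<rparr>)
       (Pi_pmf {e. e \<subseteq> {1..n} \<and> card e = 2} False (\<lambda>_. bernoulli_pmf p))"

text \<open>
  The constant \<^const>\<open>Digraph_Component.tree\<close> is unsuitable for symmetric digraphs: it forbids
  all directed cycles, and an edge traversed back and forth is one of length 2. The cycles of a
  simple graph are the directed cycles of length at least 3.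
\<close>

definition undirected_tree :: "'a pair_pre_digraph \<Rightarrow> bool" where
  "undirected_tree T \<longleftrightarrow>
     pair_graph T \<and> Digraph_Component.connected (with_proj T) \<and>
     \<not> (\<exists>c. pre_digraph.cycle (with_proj T) c \<and> 3 \<le> length c)"

text \<open>
  For symmetric \<open>G\<close>, \<^const>\<open>pre_digraph.sccs\<close> is the set of connected components of \<open>G\<close>.
  The null graph is a \<open>T\<close>-matching (with no components).
\<close>

definition is_matching_of :: "'a pair_pre_digraph \<Rightarrow> ('b, 'b \<times> 'b) pre_digraph \<Rightarrow> bool" where
  "is_matching_of T G \<longleftrightarrow> (\<forall>C \<in> pre_digraph.sccs G. digraph_iso C (with_proj T))"

definition induced_matching :: "'a pair_pre_digraph \<Rightarrow> 'b pair_pre_digraph \<Rightarrow> 'b set \<Rightarrow> bool" where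
  "induced_matching T G U \<longleftrightarrow> U \<subseteq> pverts G \<and> is_matching_of T (with_proj G \<restriction> U)"

definition max_induced_matching_order :: "'a pair_pre_digraph \<Rightarrow> 'b pair_pre_digraph \<Rightarrow> nat" where
  "max_induced_matching_order T G = Max (card ` {U. induced_matching T G U})"

end

theory Submission
  imports Defs "HOL-Combinatorics.Permutations" "HOL-Real_Asymp.Real_Asymp"
begin

text \<open>
  Let \<open>t\<close> be the order of \<open>T\<close>, \<open>d = np\<close>, \<open>q = 1/(1-p)\<close> and \<open>L = log q d\<close>; note that \<open>L \<rightarrow> \<infinity>\<close>
  uniformly in the allowed range of \<open>p\<close>. The upper bound is a first moment computation: the expected
  number of induced matchings with \<open>k \<ge> (2+\<epsilon>)L/t\<close> components is at most \<open>2 powr -k\<close>.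

  For the lower bound fix \<open>kt \<approx> (2-\<epsilon>/2)L\<close> disjoint blocks of \<open>m \<approx> n/(kt)\<close> vertices, \<open>k\<close> for each vertex
  of \<open>T\<close>, and look for an induced matching with one vertex in every block. Prescribing the edges of
  the copies by permutations that match the blocks of a vertex of \<open>T\<close> with those of its parent, the
  second moment method gives such a matching with probability at least \<open>exp (-\<eta>kt)\<close>, where \<open>\<eta>\<close> is
  arbitrarily small if \<open>d\<close> is large. The largest order \<open>Y\<close> of an induced matching with at most one
  vertex in each block changes by at most \<open>t\<close> if the edges at a single block change, so by
  McDiarmid's inequality it deviates from its mean by \<open>\<delta>kt\<close> with probability at most
  \<open>exp (-2\<delta>\<^sup>2k/t)\<close>. Since this is smaller than \<open>exp (-\<eta>kt)\<close>, the mean of \<open>Y\<close> is at least \<open>(1-\<delta>)kt\<close>,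
  and \<open>Y\<close> is concentrated there. Taking the number of blocks proportional to \<open>L\<close> makes this work for
  sparse and dense graphs alike.
\<close>

section \<open>Trees as parent functions\<close>

text \<open>Exposing the graph vertex by vertex would bound deviations \<open>l\<close> by exp (-c
  l^2 / n), which is useless for matchings of order L; with kt blocks the exponent is linear in
  \<open>k\<close>. This is also the scale of the loss in the second moment, which for bounded
  \<open>d\<close> is controlled only up to a factor exponential in \<open>k\<close>, at a rate that
  is small for large \<open>d\<close>. The permutations restore a balance in that computation. A
  shared edge raises a joint probability by 1/p, which the factor 1/m of a shared vertex cannot pay
  for when \<open>p\<close> is small. With the partner block free among \<open>k\<close>, a
  coincidence costs about e/k, and kp >= e. The same inequality serves the upper bound: a component
  has t vertices but only t-1 edges, and the spare 1/p in (np)^t / p is absorbed by the e/k that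
  comes from counting components without order. As L is of order (ln d)/p, the inequality kp >= e
  only asks for large \<open>d\<close>. The bound 0.99 enters through q <= 100 and ln q <= 100
  p.\<close>

text \<open>
  The vertices of a rooted tree on \<open>t\<close> vertices are numbered by \<open>{..<t}\<close>, with root \<open>0\<close> and every other vertex
  after its parent.
\<close>

definition par_edge :: "(nat \<Rightarrow> nat) \<Rightarrow> nat \<Rightarrow> nat \<Rightarrow> bool" where
  "par_edge par i j \<longleftrightarrow> (0 < j \<and> par j = i) \<or> (0 < i \<and> par i = j)"

text \<open>Parents have smaller indices, so the walk along parents ends at 0. Only the arcs from
  each vertex to its parent are assumed, which lets the lemma serve both a partly built subtree and
  a single copy inside an induced matching.\<close>

lemma par_tree_reaches_root:
  fixes h :: "nat \<Rightarrow> 'a"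
  assumes "wf_digraph G" and "\<And>i. 0 < i \<Longrightarrow> i < s \<Longrightarrow> par i < i"
    and "\<And>i. 0 < i \<Longrightarrow> i < s \<Longrightarrow> (h i, h (par i)) \<in> arcs_ends G"
    and "i < s" "h i \<in> verts G"
  shows "h i \<rightarrow>\<^sup>*\<^bsub>G\<^esub> h 0"
  using assms(4,5)
proof (induction i rule: less_induct)
  case (less i)
  interpret wf_digraph G by fact
  show ?case
  proof (cases "i = 0")
    case True
    then show ?thesis using less.prems by (simp add: reachable_refl)
  next
    case False
    have e: "(h i, h (par i)) \<in> arcs_ends G" using assms(3) False less.prems by simp
    moreover have "h (par i) \<in> verts G" using adj_in_verts(2) e by blast
    ultimately show ?thesis
      using less.IH[of "par i"] assms(2)[of i] False less.prems
      by (meson adj_reachable_trans bot_nat_0.not_eq_extremum dual_order.strict_trans)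
  qed
qed

text \<open>A path from \<open>y\<close> to \<open>z\<close> inside \<open>S\<close> avoids
  \<open>x\<close>, so the two arcs at \<open>x\<close> close it to a cycle. As \<open>y\<close> and
  \<open>z\<close> differ, the path is not empty and the length is at least 3, which excludes the
  back-and-forth cycle along one edge. This converts acyclicity into uniqueness of the
  parent.\<close>

lemma cycle_through_new_vertex:
  assumes "pair_graph T" and S: "S \<subseteq> pverts T" and x: "x \<in> pverts T" "x \<notin> S"
    and reach: "y \<rightarrow>\<^sup>*\<^bsub>with_proj T \<restriction> S\<^esub> z" and "y \<noteq> z"
    and "(x, y) \<in> parcs T" "(z, x) \<in> parcs T"
  shows "\<exists>c. pre_digraph.cycle (with_proj T) c \<and> 3 \<le> length c"
proof -
  interpret pair_graph T by fact
  interpret H: wf_digraph "with_proj T \<restriction> S" by (rule wellformed_induce_subgraph)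
  obtain p where p: "H.apath y p z" using reach H.reachable_apath by blast
  have sub: "subgraph (with_proj T \<restriction> S) (with_proj T)"
    using induced_induce[OF S] by (rule induced_imp_subgraph)
  have pT: "apath y p z" using subgraph_apath_imp_apath[OF p sub] .
  have "p \<noteq> []" using p \<open>y \<noteq> z\<close> by (auto simp: H.apath_def H.awalk_def H.cas.simps)
  have vS: "set (pawalk_verts y p) \<subseteq> S"
  proof -
    have "set (H.awalk_verts y p) \<subseteq> verts (with_proj T \<restriction> S)"
      using p H.awalkE' H.apath_def H.awalk_verts_in_verts
      by (metis H.awalk_def)
    moreover have "H.awalk_verts y p = pawalk_verts y p"
      by (metis awalk_verts_with_proj_eq compatible_awalk_verts compatible_induce_subgraph)
    ultimately show ?thesis by simp
  qed
  define c where "c = (x, y) # p @ [(z, x)]"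
  have aw: "awalk y p z" "distinct (pawalk_verts y p)" using pT by (auto simp: apath_def)
  have "awalk x c x" unfolding c_def using aw(1) assms(7,8) x
    by (auto simp: awalk_Cons_iff awalk_append_iff awalk_def)
  moreover have "pawalk_verts y (p @ [(z, x)]) = pawalk_verts y p @ [x]"
  proof -
    have "pcas y p z" using aw(1) by (auto simp: awalk_def)
    then show ?thesis by (induction p arbitrary: y) auto
  qed
  ultimately have "cycle c" unfolding cycle_def using aw(2) vS x(2)
    by (intro exI[of _ x]) (auto simp: c_def)
  moreover have "3 \<le> length c" using \<open>p \<noteq> []\<close> by (cases p) (auto simp: c_def)
  ultimately show ?thesis by blast
qed

text \<open>Vertices are added one at a time to a set \<open>S\<close> connected through the root.
  Connectedness of the tree supplies a new vertex with a neighbour in \<open>S\<close>, acyclicity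
  makes this neighbour unique, and it becomes the parent.\<close>

lemma undirected_tree_enumeration:
  assumes T: "undirected_tree T"
  obtains t par h where "0 < t" "\<And>i. 0 < i \<Longrightarrow> i < t \<Longrightarrow> par i < i"
    "bij_betw h {..<t} (pverts T)"
    "\<And>i j. i < t \<Longrightarrow> j < t \<Longrightarrow> (h i, h j) \<in> parcs T \<longleftrightarrow> par_edge par i j"
proof -
  from T interpret pair_graph T by (simp add: undirected_tree_def)
  have conn: "strongly_connected (with_proj T)"
    using T sym_arcs symmetric_connected_imp_strongly_connected
    by (simp add: undirected_tree_def)
  have nocyc: "\<not> (\<exists>c. pre_digraph.cycle (with_proj T) c \<and> 3 \<le> length c)"
    using T by (simp add: undirected_tree_def)
  have ne: "pverts T \<noteq> {}" using conn by (auto simp: strongly_connected_def)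
  have step: "\<exists>h par. (\<forall>i. 0 < i \<longrightarrow> i < s \<longrightarrow> par i < i) \<and> inj_on h {..<s} \<and>
      h ` {..<s} \<subseteq> pverts T \<and>
      (\<forall>i<s. \<forall>j<s. (h i, h j) \<in> parcs T \<longleftrightarrow> par_edge par i j)"
    if "0 < s" "s \<le> card (pverts T)" for s
    using that
  proof (induction s)
    case (Suc s)
    show ?case
    proof (cases "s = 0")
      case True
      obtain v where "v \<in> pverts T" using ne by blast
      then show ?thesis using True no_loops' by (intro exI[of _ "\<lambda>_. v"]) (auto simp: par_edge_def lessThan_Suc)
    next
      case False
      then obtain h par where IH: "\<And>i. 0 < i \<Longrightarrow> i < s \<Longrightarrow> par i < i" "inj_on h {..<s}"
        "h ` {..<s} \<subseteq> pverts T"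
        "\<And>i j. i < s \<Longrightarrow> j < s \<Longrightarrow> (h i, h j) \<in> parcs T \<longleftrightarrow> par_edge par i j"
        using Suc by force
      define S where "S = h ` {..<s}"
      have S: "S \<subseteq> pverts T" using IH by (auto simp: S_def)
      have "card S = s" using IH(2) by (simp add: S_def card_image)
      then obtain w where w: "w \<in> pverts T" "w \<notin> S"
        using Suc.prems(2) S by (metis Suc_n_not_le_n subsetI subset_antisym)
      have h0: "h 0 \<in> S" using False by (auto simp: S_def)
      have "h 0 \<rightarrow>\<^sup>*\<^bsub>with_proj T\<^esub> w"
        using conn w(1) h0 S by (auto simp: strongly_connected_def)
      \<comment> \<open>A walk from the root to \<open>w\<close> starts in \<open>S\<close> and ends
        outside, so one of its arcs leaves \<open>S\<close>.\<close>
      then have "\<exists>y x. y \<in> S \<and> x \<in> pverts T - S \<and> (y, x) \<in> parcs T"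
        unfolding reachable_def using h0 w(2)
      proof (induction rule: rtrancl_on_induct)
        case (step y z)
        then show ?case by (cases "y \<in> S") auto
      qed auto
      then obtain i0 x where i0: "i0 < s" and x: "x \<in> pverts T" "x \<notin> S" and e: "(h i0, x) \<in> parcs T"
        by (auto simp: S_def)
      interpret H: wf_digraph "with_proj T \<restriction> S" by (rule wellformed_induce_subgraph)
      have arcsS: "(h i, h (par i)) \<in> parcs T" "h i \<in> S" "h (par i) \<in> S" if "0 < i" "i < s" for i
        using that IH(1)[OF that] IH(4)[of i "par i"] by (simp_all add: par_edge_def S_def)
      have endsS: "(a, b) \<in> arcs_ends (with_proj T \<restriction> S)" if "(a, b) \<in> parcs T" "a \<in> S" "b \<in> S" for a b
        using that by (simp add: arcs_ends_conv image_iff)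
      have toroot: "h i \<rightarrow>\<^sup>*\<^bsub>with_proj T \<restriction> S\<^esub> h 0" if "i < s" for i
        by (rule par_tree_reaches_root[where par = par and s = s])
           (use that IH(1) arcsS endsS in \<open>auto simp: S_def intro: H.wf_digraph_axioms\<close>)
      have fromroot: "h 0 \<rightarrow>\<^sup>*\<^bsub>with_proj T \<restriction> S\<^esub> h i" if "i < s" for i
      proof -
        have "symmetric (with_proj T \<restriction> S)"
          using induced_graph_imp_symmetric[OF sym_arcs induced_induce[OF S]] .
        from symmetric_reachable[OF this toroot[OF that]] show ?thesis .
      qed
      \<comment> \<open>Two neighbours of \<open>x\<close> in \<open>S\<close> are joined inside
        \<open>S\<close> via the root, and the path closes up through \<open>x\<close>.\<close>
      have uniq: "j = i0" if "j < s" "(h j, x) \<in> parcs T" for j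
      proof (rule ccontr)
        assume "j \<noteq> i0"
        then have "h i0 \<noteq> h j" using IH(2) that i0 by (auto dest: inj_onD)
        moreover have "h i0 \<rightarrow>\<^sup>*\<^bsub>with_proj T \<restriction> S\<^esub> h j"
          using H.reachable_trans[OF toroot[OF i0] fromroot[OF that(1)]] .
        moreover have "(x, h i0) \<in> parcs T" using e arcs_symmetric by blast
        ultimately have "\<exists>c. pre_digraph.cycle (with_proj T) c \<and> 3 \<le> length c"
          by (intro cycle_through_new_vertex[OF pair_graph S x _ _ _ that(2)])
        then show False using nocyc by contradiction
      qed
      define h' where "h' = h(s := x)"
      define par' where "par' = par(s := i0)"
      have "(h' i, h' j) \<in> parcs T \<longleftrightarrow> par_edge par' i j" if ij: "i < Suc s" "j < Suc s" for i j
      proof -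
        have ed: "(h i, x) \<in> parcs T \<longleftrightarrow> i = i0" "(x, h i) \<in> parcs T \<longleftrightarrow> i = i0" if "i < s" for i
          using uniq[OF that] e arcs_symmetric by blast+
        consider "i < s" "j < s" | "i < s" "j = s" | "i = s" "j < s" | "i = s" "j = s"
          using ij unfolding less_Suc_eq by blast
        then show ?thesis
        proof cases
          case 1
          then have "h' i = h i" "h' j = h j" "par' i = par i" "par' j = par j"
            by (simp_all add: h'_def par'_def)
          then show ?thesis using IH(4)[OF 1] by (simp add: par_edge_def)
        next
          case 2
          then have "h' i = h i" "h' j = x" "par' i = par i" "par' j = i0"
            by (simp_all add: h'_def par'_def)
          moreover have "\<not> (0 < i \<and> par i = s)" using IH(1)[of i] 2 by force
          ultimately show ?thesis using ed(1)[of i] 2 False by (auto simp: par_edge_def)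
        next
          case 3
          then have "h' i = x" "h' j = h j" "par' i = i0" "par' j = par j"
            by (simp_all add: h'_def par'_def)
          moreover have "\<not> (0 < j \<and> par j = s)" using IH(1)[of j] 3 by force
          ultimately show ?thesis using ed(2)[of j] 3 False by (auto simp: par_edge_def)
        next
          case 4 then show ?thesis using no_loops'[of x x] i0 by (auto simp: h'_def par'_def par_edge_def)
        qed
      qed
      moreover have "inj_on h' {..<Suc s}"
        using IH(2) x(2) unfolding h'_def S_def lessThan_Suc by (simp add: inj_on_fun_updI)
      moreover have "h' ` {..<Suc s} \<subseteq> pverts T"
        using x(1) IH(3) unfolding h'_def lessThan_Suc by auto
      moreover have "\<forall>i. 0 < i \<longrightarrow> i < Suc s \<longrightarrow> par' i < i"
        using IH(1) i0 by (simp add: par'_def less_Suc_eq)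
      ultimately show ?thesis by (intro exI[of _ h'] exI[of _ par'] conjI) auto
    qed
  qed simp
  define t where "t = card (pverts T)"
  have "0 < t" using ne by (simp add: t_def card_gt_0_iff pair_finite_verts)
  then obtain h par where H: "\<forall>i. 0 < i \<longrightarrow> i < t \<longrightarrow> par i < i" "inj_on h {..<t}"
     "h ` {..<t} \<subseteq> pverts T"
     "\<forall>i<t. \<forall>j<t. (h i, h j) \<in> parcs T \<longleftrightarrow> par_edge par i j"
    using step[OF \<open>0 < t\<close> eq_refl[OF t_def]] by (elim exE conjE) (rule that)
  have "h ` {..<t} = pverts T"
    using H(2,3) by (intro card_subset_eq) (auto simp: card_image t_def pair_finite_verts)
  then show ?thesis using that[of t par h] H \<open>0 < t\<close> by (simp add: bij_betw_def)
qed

section \<open>Matchings as families of copies\<close>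

text \<open>The equivalence ranges over all pairs of copies, so it says both that each copy is
  induced and that distinct copies span no edge. The index type is open: copies are indexed by
  numbers when they are built and by their own roots when they are counted.\<close>

definition tree_copies :: "nat \<Rightarrow> (nat \<Rightarrow> nat) \<Rightarrow> ('v \<Rightarrow> 'v \<Rightarrow> bool) \<Rightarrow> 'i set \<Rightarrow> ('i \<times> nat \<Rightarrow> 'v) \<Rightarrow> bool" where
  "tree_copies t par adj I g \<longleftrightarrow> inj_on g (I \<times> {..<t}) \<and>
     (\<forall>a\<in>I. \<forall>b\<in>I. \<forall>i<t. \<forall>j<t. adj (g (a, i)) (g (b, j)) \<longleftrightarrow> a = b \<and> par_edge par i j)"

text \<open>In the general notion an isomorphism also maps arcs and supplies new head and tail
  functions. For arcs that are pairs these functions must be the projections, so the arc map is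
  determined by the vertex map.\<close>

lemma digraph_iso_induce_iff:
  assumes "pair_wf_digraph G" "pair_wf_digraph T"
  shows "digraph_iso (with_proj G \<restriction> S) (with_proj T) \<longleftrightarrow>
    (\<exists>\<phi>. bij_betw \<phi> S (pverts T) \<and> (\<forall>x\<in>S. \<forall>y\<in>S. (x, y) \<in> parcs G \<longleftrightarrow> (\<phi> x, \<phi> y) \<in> parcs T))"
    (is "?L \<longleftrightarrow> ?R")
proof
  assume ?L
  then obtain f where f: "pre_digraph.digraph_isomorphism (with_proj G \<restriction> S) f"
    and eq: "with_proj T = app_iso f (with_proj G \<restriction> S)" by (auto simp: digraph_iso_def)
  define \<phi> where "\<phi> = iso_verts f"
  have V: "pverts T = \<phi> ` S" using arg_cong[OF eq, of verts] by (simp add: \<phi>_def)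
  have A: "parcs T = iso_arcs f ` {e \<in> parcs G. fst e \<in> S \<and> snd e \<in> S}"
    using arg_cong[OF eq, of arcs] by simp
  have tl: "iso_tail f = fst" and hd: "iso_head f = snd"
    using arg_cong[OF eq, of tail] arg_cong[OF eq, of head] by simp_all
  have inj: "inj_on \<phi> S" and e: "\<And>a. a \<in> parcs G \<Longrightarrow> fst a \<in> S \<Longrightarrow> snd a \<in> S \<Longrightarrow>
      \<phi> (fst a) = fst (iso_arcs f a) \<and> \<phi> (snd a) = snd (iso_arcs f a)"
    using f unfolding pre_digraph.digraph_isomorphism_def by (auto simp: \<phi>_def tl hd)
  have e': "iso_arcs f a = (\<phi> (fst a), \<phi> (snd a))"
    if "a \<in> parcs G" "fst a \<in> S" "snd a \<in> S" for a
    using e[OF that] by (simp add: prod_eq_iff)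
  have "(x, y) \<in> parcs G \<longleftrightarrow> (\<phi> x, \<phi> y) \<in> parcs T" if "x \<in> S" "y \<in> S" for x y
  proof
    assume "(x, y) \<in> parcs G"
    then show "(\<phi> x, \<phi> y) \<in> parcs T" unfolding A using e'[of "(x, y)"] that
      by (intro image_eqI[of _ _ "(x, y)"]) auto
  next
    assume "(\<phi> x, \<phi> y) \<in> parcs T"
    then obtain a where a: "a \<in> parcs G" "fst a \<in> S" "snd a \<in> S" "(\<phi> x, \<phi> y) = iso_arcs f a"
      unfolding A by blast
    then have "\<phi> x = \<phi> (fst a)" "\<phi> y = \<phi> (snd a)" using e' by auto
    then have "x = fst a" "y = snd a" using inj a that by (auto dest: inj_onD)
    then show "(x, y) \<in> parcs G" using a by simp
  qed
  then show ?R using V inj by (auto simp: bij_betw_def)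
next
  assume ?R
  then obtain \<phi> where \<phi>: "bij_betw \<phi> S (pverts T)"
    and e: "\<And>x y. x \<in> S \<Longrightarrow> y \<in> S \<Longrightarrow> (x, y) \<in> parcs G \<longleftrightarrow> (\<phi> x, \<phi> y) \<in> parcs T" by blast
  define f where "f = \<lparr>iso_verts = \<phi>, iso_arcs = map_prod \<phi> \<phi>, iso_head = snd, iso_tail = fst\<rparr>"
  interpret G: pair_wf_digraph G by fact
  interpret T: pair_wf_digraph T by fact
  have inj: "inj_on \<phi> S" and im: "\<phi> ` S = pverts T" using \<phi> by (auto simp: bij_betw_def)
  have A: "map_prod \<phi> \<phi> ` {e \<in> parcs G. fst e \<in> S \<and> snd e \<in> S} = parcs T" (is "?A = _")
  proof (intro equalityI subsetI)
    fix z assume "z \<in> ?A"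
    then show "z \<in> parcs T" using e by auto
  next
    fix z assume z: "z \<in> parcs T"
    then have "fst z \<in> \<phi> ` S" "snd z \<in> \<phi> ` S"
      using im T.arc_fst_in_verts T.arc_snd_in_verts by auto
    then obtain x y where xy: "x \<in> S" "y \<in> S" "z = (\<phi> x, \<phi> y)" by (metis imageE prod.collapse)
    then have "(x, y) \<in> parcs G" using e z by simp
    then show "z \<in> ?A" using xy by (intro image_eqI[of _ _ "(x, y)"]) auto
  qed
  have "pre_digraph.digraph_isomorphism (with_proj G \<restriction> S) f"
    unfolding pre_digraph.digraph_isomorphism_def
  proof (intro conjI ballI)
    show "wf_digraph (with_proj G \<restriction> S)" by (rule G.wellformed_induce_subgraph)
    show "inj_on (iso_verts f) (verts (with_proj G \<restriction> S))" using inj by (simp add: f_def)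
    show "inj_on (iso_arcs f) (arcs (with_proj G \<restriction> S))"
      using inj by (auto simp: f_def intro!: inj_onI dest: inj_onD)
  qed (auto simp: f_def)
  moreover have "with_proj T = app_iso f (with_proj G \<restriction> S)"
    by (rule pre_digraph.equality) (simp_all add: f_def im A)
  ultimately show ?L unfolding digraph_iso_def by blast
qed

lemma is_matching_of_iff_scc_of:
  assumes "sym_digraph H"
  shows "is_matching_of T H \<longleftrightarrow>
    (\<forall>u\<in>verts H. digraph_iso (H \<restriction> pre_digraph.scc_of H u) (with_proj T))"
proof -
  interpret sym_digraph H by fact
  show ?thesis unfolding is_matching_of_def sccs_conv_sccs_verts sccs_verts_conv_scc_of by auto
qed

lemma (in pair_pseudo_graph) sym_digraph_induce:
  assumes "U \<subseteq> pverts G"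
  shows "sym_digraph (with_proj G \<restriction> U)"
  using induced_graph_imp_symmetric[OF sym_arcs induced_induce[OF assms]] wellformed_induce_subgraph
  by (intro sym_digraph.intro sym_digraph_axioms.intro)

lemma induce_induce_subset: "S \<subseteq> U \<Longrightarrow> (G \<restriction> U) \<restriction> S = G \<restriction> S"
  by (auto simp: induce_subgraph_def)

locale par_tree =
  fixes t :: nat and par :: "nat \<Rightarrow> nat"
  assumes t_pos: "0 < t" and par_less: "\<And>i. 0 < i \<Longrightarrow> i < t \<Longrightarrow> par i < i"

locale enumerated_tree = par_tree t par for t :: nat and par :: "nat \<Rightarrow> nat" +
  fixes T :: "'a pair_pre_digraph" and h :: "nat \<Rightarrow> 'a"
  assumes wf_T: "pair_wf_digraph T"
    and bij_h: "bij_betw h {..<t} (pverts T)"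
    and arcs_h: "\<And>i j. i < t \<Longrightarrow> j < t \<Longrightarrow> (h i, h j) \<in> parcs T \<longleftrightarrow> par_edge par i j"
begin

lemma digraph_iso_induce_tree_iff:
  assumes "pair_wf_digraph G"
  shows "digraph_iso (with_proj G \<restriction> S) (with_proj T) \<longleftrightarrow>
    (\<exists>g. bij_betw g {..<t} S \<and> (\<forall>i<t. \<forall>j<t. (g i, g j) \<in> parcs G \<longleftrightarrow> par_edge par i j))"
    (is "_ \<longleftrightarrow> ?R")
  unfolding digraph_iso_induce_iff[OF assms wf_T]
proof
  assume "\<exists>\<phi>. bij_betw \<phi> S (pverts T) \<and> (\<forall>x\<in>S. \<forall>y\<in>S. (x, y) \<in> parcs G \<longleftrightarrow> (\<phi> x, \<phi> y) \<in> parcs T)"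
  then obtain \<phi> where \<phi>: "bij_betw \<phi> S (pverts T)"
    "\<And>x y. x \<in> S \<Longrightarrow> y \<in> S \<Longrightarrow> (x, y) \<in> parcs G \<longleftrightarrow> (\<phi> x, \<phi> y) \<in> parcs T" by blast
  define g where "g = the_inv_into S \<phi> \<circ> h"
  have g: "bij_betw g {..<t} S"
    unfolding g_def using bij_h bij_betw_the_inv_into[OF \<phi>(1)] by (rule bij_betw_trans)
  have "\<phi> (g i) = h i" "g i \<in> S" if "i < t" for i
  proof -
    have "h i \<in> \<phi> ` S" using bij_h \<phi>(1) that by (auto simp: bij_betw_def)
    then show "\<phi> (g i) = h i" unfolding g_def using \<phi>(1)
      by (simp add: bij_betw_def f_the_inv_into_f)
    show "g i \<in> S" using g that by (auto simp: bij_betw_def)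
  qed
  then show ?R using g \<phi>(2) arcs_h by (intro exI[of _ g]) auto
next
  assume ?R
  then obtain g where g: "bij_betw g {..<t} S"
    "\<And>i j. i < t \<Longrightarrow> j < t \<Longrightarrow> (g i, g j) \<in> parcs G \<longleftrightarrow> par_edge par i j" by blast
  define \<phi> where "\<phi> = h \<circ> the_inv_into {..<t} g"
  have \<phi>: "bij_betw \<phi> S (pverts T)"
    unfolding \<phi>_def using bij_betw_the_inv_into[OF g(1)] bij_h by (rule bij_betw_trans)
  have "\<phi> (g i) = h i" if "i < t" for i
    unfolding \<phi>_def using g(1) that by (simp add: bij_betw_def the_inv_into_f_f)
  moreover have "S = g ` {..<t}" using g(1) by (simp add: bij_betw_def)
  ultimately show "\<exists>\<phi>. bij_betw \<phi> S (pverts T) \<and>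
      (\<forall>x\<in>S. \<forall>y\<in>S. (x, y) \<in> parcs G \<longleftrightarrow> (\<phi> x, \<phi> y) \<in> parcs T)"
    using \<phi> g(2) arcs_h by (intro exI[of _ \<phi>]) auto
qed

text \<open>Each copy is connected through its root, and by the adjacency condition no arc of the
  induced subgraph leaves it; so the components are exactly the copies.\<close>

lemma is_matching_of_tree_copies:
  assumes G: "pair_pseudo_graph G" and U: "U = g ` (I \<times> {..<t})" "U \<subseteq> pverts G"
    and c: "tree_copies t par (\<lambda>u v. (u, v) \<in> parcs G) I g"
  shows "is_matching_of T (with_proj G \<restriction> U)"
proof -
  interpret G: pair_pseudo_graph G by fact
  define H where "H = with_proj G \<restriction> U"
  interpret H: sym_digraph H
    unfolding H_def using U(2) by (rule G.sym_digraph_induce)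
  have inj: "inj_on g (I \<times> {..<t})" and adj: "\<And>a b i j. a \<in> I \<Longrightarrow> b \<in> I \<Longrightarrow> i < t \<Longrightarrow> j < t \<Longrightarrow>
      (g (a, i), g (b, j)) \<in> parcs G \<longleftrightarrow> a = b \<and> par_edge par i j"
    using c by (auto simp: tree_copies_def)
  have ends: "arcs_ends H = {(u, v). u \<in> U \<and> v \<in> U \<and> (u, v) \<in> parcs G}"
    by (auto simp: H_def arcs_ends_conv image_iff)
  have vH [simp]: "verts H = U" by (simp add: H_def)
  have scc: "H.scc_of (g (a, i)) = g ` ({a} \<times> {..<t})" if a: "a \<in> I" and i: "i < t" for a i
  proof -
    have to0: "g (a, j) \<rightarrow>\<^sup>*\<^bsub>H\<^esub> g (a, 0)" if "j < t" for j
    proof (rule par_tree_reaches_root[where h = "\<lambda>j. g (a, j)" and s = t and par = par])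
      fix j assume j: "0 < j" "j < t"
      then have "par j < t" using par_less[OF j] by linarith
      then show "(g (a, j), g (a, par j)) \<in> arcs_ends H"
        unfolding ends using j a adj[OF a a j(2) \<open>par j < t\<close>] by (auto simp: U par_edge_def)
    qed (use that a par_less in \<open>auto simp: U H.wf_digraph_axioms\<close>)
    show ?thesis
    proof (intro equalityI subsetI)
      fix v assume "v \<in> H.scc_of (g (a, i))"
      then have "g (a, i) \<rightarrow>\<^sup>*\<^bsub>H\<^esub> v" by (simp add: H.scc_of_def)
      then show "v \<in> g ` ({a} \<times> {..<t})"
        unfolding reachable_def
      proof (induction rule: rtrancl_on_induct)
        case base then show ?case using i by auto
      next
        case (step y z)
        then obtain j where j: "j < t" "y = g (a, j)" by auto
        obtain b k where b: "b \<in> I" "k < t" "z = g (b, k)" using step.hyps by (auto simp: U)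
        have "(y, z) \<in> parcs G" using step.hyps by (auto simp: ends)
        then have "a = b" using adj[OF a b(1) j(1) b(2)] j b by simp
        then show ?case using b by auto
      qed
    next
      fix v assume "v \<in> g ` ({a} \<times> {..<t})"
      then obtain j where "j < t" "v = g (a, j)" by auto
      then have "v \<rightarrow>\<^sup>*\<^bsub>H\<^esub> g (a, i)"
        using H.reachable_trans[OF to0 H.symmetric_reachable'[OF to0[OF i]]] by simp
      then show "v \<in> H.scc_of (g (a, i))" by (rule H.scc_ofI_reachable)
    qed
  qed
  have "digraph_iso (H \<restriction> H.scc_of u) (with_proj T)" if u: "u \<in> verts H" for u
  proof -
    obtain a i where a: "a \<in> I" "i < t" "u = g (a, i)" using u by (auto simp: U)
    have "g ` ({a} \<times> {..<t}) \<subseteq> U" using a by (auto simp: U)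
    then have "H \<restriction> H.scc_of u = with_proj G \<restriction> g ` ({a} \<times> {..<t})"
      using scc[OF a(1,2)] a(3) by (simp add: H_def induce_induce_subset)
    moreover have "digraph_iso \<dots> (with_proj T)"
      unfolding digraph_iso_induce_tree_iff[OF G.pair_wf_digraph_axioms]
    proof (intro exI[of _ "\<lambda>i. g (a, i)"] conjI)
      show "bij_betw (\<lambda>i. g (a, i)) {..<t} (g ` ({a} \<times> {..<t}))"
        using inj a by (auto simp: bij_betw_def inj_on_def)
    qed (use adj a in auto)
    ultimately show ?thesis by simp
  qed
  then show ?thesis unfolding H_def[symmetric] is_matching_of_iff_scc_of[OF H.sym_digraph_axioms] by blast
qed

text \<open>Each copy is indexed by its own root, so the index set \<open>I\<close> consists of
  vertices of the graph and carries no order. The first moment count exploits this.\<close>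

lemma tree_copies_of_is_matching:
  assumes G: "pair_pseudo_graph G" and U: "U \<subseteq> pverts G" and m: "is_matching_of T (with_proj G \<restriction> U)"
  obtains I g where "I \<subseteq> U" "U = g ` (I \<times> {..<t})" "\<And>v. v \<in> I \<Longrightarrow> g (v, 0) = v"
    "tree_copies t par (\<lambda>u v. (u, v) \<in> parcs G) I g"
proof -
  interpret G: pair_pseudo_graph G by fact
  define H where "H = with_proj G \<restriction> U"
  interpret H: sym_digraph H
    unfolding H_def using U by (rule G.sym_digraph_induce)
  have ends: "arcs_ends H = {(u, v). u \<in> U \<and> v \<in> U \<and> (u, v) \<in> parcs G}"
    by (auto simp: H_def arcs_ends_conv image_iff)
  have vH [simp]: "verts H = U" by (simp add: H_def)
  have sccU: "H.scc_of u \<subseteq> U" for u by (auto simp: H.scc_of_def dest: H.reachable_in_verts)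
  have "\<exists>g. bij_betw g {..<t} (H.scc_of u) \<and>
      (\<forall>i<t. \<forall>j<t. (g i, g j) \<in> parcs G \<longleftrightarrow> par_edge par i j)" if "u \<in> U" for u
  proof -
    have "digraph_iso (H \<restriction> H.scc_of u) (with_proj T)"
      using m[folded H_def] that unfolding is_matching_of_iff_scc_of[OF H.sym_digraph_axioms] by simp
    then show ?thesis
      by (simp add: H_def induce_induce_subset[OF sccU, unfolded H_def]
          digraph_iso_induce_tree_iff[OF G.pair_wf_digraph_axioms])
  qed
  \<comment> \<open>The isomorphism is chosen per component, not per vertex: all vertices of a
    component must share one labelling and one root.\<close>
  then have "\<forall>S\<in>H.scc_of ` U. \<exists>g. bij_betw g {..<t} S \<and>
      (\<forall>i<t. \<forall>j<t. (g i, g j) \<in> parcs G \<longleftrightarrow> par_edge par i j)" by blast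
  then obtain f where f: "\<And>u. u \<in> U \<Longrightarrow> bij_betw (f (H.scc_of u)) {..<t} (H.scc_of u)"
    "\<And>u i j. u \<in> U \<Longrightarrow> i < t \<Longrightarrow> j < t \<Longrightarrow>
      (f (H.scc_of u) i, f (H.scc_of u) j) \<in> parcs G \<longleftrightarrow> par_edge par i j"
    unfolding bchoice_iff by blast
  define I where "I = (\<lambda>u. f (H.scc_of u) 0) ` U"
  define g where "g = (\<lambda>(v, i). f (H.scc_of v) i)"
  have fin: "f (H.scc_of u) i \<in> H.scc_of u" if "u \<in> U" "i < t" for u i
    using f(1)[OF that(1)] that(2) by (auto simp: bij_betw_def)
  have sccf: "H.scc_of (f (H.scc_of u) i) = H.scc_of u" if "u \<in> U" "i < t" for u i
    using H.scc_of_eq[OF fin[OF that]] .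
  have IU: "I \<subseteq> U" using fin sccU t_pos by (auto simp: I_def)
  have g0: "g (v, 0) = v" if "v \<in> I" for v
    using that sccf t_pos by (auto simp: I_def g_def)
  have gin: "g (v, i) \<in> H.scc_of v" if "v \<in> I" "i < t" for v i
    using fin that IU by (auto simp: g_def)
  have same: "a = b" if "a \<in> I" "b \<in> I" "i < t" "j < t" "g (b, j) \<in> H.scc_of (g (a, i))" for a b i j
  proof -
    have "H.scc_of b = H.scc_of a"
      using H.scc_of_eq[OF gin[OF that(1,3)]] H.scc_of_eq[OF gin[OF that(2,4)]]
        H.scc_of_eq[OF that(5)] by simp
    then show ?thesis using g0[OF that(1)] g0[OF that(2)] by (simp add: g_def)
  qed
  have inj: "inj_on g (I \<times> {..<t})"
  proof (rule inj_onI)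
    fix x y assume xy: "x \<in> I \<times> {..<t}" "y \<in> I \<times> {..<t}" "g x = g y"
    obtain a i b j where [simp]: "x = (a, i)" "y = (b, j)" by (cases x, cases y)
    have *: "a \<in> I" "i < t" "b \<in> I" "j < t" "g (a, i) = g (b, j)" using xy by simp_all
    then have "g (b, j) \<in> H.scc_of (g (a, i))"
      using H.in_scc_of_self[of "g (b, j)"] gin[of b j] sccU by auto
    then have ab: "a = b" using same * by blast
    then have "f (H.scc_of b) i = f (H.scc_of b) j" using * by (simp add: g_def)
    then have "i = j" using f(1)[of b] * IU by (auto simp: bij_betw_def dest: inj_onD)
    then show "x = y" using ab by simp
  qed
  have adj: "(g (a, i), g (b, j)) \<in> parcs G \<longleftrightarrow> a = b \<and> par_edge par i j"
    if "a \<in> I" "b \<in> I" "i < t" "j < t" for a b i j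
  proof (cases "a = b")
    case True
    then show ?thesis using f(2)[of b i j] that IU by (auto simp: g_def)
  next
    case False
    have "g (b, j) \<in> H.scc_of (g (a, i))" if "(g (a, i), g (b, j)) \<in> parcs G"
    proof -
      have "(g (a, i), g (b, j)) \<in> arcs_ends H"
        using that gin sccU \<open>a \<in> I\<close> \<open>b \<in> I\<close> \<open>i < t\<close> \<open>j < t\<close> unfolding ends by blast
      then show ?thesis using H.scc_ofI_reachable' H.reachable_adjI by blast
    qed
    then show ?thesis using same that False by blast
  qed
  have "U = g ` (I \<times> {..<t})"
  proof (intro equalityI subsetI)
    fix u assume u: "u \<in> U"
    then have "u \<in> H.scc_of u" using H.in_scc_of_self by simp
    then obtain i where i: "i < t" "u = f (H.scc_of u) i"
      using f(1)[OF u] by (auto simp: bij_betw_def)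
    have "u = g (f (H.scc_of u) 0, i)" using i sccf[OF u t_pos] by (simp add: g_def)
    moreover have "f (H.scc_of u) 0 \<in> I" using u by (simp add: I_def)
    ultimately show "u \<in> g ` (I \<times> {..<t})" using i(1) by blast
  next
    fix u assume "u \<in> g ` (I \<times> {..<t})"
    then show "u \<in> U" using gin sccU by auto
  qed
  then show ?thesis using that[of I g] IU g0 inj adj by (simp add: tree_copies_def)
qed

end

section \<open>McDiarmid's inequality\<close>

lemma expectation_pair_pmf_finite:
  fixes f :: "'a \<times> 'b \<Rightarrow> real"
  assumes "finite (set_pmf p)" "finite (set_pmf q)"
  shows "measure_pmf.expectation (pair_pmf p q) f =
    measure_pmf.expectation p (\<lambda>x. measure_pmf.expectation q (\<lambda>y. f (x, y)))"
proof -
  have "measure_pmf.expectation (pair_pmf p q) f =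
      (\<Sum>z\<in>set_pmf p \<times> set_pmf q. f z * pmf (pair_pmf p q) z)"
    by (rule integral_measure_pmf_real) (use assms in auto)
  also have "\<dots> = (\<Sum>x\<in>set_pmf p. \<Sum>y\<in>set_pmf q. f (x, y) * (pmf p x * pmf q y))"
    by (subst sum.cartesian_product) (auto intro!: sum.cong simp: pmf_pair)
  also have "\<dots> = (\<Sum>x\<in>set_pmf p. (\<Sum>y\<in>set_pmf q. f (x, y) * pmf q y) * pmf p x)"
    by (simp add: sum_distrib_left mult_ac)
  also have "\<dots> = measure_pmf.expectation p (\<lambda>x. measure_pmf.expectation q (\<lambda>y. f (x, y)))"
    by (simp add: integral_measure_pmf_real[OF assms(1)] integral_measure_pmf_real[OF assms(2)])
  finally show ?thesis .
qed

lemma finite_set_Pi_pmf: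
  assumes "finite A" "\<And>e. finite (set_pmf (D e))"
  shows "finite (set_pmf (Pi_pmf A d D))"
  using assms by (simp add: set_Pi_pmf finite_PiE_dflt)

text \<open>An oscillation of at most \<open>c\<close> confines \<open>F\<close> to an interval of
  length \<open>c\<close> starting at its infimum. An interval centred at a value of
  \<open>F\<close> would have length 2c and spoil the constant in Hoeffding's lemma.\<close>

lemma expectation_exp_le_of_bounded_differences:
  fixes F :: "'a \<Rightarrow> real"
  assumes fin: "finite (set_pmf r)" and c: "\<And>x y. \<bar>F x - F y\<bar> \<le> c" and s: "s > 0"
  shows "measure_pmf.expectation r (\<lambda>y. exp (s * (F y - measure_pmf.expectation r F)))
    \<le> exp (s\<^sup>2 * c\<^sup>2 / 8)"
proof -
  define a where "a = (INF y. F y)"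
  have diff: "F x - c \<le> F y" for x y using c[of x y] by (simp add: abs_le_iff)
  have bdd: "bdd_below (range F)"
  proof (rule bdd_belowI)
    fix z assume "z \<in> range F"
    then show "F undefined - c \<le> z" using diff by auto
  qed
  have lo: "a \<le> F y" for y unfolding a_def using bdd by (simp add: cINF_lower)
  have "F y - c \<le> a" for y unfolding a_def by (rule cINF_greatest) (use diff in auto)
  then have hi: "F y \<le> a + c" for y by (simp add: diff_le_eq)
  interpret I: interval_bounded_random_variable "measure_pmf r" F a "a + c"
    by unfold_locales (use lo hi in auto)
  have "(\<integral>\<^sup>+ x. exp (s * (F x - measure_pmf.expectation r F)) \<partial>r) \<le> ennreal (exp (s\<^sup>2 * c\<^sup>2 / 8))"
    using I.Hoeffdings_lemma_nn_integral[OF s] by simp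
  moreover have "(\<integral>\<^sup>+ x. exp (s * (F x - measure_pmf.expectation r F)) \<partial>r) =
      ennreal (measure_pmf.expectation r (\<lambda>y. exp (s * (F y - measure_pmf.expectation r F))))"
    by (rule nn_integral_eq_integral) (auto intro: integrable_measure_pmf_finite[OF fin])
  ultimately show ?thesis by simp
qed

text \<open>Induction on the groups \<open>A i\<close>, which play the role of the independent
  coordinates. Averaging \<open>f\<close> over one group gives \<open>g\<close>, which still has
  differences at most \<open>c\<close> in the other groups. With those fixed, \<open>f\<close>
  varies by at most \<open>c\<close> and has mean \<open>g\<close>, so Hoeffding's lemma contributes
  one factor exp (s^2 c^2 / 8).\<close>

lemma mcdiarmid_mgf:
  fixes f :: "('e \<Rightarrow> 'b) \<Rightarrow> real"
  assumes "finite I" "\<And>i. i \<in> I \<Longrightarrow> finite (A i)" "disjoint_family_on A I"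
    and finD: "\<And>e. finite (set_pmf (D e))" and s: "s > 0"
    and lip: "\<And>i x y. i \<in> I \<Longrightarrow> (\<And>e. e \<notin> A i \<Longrightarrow> x e = y e) \<Longrightarrow> \<bar>f x - f y\<bar> \<le> c"
  shows "measure_pmf.expectation (Pi_pmf (\<Union>i\<in>I. A i) d D)
      (\<lambda>x. exp (s * (f x - measure_pmf.expectation (Pi_pmf (\<Union>i\<in>I. A i) d D) f)))
    \<le> exp (s\<^sup>2 * c\<^sup>2 * card I / 8)"
  using assms(1-3) lip
proof (induction I arbitrary: f rule: finite_induct)
  case empty
  then show ?case by simp
next
  case (insert i I)
  define q where "q = Pi_pmf (\<Union>i\<in>I. A i) d D"
  define r where "r = Pi_pmf (A i) d D"
  define m where "m = (\<lambda>y x e. if e \<in> A i then y e else x e :: 'b)"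
  define g where "g = (\<lambda>x. measure_pmf.expectation r (\<lambda>y. f (m y x)))"
  have finq: "finite (set_pmf q)" and finr: "finite (set_pmf r)"
    unfolding q_def r_def using insert by (auto intro!: finite_set_Pi_pmf finD)
  have disj: "A i \<inter> (\<Union>i\<in>I. A i) = {}"
    using insert.prems(2) insert.hyps by (fastforce simp: disjoint_family_on_def)
  have dec: "Pi_pmf (\<Union>i\<in>insert i I. A i) d D = map_pmf (\<lambda>(x, y). m y x) (pair_pmf q r)"
  proof -
    have "Pi_pmf (\<Union>i\<in>insert i I. A i) d D = Pi_pmf (A i \<union> (\<Union>i\<in>I. A i)) d D" by simp
    also have "\<dots> = map_pmf (\<lambda>(y, x). m y x) (pair_pmf r q)"
      using insert disj by (subst Pi_pmf_union) (auto simp: m_def q_def r_def)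
    also have "pair_pmf r q = map_pmf (\<lambda>(x, y). (y, x)) (pair_pmf q r)" by (rule pair_commute_pmf)
    finally show ?thesis by (simp add: map_pmf_comp case_prod_unfold)
  qed
  have E: "measure_pmf.expectation (Pi_pmf (\<Union>i\<in>insert i I. A i) d D) F =
      measure_pmf.expectation q (\<lambda>x. measure_pmf.expectation r (\<lambda>y. F (m y x)))"
    for F :: "('e \<Rightarrow> 'b) \<Rightarrow> real"
    unfolding dec by (simp add: expectation_pair_pmf_finite[OF finq finr])
  have Ef: "measure_pmf.expectation (Pi_pmf (\<Union>i\<in>insert i I. A i) d D) f = measure_pmf.expectation q g"
    unfolding E g_def ..
  have glip: "\<bar>g x - g y\<bar> \<le> c" if "j \<in> I" "\<And>e. e \<notin> A j \<Longrightarrow> x e = y e" for j x y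
  proof -
    have b: "\<bar>f (m z x) - f (m z y)\<bar> \<le> c" for z
      by (rule insert.prems(3)[of j]) (use that in \<open>auto simp: m_def\<close>)
    have "g x - g y = measure_pmf.expectation r (\<lambda>z. f (m z x) - f (m z y))"
      unfolding g_def by (subst Bochner_Integration.integral_diff)
        (auto intro: integrable_measure_pmf_finite[OF finr])
    also have "\<bar>\<dots>\<bar> \<le> measure_pmf.expectation r (\<lambda>z. \<bar>f (m z x) - f (m z y)\<bar>)"
      by (rule integral_abs_bound)
    also have "\<dots> \<le> measure_pmf.expectation r (\<lambda>z. c)"
      by (rule integral_mono) (use b in \<open>auto intro: integrable_measure_pmf_finite[OF finr]\<close>)
    finally show ?thesis by simp
  qed
  have inner: "measure_pmf.expectation r (\<lambda>y. exp (s * (f (m y x) - g x))) \<le> exp (s\<^sup>2 * c\<^sup>2 / 8)" for x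
    unfolding g_def
    by (rule expectation_exp_le_of_bounded_differences[OF finr _ s], rule insert.prems(3)[of i])
       (auto simp: m_def)
  let ?E = "measure_pmf.expectation q g"
  \<comment> \<open>The integrand splits into a factor depending on \<open>x\<close> only and exp (s
    (f - g)), whose inner mean is bounded uniformly in \<open>x\<close>.\<close>
  have "measure_pmf.expectation q (\<lambda>x. measure_pmf.expectation r (\<lambda>y. exp (s * (f (m y x) - ?E))))
      = measure_pmf.expectation q
          (\<lambda>x. exp (s * (g x - ?E)) * measure_pmf.expectation r (\<lambda>y. exp (s * (f (m y x) - g x))))"
    by (subst Bochner_Integration.integral_mult_right_zero[symmetric])
       (simp add: exp_add[symmetric] algebra_simps)
  also have "\<dots> \<le> measure_pmf.expectation q (\<lambda>x. exp (s * (g x - ?E)) * exp (s\<^sup>2 * c\<^sup>2 / 8))"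
    by (intro integral_mono mult_left_mono inner integrable_measure_pmf_finite[OF finq]) auto
  also have "\<dots> = measure_pmf.expectation q (\<lambda>x. exp (s * (g x - ?E))) * exp (s\<^sup>2 * c\<^sup>2 / 8)"
    by simp
  also have "\<dots> \<le> exp (s\<^sup>2 * c\<^sup>2 * card I / 8) * exp (s\<^sup>2 * c\<^sup>2 / 8)"
    unfolding q_def
    by (intro mult_right_mono insert.IH glip)
       (use insert.prems(1,2) glip in \<open>auto simp: disjoint_family_on_def\<close>)
  also have "\<dots> = exp (s\<^sup>2 * c\<^sup>2 * card (insert i I) / 8)"
    using insert.hyps by (simp add: exp_add[symmetric] field_simps)
  finally show ?case unfolding Ef unfolding E .
qed

lemma mcdiarmid_ge:
  fixes f :: "('e \<Rightarrow> 'b) \<Rightarrow> real" and d :: 'b and c :: real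
  assumes "finite I" "I \<noteq> {}" "\<And>i. i \<in> I \<Longrightarrow> finite (A i)" "disjoint_family_on A I"
    and finD: "\<And>e. finite (set_pmf (D e))" and c: "c > 0" and l: "l \<ge> 0"
    and lip: "\<And>i x y. i \<in> I \<Longrightarrow> (\<And>e. e \<notin> A i \<Longrightarrow> x e = y e) \<Longrightarrow> \<bar>f x - f y\<bar> \<le> c"
  defines "M \<equiv> Pi_pmf (\<Union>i\<in>I. A i) d D"
  shows "measure_pmf.prob M {x. f x \<ge> measure_pmf.expectation M f + l}
    \<le> exp (- 2 * l\<^sup>2 / (card I * c\<^sup>2))"
proof (cases "l = 0")
  case False
  define n where "n = real (card I)"
  have n: "n > 0" using assms(1,2) by (simp add: n_def card_gt_0_iff)
  \<comment> \<open>This \<open>s\<close> minimizes the exponent s^2 c^2 n / 8 - s l of the Markov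
    bound. It is positive only for l > 0; for l = 0 the claim is trivial.\<close>
  define s where "s = 4 * l / (n * c\<^sup>2)"
  have s: "s > 0" using False l n c by (simp add: s_def)
  have finM: "finite (set_pmf M)" unfolding M_def using assms(1,3) finD by (intro finite_set_Pi_pmf) auto
  let ?u = "\<lambda>x. exp (s * (f x - measure_pmf.expectation M f))"
  have "measure_pmf.prob M {x. f x \<ge> measure_pmf.expectation M f + l} \<le>
      measure_pmf.prob M {x \<in> space M. ?u x \<ge> exp (s * l)}"
    using s by (intro measure_pmf.finite_measure_mono) auto
  also have "\<dots> \<le> measure_pmf.expectation M ?u / exp (s * l)"
    by (rule integral_Markov_inequality_measure[where A = UNIV])
       (auto intro: integrable_measure_pmf_finite[OF finM])
  also have "\<dots> \<le> exp (s\<^sup>2 * c\<^sup>2 * n / 8) / exp (s * l)"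
    unfolding M_def n_def
    by (intro divide_right_mono mcdiarmid_mgf assms(1,3,4) finD s lip) auto
  also have "\<dots> = exp (- 2 * l\<^sup>2 / (n * c\<^sup>2))"
    using n c by (simp add: exp_diff[symmetric] s_def field_simps power2_eq_square)
  finally show ?thesis by (simp add: n_def)
qed simp

lemma mcdiarmid_le:
  fixes f :: "('e \<Rightarrow> 'b) \<Rightarrow> real" and d :: 'b and c :: real
  assumes "finite I" "I \<noteq> {}" "\<And>i. i \<in> I \<Longrightarrow> finite (A i)" "disjoint_family_on A I"
    and finD: "\<And>e. finite (set_pmf (D e))" and c: "c > 0" and l: "l \<ge> 0"
    and lip: "\<And>i x y. i \<in> I \<Longrightarrow> (\<And>e. e \<notin> A i \<Longrightarrow> x e = y e) \<Longrightarrow> \<bar>f x - f y\<bar> \<le> c"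
  defines "M \<equiv> Pi_pmf (\<Union>i\<in>I. A i) d D"
  shows "measure_pmf.prob M {x. f x \<le> measure_pmf.expectation M f - l}
    \<le> exp (- 2 * l\<^sup>2 / (card I * c\<^sup>2))"
proof -
  have lip': "\<bar>- f x - - f y\<bar> \<le> c" if "i \<in> I" "\<And>e. e \<notin> A i \<Longrightarrow> x e = y e" for i x y
    using lip[OF that] by (simp add: abs_minus_commute)
  have "measure_pmf.prob M {x. - f x \<ge> measure_pmf.expectation M (\<lambda>x. - f x) + l}
    \<le> exp (- 2 * l\<^sup>2 / (card I * c\<^sup>2))"
    unfolding M_def by (rule mcdiarmid_ge[where f = "\<lambda>x. - f x"]) (fact assms lip')+
  moreover have "{x. - f x \<ge> measure_pmf.expectation M (\<lambda>x. - f x) + l} =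
      {x. f x \<le> measure_pmf.expectation M f - l}" by auto
  ultimately show ?thesis by simp
qed

section \<open>Second moments of patterns\<close>

definition pattern_event :: "'e set \<Rightarrow> 'e set \<Rightarrow> ('e \<Rightarrow> bool) set" where
  "pattern_event R N = {X. (\<forall>e\<in>R. X e) \<and> (\<forall>e\<in>N. \<not> X e)}"

lemma pattern_event_Int:
  "pattern_event R N \<inter> pattern_event R' N' = pattern_event (R \<union> R') (N \<union> N')"
  by (auto simp: pattern_event_def)

lemma prob_pattern_event:
  assumes "finite E" "R \<subseteq> E" "N \<subseteq> E" "R \<inter> N = {}" "0 \<le> p" "p \<le> 1"
  shows "measure_pmf.prob (Pi_pmf E False (\<lambda>_. bernoulli_pmf p)) (pattern_event R N)
    = p ^ card R * (1 - p) ^ card N"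
proof -
  define B where "B = (\<lambda>e. if e \<in> R then {True} else if e \<in> N then {False} else UNIV)"
  have "pattern_event R N = Pi E B"
  proof (intro equalityI subsetI)
    fix X assume X: "X \<in> pattern_event R N"
    show "X \<in> Pi E B"
    proof
      fix e assume "e \<in> E"
      show "X e \<in> B e" using X by (simp add: pattern_event_def B_def)
    qed
  next
    fix X assume X: "X \<in> Pi E B"
    have "X e" if "e \<in> R" for e
      using Pi_mem[OF X, of e] assms(2) that by (auto simp: B_def)
    moreover have "\<not> X e" if "e \<in> N" for e
    proof -
      have "e \<notin> R" "e \<in> E" using that assms(3,4) by auto
      then show ?thesis using Pi_mem[OF X, of e] that by (simp add: B_def)
    qed
    ultimately show "X \<in> pattern_event R N" by (simp add: pattern_event_def)
  qed
  then have "measure_pmf.prob (Pi_pmf E False (\<lambda>_. bernoulli_pmf p)) (pattern_event R N)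
      = (\<Prod>e\<in>E. measure_pmf.prob (bernoulli_pmf p) (B e))"
    using measure_Pi_pmf_Pi[OF assms(1)] by simp
  also have "\<dots> = (\<Prod>e\<in>E. (if e \<in> R then p else 1) * (if e \<in> N then 1 - p else 1))"
    by (intro prod.cong) (use assms in \<open>auto simp: B_def measure_pmf_single\<close>)
  also have "\<dots> = (\<Prod>e\<in>E. if e \<in> R then p else 1) * (\<Prod>e\<in>E. if e \<in> N then 1 - p else 1)"
    by (rule prod.distrib)
  also have "(\<Prod>e\<in>E. if e \<in> R then p else 1) = p ^ card R"
    using assms by (simp add: prod.If_cases Int_absorb1)
  also have "(\<Prod>e\<in>E. if e \<in> N then 1 - p else 1) = (1 - p) ^ card N"
    using assms by (simp add: prod.If_cases Int_absorb1)
  finally show ?thesis .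
qed

text \<open>An edge prescribed by both patterns is paid for twice in the product of the
  probabilities but once in the joint one, hence a correction 1/p or 1/(1-p) per common edge. Both
  exceed 1, so upper bounds on the overlaps suffice. If some edge is both required and forbidden,
  the joint event is empty.\<close>

lemma prob_pattern_event_Int_le:
  assumes E: "finite E" "R \<subseteq> E" "N \<subseteq> E" "R' \<subseteq> E" "N' \<subseteq> E" and p: "0 < p" "p < 1"
    and j: "card (R \<inter> R') \<le> j" and l: "card (N \<inter> N') \<le> l"
  shows "measure_pmf.prob (Pi_pmf E False (\<lambda>_. bernoulli_pmf p))
      (pattern_event R N \<inter> pattern_event R' N')
    \<le> p ^ card R * (1 - p) ^ card N * (p ^ card R' * (1 - p) ^ card N') *
       ((1 / p) ^ j * (1 / (1 - p)) ^ l)" (is "?P \<le> ?B")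
proof (cases "(R \<union> R') \<inter> (N \<union> N') = {}")
  case True
  have fin: "finite R" "finite N" "finite R'" "finite N'" using E finite_subset by blast+
  have cup: "x ^ card (A \<union> B) \<le> x ^ card A * x ^ card B * (1 / x) ^ k"
    if "finite A" "finite B" "card (A \<inter> B) \<le> k" "0 < x" "x < 1" for A B :: "'a set" and x :: real and k
  proof -
    have c: "card A + card B = card (A \<union> B) + card (A \<inter> B)" using card_Un_Int that by blast
    have "x ^ card A * x ^ card B * (1 / x) ^ k = x ^ card (A \<union> B) * (x ^ card (A \<inter> B) / x ^ k)"
      by (simp add: power_add[symmetric] c power_divide)
    moreover have "x ^ card (A \<inter> B) / x ^ k \<ge> 1"
      using that by (simp add: power_decreasing)
    ultimately show ?thesis
      using mult_left_mono[of 1 "x ^ card (A \<inter> B) / x ^ k" "x ^ card (A \<union> B)"] that(4) by simp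
  qed
  have "?P = p ^ card (R \<union> R') * (1 - p) ^ card (N \<union> N')"
    unfolding pattern_event_Int by (rule prob_pattern_event) (use E p True in auto)
  also have "\<dots> \<le> (p ^ card R * p ^ card R' * (1 / p) ^ j) *
      ((1 - p) ^ card N * (1 - p) ^ card N' * (1 / (1 - p)) ^ l)"
    using p by (intro mult_mono cup fin j l) auto
  finally show ?thesis by (simp add: mult_ac)
next
  case False
  then have "pattern_event R N \<inter> pattern_event R' N' = {}"
    unfolding pattern_event_Int by (auto simp: pattern_event_def)
  then show ?thesis using p by simp
qed

text \<open>With X the number of events that occur, the indicator of X > 0 is at least 2aX - a^2 X^2
  for every real \<open>a\<close>, because (1 - aX)^2 is nonnegative. Taking expectations and
  optimizing \<open>a\<close> gives P(X > 0) >= (E X)^2 / E X^2, and \<open>S\<close> bounds the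
  reciprocal of this quotient.\<close>

lemma second_moment_union:
  fixes S P0 :: real
  assumes fin: "finite \<Psi>" "\<Psi> \<noteq> {}" and fM: "finite (set_pmf M)"
    and P0: "0 < P0" "\<And>\<psi>. \<psi> \<in> \<Psi> \<Longrightarrow> measure_pmf.prob M (Ev \<psi>) = P0"
    and S: "\<And>\<phi>. \<phi> \<in> \<Psi> \<Longrightarrow>
      (\<Sum>\<psi>\<in>\<Psi>. measure_pmf.prob M (Ev \<phi> \<inter> Ev \<psi>)) \<le> S * card \<Psi> * P0\<^sup>2"
  shows "measure_pmf.prob M (\<Union>\<psi>\<in>\<Psi>. Ev \<psi>) \<ge> 1 / S"
proof -
  define X where "X = (\<lambda>x. \<Sum>\<psi>\<in>\<Psi>. indicat_real (Ev \<psi>) x)"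
  note int = integrable_measure_pmf_finite[OF fM]
  define c where "c = real (card \<Psi>)"
  have c: "c > 0" using fin by (simp add: c_def card_gt_0_iff)
  have EX: "measure_pmf.expectation M X = c * P0"
    unfolding X_def by (subst Bochner_Integration.integral_sum) (simp_all add: int P0(2) c_def)
  have X2: "(X x)\<^sup>2 = (\<Sum>\<phi>\<in>\<Psi>. \<Sum>\<psi>\<in>\<Psi>. indicat_real (Ev \<phi> \<inter> Ev \<psi>) x)" for x
    unfolding X_def power2_eq_square sum_product by (simp add: indicator_inter_arith)
  have "measure_pmf.expectation M (\<lambda>x. (X x)\<^sup>2) =
      (\<Sum>\<phi>\<in>\<Psi>. \<Sum>\<psi>\<in>\<Psi>. measure_pmf.prob M (Ev \<phi> \<inter> Ev \<psi>))"
    unfolding X2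
    by (subst Bochner_Integration.integral_sum, rule int,
        subst Bochner_Integration.integral_sum, rule int) simp
  also have "\<dots> \<le> (\<Sum>\<phi>\<in>\<Psi>. S * c * P0\<^sup>2)" unfolding c_def by (intro sum_mono S)
  also have "\<dots> = S * (c * P0)\<^sup>2" by (simp add: c_def power2_eq_square)
  finally have EX2: "measure_pmf.expectation M (\<lambda>x. (X x)\<^sup>2) \<le> S * (c * P0)\<^sup>2" .
  have "0 < (c * P0)\<^sup>2" using c P0 by simp
  \<comment> \<open>Nonnegativity of the variance shows S >= 1, which justifies dividing by
    \<open>S\<close> below.\<close>
  moreover have "(c * P0)\<^sup>2 \<le> S * (c * P0)\<^sup>2"
  proof -
    have "0 \<le> measure_pmf.expectation M (\<lambda>x. (X x - c * P0)\<^sup>2)" by simp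
    also have "\<dots> = measure_pmf.expectation M (\<lambda>x. (X x)\<^sup>2) - (c * P0)\<^sup>2"
    proof -
      have "measure_pmf.expectation M (\<lambda>x. (X x - c * P0)\<^sup>2) =
          measure_pmf.expectation M (\<lambda>x. (X x)\<^sup>2 - 2 * (c * P0) * X x + (c * P0)\<^sup>2)"
        by (rule Bochner_Integration.integral_cong) (simp_all add: power2_diff mult_ac)
      also have "\<dots> = measure_pmf.expectation M (\<lambda>x. (X x)\<^sup>2) - 2 * (c * P0) * (c * P0) + (c * P0)\<^sup>2"
        by (subst Bochner_Integration.integral_add, rule int, rule int,
            subst Bochner_Integration.integral_diff, rule int, rule int) (simp add: EX)
      finally show ?thesis by (simp add: power2_eq_square)
    qed
    finally show ?thesis using EX2 by linarith
  qed
  ultimately have S1: "S \<ge> 1" by simp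
  \<comment> \<open>The maximizer of 2a E X - a^2 S (E X)^2.\<close>
  define a where "a = 1 / (S * (c * P0))"
  have "2 * a * (c * P0) - a\<^sup>2 * (S * (c * P0)\<^sup>2) = 1 / S"
    using S1 c P0 by (simp add: a_def power2_eq_square field_simps)
  then have "1 / S \<le> 2 * a * (c * P0) - a\<^sup>2 * measure_pmf.expectation M (\<lambda>x. (X x)\<^sup>2)"
    using mult_left_mono[OF EX2, of "a\<^sup>2"] by simp
  also have "\<dots> = measure_pmf.expectation M (\<lambda>x. 2 * a * X x - a\<^sup>2 * (X x)\<^sup>2)"
    by (subst Bochner_Integration.integral_diff, rule int, rule int) (simp add: EX)
  also have "\<dots> \<le> measure_pmf.expectation M (indicat_real (\<Union>\<psi>\<in>\<Psi>. Ev \<psi>))"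
  proof (rule integral_mono)
    fix x
    show "2 * a * X x - a\<^sup>2 * (X x)\<^sup>2 \<le> indicat_real (\<Union>\<psi>\<in>\<Psi>. Ev \<psi>) x"
    proof (cases "x \<in> (\<Union>\<psi>\<in>\<Psi>. Ev \<psi>)")
      case True
      have "0 \<le> (1 - a * X x)\<^sup>2" by simp
      then show ?thesis using True by (simp add: power2_diff power_mult_distrib)
    next
      case False
      then have "X x = 0" unfolding X_def by (intro sum.neutral) auto
      then show ?thesis by simp
    qed
  qed (auto intro: int)
  finally show ?thesis by simp
qed

section \<open>Sums over permutations and choice functions, weighted by agreement\<close>

lemma card_permutes_agreeing:
  assumes "finite S" "\<sigma> permutes S" "J \<subseteq> S"
  shows "card {\<pi>. \<pi> permutes S \<and> (\<forall>b\<in>J. \<pi> b = \<sigma> b)} = fact (card S - card J)"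
proof -
  \<comment> \<open>Composition with \<sigma> turns fixing \<open>J\<close> pointwise, that is,
    permuting the complement of \<open>J\<close>, into agreement with \<sigma> on
    \<open>J\<close>.\<close>
  have "bij_betw (\<lambda>\<rho>. \<sigma> \<circ> \<rho>) {\<rho>. \<rho> permutes (S - J)} {\<pi>. \<pi> permutes S \<and> (\<forall>b\<in>J. \<pi> b = \<sigma> b)}"
  proof (rule bij_betwI[where g = "\<lambda>\<pi>. inv \<sigma> \<circ> \<pi>"])
    show "(\<lambda>\<rho>. \<sigma> \<circ> \<rho>) \<in> {\<rho>. \<rho> permutes (S - J)} \<rightarrow> {\<pi>. \<pi> permutes S \<and> (\<forall>b\<in>J. \<pi> b = \<sigma> b)}"
    proof
      fix \<rho> assume "\<rho> \<in> {\<rho>. \<rho> permutes (S - J)}"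
      then have \<rho>: "\<rho> permutes (S - J)" by simp
      then have "\<rho> permutes S" by (rule permutes_subset) auto
      then have "(\<sigma> \<circ> \<rho>) permutes S" using assms(2) by (rule permutes_compose)
      moreover have "\<rho> b = b" if "b \<in> J" for b using permutes_not_in[OF \<rho>] that by simp
      ultimately show "\<sigma> \<circ> \<rho> \<in> {\<pi>. \<pi> permutes S \<and> (\<forall>b\<in>J. \<pi> b = \<sigma> b)}" by simp
    qed
    show "(\<lambda>\<pi>. inv \<sigma> \<circ> \<pi>) \<in> {\<pi>. \<pi> permutes S \<and> (\<forall>b\<in>J. \<pi> b = \<sigma> b)} \<rightarrow> {\<rho>. \<rho> permutes (S - J)}"
    proof
      fix \<pi> assume "\<pi> \<in> {\<pi>. \<pi> permutes S \<and> (\<forall>b\<in>J. \<pi> b = \<sigma> b)}"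
      then have \<pi>: "\<pi> permutes S" "\<And>b. b \<in> J \<Longrightarrow> \<pi> b = \<sigma> b" by auto
      have "(inv \<sigma> \<circ> \<pi>) permutes S" using \<pi>(1) permutes_inv[OF assms(2)] permutes_compose by blast
      then show "inv \<sigma> \<circ> \<pi> \<in> {\<rho>. \<rho> permutes (S - J)}"
        using \<pi>(2) permutes_inverses(2)[OF assms(2)]
        by (auto intro: permutes_superset)
    qed
  qed (use permutes_inverses[OF assms(2)] in \<open>auto simp: fun_eq_iff\<close>)
  then have "card {\<pi>. \<pi> permutes S \<and> (\<forall>b\<in>J. \<pi> b = \<sigma> b)} = card {\<rho>. \<rho> permutes (S - J)}"
    by (simp add: bij_betw_same_card)
  also have "\<dots> = fact (card S - card J)"
    using assms by (subst card_permutations[of _ "card S - card J"])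
      (auto simp: card_Diff_subset finite_subset)
  finally show ?thesis .
qed

text \<open>The quotient s^s / s! is a single term of the exponential series at \<open>s\<close>,
  hence at most e^s.\<close>

lemma power_div_exp_le_fact: "(real s / exp 1) ^ s \<le> fact s"
proof -
  have "real s ^ s / fact s \<le> exp (real s)"
    using sum_le_suminf[of "\<lambda>n. real s ^ n /\<^sub>R fact n" "{s}"] exp_converges[of "real s"]
    by (simp add: sums_iff divide_inverse mult.commute)
  then show ?thesis
    by (simp add: power_divide divide_le_eq exp_of_nat_mult[symmetric] mult.commute)
qed

text \<open>The falling factorial k (k-1) ... (k-s+1) is a binomial coefficient, at least (k/s)^s,
  times s!, at least (s/e)^s; so it is at least (k/e)^s.\<close>

lemma fact_diff_le:
  assumes "s \<le> k"
  shows "fact (k - s) \<le> fact k * (exp 1 / real k) ^ s"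
proof (cases "s = 0")
  case False
  have k: "k > 0" using assms False by simp
  have "(real k / exp 1) ^ s = (real k / real s) ^ s * (real s / exp 1) ^ s"
    using False by (simp add: power_mult_distrib[symmetric])
  also have "\<dots> \<le> real (k choose s) * fact s"
    using binomial_ge_n_over_k_pow_k[OF assms, where 'a = real] power_div_exp_le_fact[of s]
    by (intro mult_mono) auto
  also have "\<dots> = fact k / fact (k - s)"
    using assms by (simp add: binomial_fact)
  finally show ?thesis using k by (simp add: power_divide field_simps)
qed simp

text \<open>Each weight is dominated by a sum over all sets \<open>J\<close> of agreements. With k =
  \<open>card S\<close>, a fixed \<open>J\<close> is met by (k - |J|)! permutations, so by kp >= e
  it contributes at most k! (e/(kp))^|J| <= k!, and there are 2^|A| sets. On average the corrections
  1/p of shared edges thus cost only a factor 2 per element of \<open>A\<close>.\<close>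

lemma sum_permutes_agree_le:
  fixes p :: real
  assumes fin: "finite S" and \<sigma>: "\<sigma> permutes S" and A: "A \<subseteq> S" and p: "0 < p" and kp: "exp 1 \<le> card S * p"
  shows "(\<Sum>\<pi> | \<pi> permutes S. (1 / p) ^ card {b \<in> A. \<pi> b = \<sigma> b}) \<le> fact (card S) * 2 ^ card A"
proof -
  let ?k = "card S"
  have finA: "finite A" using fin A finite_subset by blast
  have finP: "finite {\<pi>. \<pi> permutes S}" using finite_permutations[OF fin] .
  have k: "?k > 0" using kp exp_gt_zero[of "1::real"] by (cases "card S") auto
  have "(\<Sum>\<pi> | \<pi> permutes S. (1 / p) ^ card {b \<in> A. \<pi> b = \<sigma> b}) \<le>
      (\<Sum>\<pi> | \<pi> permutes S. \<Sum>J\<in>Pow A. if \<forall>b\<in>J. \<pi> b = \<sigma> b then (1 / p) ^ card J else 0)"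
  proof (rule sum_mono)
    fix \<pi>
    let ?J = "{b \<in> A. \<pi> b = \<sigma> b}"
    have "(1 / p) ^ card ?J = (\<Sum>J\<in>{?J}. if \<forall>b\<in>J. \<pi> b = \<sigma> b then (1 / p) ^ card J else 0)" by simp
    also have "\<dots> \<le> (\<Sum>J\<in>Pow A. if \<forall>b\<in>J. \<pi> b = \<sigma> b then (1 / p) ^ card J else 0)"
      using finA p by (intro sum_mono2) auto
    finally show "(1 / p) ^ card ?J \<le> \<dots>" .
  qed
  also have "\<dots> = (\<Sum>J\<in>Pow A. \<Sum>\<pi> | \<pi> permutes S. if \<forall>b\<in>J. \<pi> b = \<sigma> b then (1 / p) ^ card J else 0)"
    by (rule sum.swap)
  also have "\<dots> = (\<Sum>J\<in>Pow A. fact (?k - card J) * (1 / p) ^ card J)"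
  proof (rule sum.cong)
    fix J assume "J \<in> Pow A"
    then have "J \<subseteq> S" using A by auto
    have "{\<pi>. \<pi> permutes S} \<inter> {\<pi>. \<forall>b\<in>J. \<pi> b = \<sigma> b} = {\<pi>. \<pi> permutes S \<and> (\<forall>b\<in>J. \<pi> b = \<sigma> b)}" by auto
    then show "(\<Sum>\<pi> | \<pi> permutes S. if \<forall>b\<in>J. \<pi> b = \<sigma> b then (1 / p) ^ card J else 0) =
        fact (?k - card J) * (1 / p) ^ card J"
      using card_permutes_agreeing[OF fin \<sigma> \<open>J \<subseteq> S\<close>] finP by (simp add: sum.If_cases)
  qed simp
  also have "\<dots> \<le> (\<Sum>J\<in>Pow A. fact ?k)"
  proof (rule sum_mono)
    fix J assume "J \<in> Pow A"
    then have "card J \<le> ?k" using A fin by (meson PowD card_mono order_trans)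
    have "fact (?k - card J) * (1 / p) ^ card J \<le> fact ?k * (exp 1 / ?k) ^ card J * (1 / p) ^ card J"
      using p by (intro mult_right_mono fact_diff_le \<open>card J \<le> ?k\<close>) auto
    also have "\<dots> = fact ?k * (exp 1 / (?k * p)) ^ card J"
      by (simp add: power_mult_distrib[symmetric])
    also have "\<dots> \<le> fact ?k * 1"
      using kp p k by (intro mult_left_mono power_le_one) auto
    finally show "fact (?k - card J) * (1 / p) ^ card J \<le> fact ?k" by simp
  qed
  also have "\<dots> = fact ?k * 2 ^ card A" using finA by (simp add: card_Pow)
  finally show ?thesis .
qed

text \<open>Summing over all sets \<open>L\<close> of agreements overcounts, which is harmless as
  \<open>F\<close> is nonnegative. Prescribing \<open>w\<close> on \<open>L\<close> leaves at most
  m^(card B - card L) choices, and possibly none, because \<open>v\<close> is not assumed to take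
  its values in the sets \<open>W \<beta>\<close>.\<close>

lemma sum_PiE_agree_le:
  fixes F :: "nat \<Rightarrow> real"
  assumes fin: "finite B" "\<And>\<beta>. \<beta> \<in> B \<Longrightarrow> finite (W \<beta>)" and m: "\<And>\<beta>. \<beta> \<in> B \<Longrightarrow> card (W \<beta>) = m" "0 < m"
    and F: "\<And>l. 0 \<le> F l"
  shows "(\<Sum>w\<in>PiE B W. F (card {\<beta> \<in> B. v \<beta> = w \<beta>}))
    \<le> m ^ card B * (\<Sum>l\<le>card B. (card B choose l) * (1 / m) ^ l * F l)"
proof -
  let ?k = "card B"
  have finP: "finite (PiE B W)" using fin by (intro finite_PiE) auto
  have agr: "card {w \<in> PiE B W. \<forall>\<beta>\<in>L. v \<beta> = w \<beta>} \<le> m ^ (?k - card L)" if L: "L \<subseteq> B" for L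
  proof -
    have finL: "finite L" using L fin finite_subset by blast
    have "inj_on (\<lambda>w. restrict w (B - L)) {w \<in> PiE B W. \<forall>\<beta>\<in>L. v \<beta> = w \<beta>}"
    proof (rule inj_onI)
      fix w w' assume *: "w \<in> {w \<in> PiE B W. \<forall>\<beta>\<in>L. v \<beta> = w \<beta>}" "w' \<in> {w \<in> PiE B W. \<forall>\<beta>\<in>L. v \<beta> = w \<beta>}"
        "restrict w (B - L) = restrict w' (B - L)"
      have "w \<beta> = w' \<beta>" if "\<beta> \<in> B" for \<beta>
      proof (cases "\<beta> \<in> L")
        case True
        then show ?thesis using * by auto
      next
        case False
        then show ?thesis using fun_cong[OF *(3), of \<beta>] that by simp
      qed
      then show "w = w'" using * by (auto intro: PiE_ext)
    qed
    moreover have "(\<lambda>w. restrict w (B - L)) ` {w \<in> PiE B W. \<forall>\<beta>\<in>L. v \<beta> = w \<beta>} \<subseteq> PiE (B - L) W"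
      by auto
    moreover have "finite (PiE (B - L) W)" using fin by (intro finite_PiE) auto
    ultimately have "card {w \<in> PiE B W. \<forall>\<beta>\<in>L. v \<beta> = w \<beta>} \<le> card (PiE (B - L) W)"
      by (rule card_inj_on_le)
    also have "\<dots> = (\<Prod>\<beta>\<in>B - L. m)" using fin m by (subst card_PiE) auto
    also have "\<dots> = m ^ (?k - card L)" using L finL by (simp add: card_Diff_subset)
    finally show ?thesis .
  qed
  have "(\<Sum>w\<in>PiE B W. F (card {\<beta> \<in> B. v \<beta> = w \<beta>})) \<le>
      (\<Sum>w\<in>PiE B W. \<Sum>L\<in>Pow B. if \<forall>\<beta>\<in>L. v \<beta> = w \<beta> then F (card L) else 0)"
  proof (rule sum_mono)
    fix w
    let ?L = "{\<beta> \<in> B. v \<beta> = w \<beta>}"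
    have "F (card ?L) = (\<Sum>L\<in>{?L}. if \<forall>\<beta>\<in>L. v \<beta> = w \<beta> then F (card L) else 0)" by simp
    also have "\<dots> \<le> (\<Sum>L\<in>Pow B. if \<forall>\<beta>\<in>L. v \<beta> = w \<beta> then F (card L) else 0)"
      using fin F by (intro sum_mono2) auto
    finally show "F (card ?L) \<le> \<dots>" .
  qed
  also have "\<dots> = (\<Sum>L\<in>Pow B. \<Sum>w\<in>PiE B W. if \<forall>\<beta>\<in>L. v \<beta> = w \<beta> then F (card L) else 0)"
    by (rule sum.swap)
  also have "\<dots> = (\<Sum>L\<in>Pow B. card {w \<in> PiE B W. \<forall>\<beta>\<in>L. v \<beta> = w \<beta>} * F (card L))"
    using finP by (intro sum.cong) (auto simp: sum.If_cases Int_def)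
  also have "\<dots> \<le> (\<Sum>L\<in>Pow B. m ^ ?k * (1 / m) ^ card L * F (card L))"
  proof (rule sum_mono)
    fix L assume "L \<in> Pow B"
    then have L: "L \<subseteq> B" "card L \<le> ?k" using fin by (auto simp: card_mono)
    have "real (card {w \<in> PiE B W. \<forall>\<beta>\<in>L. v \<beta> = w \<beta>}) \<le> real (m ^ (?k - card L))"
      using agr[OF L(1)] of_nat_le_iff by blast
    also have "\<dots> = m ^ ?k * (1 / m) ^ card L"
      unfolding of_nat_power using L m(2) power_diff[of "real m" "card L" ?k] by (simp add: power_divide)
    finally show "card {w \<in> PiE B W. \<forall>\<beta>\<in>L. v \<beta> = w \<beta>} * F (card L) \<le> m ^ ?k * (1 / m) ^ card L * F (card L)"
      using F by (intro mult_right_mono) auto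
  qed
  also have "\<dots> = (\<Sum>l\<le>?k. \<Sum>L | L \<subseteq> B \<and> card L = l. m ^ ?k * (1 / m) ^ card L * F (card L))"
    using fin sum.group[of "Pow B" "{..?k}" card "\<lambda>L. m ^ ?k * (1 / m) ^ card L * F (card L)"]
    by (simp add: card_mono image_subset_iff)
  also have "\<dots> = (\<Sum>l\<le>?k. (?k choose l) * (m ^ ?k * (1 / m) ^ l * F l))"
    using n_subsets[OF fin(1)] by (intro sum.cong) auto
  finally show ?thesis by (simp add: sum_distrib_left mult_ac)
qed

section \<open>Block systems\<close>

text \<open>The argument is a predicate on sets rather than a graph, as the random object is the
  family of edge indicators. The predicate may hold at singletons, whence the clause
  \<open>u \<noteq> v\<close>.\<close>

definition tree_matching :: "nat \<Rightarrow> (nat \<Rightarrow> nat) \<Rightarrow> (nat set \<Rightarrow> bool) \<Rightarrow> nat set \<Rightarrow> bool" where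
  "tree_matching t par X U \<longleftrightarrow> (\<exists>(I :: nat set) g.
     tree_copies t par (\<lambda>u v. u \<noteq> v \<and> X {u, v}) I g \<and> U = g ` (I \<times> {..<t}))"

text \<open>
  The block \<open>W (b, i)\<close> is the \<open>b\<close>-th block reserved for the vertex \<open>i\<close> of the tree. An element
  \<open>(v, \<sigma>)\<close> of \<open>\<Psi>\<close> chooses a vertex in each block and, for each non-root \<open>i\<close>, a matching of the blocks of
  \<open>i\<close> with those of \<open>par i\<close>; all other pairs of chosen vertices are required to be non-adjacent.
\<close>

locale block_system = par_tree +
  fixes k n m :: nat and W :: "nat \<times> nat \<Rightarrow> nat set"
  assumes W_subset: "\<And>\<beta>. \<beta> \<in> {..<k} \<times> {..<t} \<Longrightarrow> W \<beta> \<subseteq> {1..n}"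
    and card_W: "\<And>\<beta>. \<beta> \<in> {..<k} \<times> {..<t} \<Longrightarrow> card (W \<beta>) = m"
    and disjoint_W: "\<And>\<beta> \<gamma> x. \<beta> \<in> {..<k} \<times> {..<t} \<Longrightarrow> \<gamma> \<in> {..<k} \<times> {..<t} \<Longrightarrow> x \<in> W \<beta> \<Longrightarrow> x \<in> W \<gamma> \<Longrightarrow> \<beta> = \<gamma>"
    and k_pos: "0 < k" and m_pos: "0 < m"
begin

abbreviation "B \<equiv> {..<k} \<times> {..<t}"

definition "\<Psi> = PiE B W \<times> PiE {1..<t} (\<lambda>_. {\<pi>. \<pi> permutes {..<k}})"

definition edge :: "(nat \<times> nat \<Rightarrow> nat) \<times> (nat \<Rightarrow> nat \<Rightarrow> nat) \<Rightarrow> nat \<times> nat \<Rightarrow> nat set" where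
  "edge = (\<lambda>(v, \<sigma>) (b, i). {v (b, i), v (\<sigma> i b, par i)})"

definition "R \<psi> = edge \<psi> ` ({..<k} \<times> {1..<t})"
definition "P \<psi> = {e. e \<subseteq> fst \<psi> ` B \<and> card e = 2}"
definition "N \<psi> = P \<psi> - R \<psi>"

lemma finite_W: "\<beta> \<in> B \<Longrightarrow> finite (W \<beta>)"
  using card_W m_pos by (metis card.infinite less_numeral_extra(3))

lemma \<Psi>_D:
  assumes "(v, \<sigma>) \<in> \<Psi>"
  shows "\<And>\<beta>. \<beta> \<in> B \<Longrightarrow> v \<beta> \<in> W \<beta>"
    and "\<And>i. 0 < i \<Longrightarrow> i < t \<Longrightarrow> \<sigma> i permutes {..<k}"
    and "\<And>b i. b < k \<Longrightarrow> 0 < i \<Longrightarrow> i < t \<Longrightarrow> (\<sigma> i b, par i) \<in> B"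
proof -
  show 1: "v \<beta> \<in> W \<beta>" if "\<beta> \<in> B" for \<beta> using assms that unfolding \<Psi>_def by (auto simp: PiE_iff)
  show 2: "\<sigma> i permutes {..<k}" if "0 < i" "i < t" for i
    using assms that unfolding \<Psi>_def by (simp add: PiE_iff)
  show "(\<sigma> i b, par i) \<in> B" if "b < k" "0 < i" "i < t" for b i
    using permutes_in_image[OF 2[OF that(2,3)], of b] par_less[OF that(2,3)] that by simp
qed

lemma block_unique:
  assumes "(v, \<sigma>) \<in> \<Psi>" "(v', \<sigma>') \<in> \<Psi>" "\<beta> \<in> B" "\<gamma> \<in> B" "v \<beta> = v' \<gamma>"
  shows "\<beta> = \<gamma>"
  using disjoint_W[OF assms(3,4)] \<Psi>_D(1)[OF assms(1,3)] \<Psi>_D(1)[OF assms(2,4)] assms(5) by simp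

lemma inj_on_v: "(v, \<sigma>) \<in> \<Psi> \<Longrightarrow> inj_on v B"
  by (rule inj_onI) (rule block_unique)

text \<open>The ends of a common edge are compared through their blocks. The crossed identification
  would give i = par i' and i' = par i, impossible as parents decrease. The direct one gives the
  same child block, the same vertex in it and the same value of the permutation there.\<close>

lemma edge_eqD:
  assumes \<psi>: "(v, \<sigma>) \<in> \<Psi>" "(v', \<sigma>') \<in> \<Psi>" and b: "b < k" "0 < i" "i < t" and b': "b' < k" "0 < i'" "i' < t"
    and eq: "edge (v, \<sigma>) (b, i) = edge (v', \<sigma>') (b', i')"
  shows "b = b' \<and> i = i' \<and> v (b, i) = v' (b, i) \<and> \<sigma> i b = \<sigma>' i b"
proof -
  have in1: "(b, i) \<in> B" "(b', i') \<in> B" "(\<sigma> i b, par i) \<in> B" "(\<sigma>' i' b', par i') \<in> B"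
    using b b' \<Psi>_D(3)[OF \<psi>(1) b] \<Psi>_D(3)[OF \<psi>(2) b'] by simp_all
  have "v (b, i) = v' (b', i') \<and> v (\<sigma> i b, par i) = v' (\<sigma>' i' b', par i') \<or>
      v (b, i) = v' (\<sigma>' i' b', par i') \<and> v (\<sigma> i b, par i) = v' (b', i')"
    using eq by (simp add: edge_def doubleton_eq_iff)
  then show ?thesis
  proof
    assume *: "v (b, i) = v' (b', i') \<and> v (\<sigma> i b, par i) = v' (\<sigma>' i' b', par i')"
    have "(b, i) = (b', i')" using block_unique[OF \<psi> in1(1,2)] * by simp
    moreover have "(\<sigma> i b, par i) = (\<sigma>' i' b', par i')" using block_unique[OF \<psi> in1(3,4)] * by simp
    ultimately show ?thesis using * by simp
  next
    assume *: "v (b, i) = v' (\<sigma>' i' b', par i') \<and> v (\<sigma> i b, par i) = v' (b', i')"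
    have "(b, i) = (\<sigma>' i' b', par i')" using block_unique[OF \<psi> in1(1,4)] * by simp
    moreover have "(\<sigma> i b, par i) = (b', i')" using block_unique[OF \<psi> in1(3,2)] * by simp
    ultimately show ?thesis using par_less[OF b(2,3)] par_less[OF b'(2,3)] by simp
  qed
qed

lemma inj_on_edge:
  assumes "(v, \<sigma>) \<in> \<Psi>"
  shows "inj_on (edge (v, \<sigma>)) ({..<k} \<times> {1..<t})"
proof (rule inj_onI)
  fix x y assume "x \<in> {..<k} \<times> {1..<t}" "y \<in> {..<k} \<times> {1..<t}" "edge (v, \<sigma>) x = edge (v, \<sigma>) y"
  then show "x = y"
    using edge_eqD[OF assms assms, of "fst x" "snd x" "fst y" "snd y"] by (simp add: mem_Times_iff prod_eq_iff)
qed

lemma R_E: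
  assumes "e \<in> R \<psi>"
  obtains b i where "b < k" "0 < i" "i < t" "e = edge \<psi> (b, i)"
proof -
  obtain z where z: "z \<in> {..<k} \<times> {1..<t}" "e = edge \<psi> z" using assms unfolding R_def by (rule imageE) (rule that)
  show ?thesis by (rule that[of "fst z" "snd z"]) (use z in \<open>simp_all add: mem_Times_iff Suc_le_eq\<close>)
qed

lemma card_R:
  assumes "\<psi> \<in> \<Psi>"
  shows "card (R \<psi>) = k * (t - 1)"
proof -
  have "inj_on (edge \<psi>) ({..<k} \<times> {1..<t})" using inj_on_edge[of "fst \<psi>" "snd \<psi>"] assms by simp
  then show ?thesis unfolding R_def by (simp add: card_image card_cartesian_product)
qed

lemma R_subset_P:
  assumes "\<psi> \<in> \<Psi>"
  shows "R \<psi> \<subseteq> P \<psi>"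
proof
  obtain v \<sigma> where \<psi>: "\<psi> = (v, \<sigma>)" by (cases \<psi>)
  fix e assume "e \<in> R \<psi>"
  then obtain b i where bi: "b < k" "0 < i" "i < t" "e = {v (b, i), v (\<sigma> i b, par i)}"
    by (elim R_E) (auto simp: \<psi> edge_def)
  have in1: "(b, i) \<in> B" "(\<sigma> i b, par i) \<in> B"
    using bi \<Psi>_D(3)[OF assms[unfolded \<psi>] bi(1-3)] by simp_all
  have "v (b, i) \<noteq> v (\<sigma> i b, par i)"
    using block_unique[OF assms[unfolded \<psi>] assms[unfolded \<psi>] in1] par_less[OF bi(2,3)] by auto
  moreover have "e \<subseteq> v ` B" unfolding bi(4) using in1 by (simp only: insert_subset imageI) simp
  ultimately show "e \<in> P \<psi>" using bi(4) by (simp add: P_def \<psi>)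
qed

lemma finite_P: "finite (P \<psi>)"
  unfolding P_def by (rule finite_subset[of _ "Pow (fst \<psi> ` B)"]) auto

lemma card_P:
  assumes "\<psi> \<in> \<Psi>"
  shows "card (P \<psi>) = (k * t) choose 2"
proof -
  have "inj_on (fst \<psi>) B" using inj_on_v[of "fst \<psi>" "snd \<psi>"] assms by simp
  then show ?thesis unfolding P_def by (subst n_subsets) (simp_all add: card_image card_cartesian_product)
qed

lemma card_N:
  assumes "\<psi> \<in> \<Psi>"
  shows "card (N \<psi>) = ((k * t) choose 2) - k * (t - 1)"
  unfolding N_def card_R[OF assms, symmetric] card_P[OF assms, symmetric]
  by (rule card_Diff_subset[OF finite_subset[OF R_subset_P[OF assms] finite_P] R_subset_P[OF assms]])

lemma image_subset_vertices:
  assumes "(v, \<sigma>) \<in> \<Psi>"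
  shows "v ` B \<subseteq> {1..n}"
proof
  fix x assume "x \<in> v ` B"
  then obtain \<beta> where \<beta>: "\<beta> \<in> B" "x = v \<beta>" by (rule imageE) (rule that)
  show "x \<in> {1..n}" using \<Psi>_D(1)[OF assms \<beta>(1)] W_subset[OF \<beta>(1)] \<beta>(2) by blast
qed

lemma P_subset: "\<psi> \<in> \<Psi> \<Longrightarrow> P \<psi> \<subseteq> {e. e \<subseteq> {1..n} \<and> card e = 2}"
  using image_subset_vertices[of "fst \<psi>" "snd \<psi>"] by (auto simp: P_def)

text \<open>A common edge is charged to its child block, where vertices and permutation values
  agree. Agreement of the vertices in the parent block is dropped, so that for fixed
  \<open>v\<close> and \<open>v'\<close> the bound is a sum of terms each involving a single
  permutation \<open>\<sigma>' i\<close>.\<close>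

lemma card_R_Int:
  assumes \<psi>: "(v, \<sigma>) \<in> \<Psi>" "(v', \<sigma>') \<in> \<Psi>"
  shows "card (R (v, \<sigma>) \<inter> R (v', \<sigma>')) \<le>
    (\<Sum>i\<in>{1..<t}. card {b \<in> {b. b < k \<and> v (b, i) = v' (b, i)}. \<sigma>' i b = \<sigma> i b})"
proof -
  let ?K = "\<lambda>i. {b \<in> {b. b < k \<and> v (b, i) = v' (b, i)}. \<sigma>' i b = \<sigma> i b}"
  have "R (v, \<sigma>) \<inter> R (v', \<sigma>') \<subseteq> (\<Union>i\<in>{1..<t}. (\<lambda>b. edge (v, \<sigma>) (b, i)) ` ?K i)"
  proof
    fix e assume "e \<in> R (v, \<sigma>) \<inter> R (v', \<sigma>')"
    then have e: "e \<in> R (v, \<sigma>)" "e \<in> R (v', \<sigma>')" by simp_all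
    obtain b i where 1: "b < k" "0 < i" "i < t" "e = edge (v, \<sigma>) (b, i)"
      using e(1) by (rule R_E)
    obtain b' i' where 2: "b' < k" "0 < i'" "i' < t" "e = edge (v', \<sigma>') (b', i')"
      using e(2) by (rule R_E)
    have "edge (v, \<sigma>) (b, i) = edge (v', \<sigma>') (b', i')" using 1(4) 2(4) by simp
    from edge_eqD[OF \<psi> 1(1-3) 2(1-3) this] have "v (b, i) = v' (b, i) \<and> \<sigma>' i b = \<sigma> i b"
      by (elim conjE) auto
    then have "b \<in> ?K i" using 1(1) by simp
    then show "e \<in> (\<Union>i\<in>{1..<t}. (\<lambda>b. edge (v, \<sigma>) (b, i)) ` ?K i)" using 1 by auto
  qed
  then have "card (R (v, \<sigma>) \<inter> R (v', \<sigma>')) \<le> card (\<Union>i\<in>{1..<t}. (\<lambda>b. edge (v, \<sigma>) (b, i)) ` ?K i)"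
    by (intro card_mono) auto
  also have "\<dots> \<le> (\<Sum>i\<in>{1..<t}. card ((\<lambda>b. edge (v, \<sigma>) (b, i)) ` ?K i))" by (rule card_UN_le) simp
  also have "\<dots> \<le> (\<Sum>i\<in>{1..<t}. card (?K i))" by (intro sum_mono card_image_le) simp
  finally show ?thesis .
qed

text \<open>A common non-edge is a pair of common vertices, and the common vertices are the values
  of \<open>v\<close> on the blocks where \<open>v\<close> and \<open>v'\<close> agree.\<close>

lemma card_N_Int:
  assumes \<psi>: "(v, \<sigma>) \<in> \<Psi>" "(v', \<sigma>') \<in> \<Psi>"
  shows "card (N (v, \<sigma>) \<inter> N (v', \<sigma>')) \<le> card {\<beta> \<in> B. v \<beta> = v' \<beta>} choose 2"
proof -
  let ?L = "{\<beta> \<in> B. v \<beta> = v' \<beta>}"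
  have "v ` B \<inter> v' ` B \<subseteq> v ` ?L"
  proof
    fix x assume "x \<in> v ` B \<inter> v' ` B"
    then obtain \<beta> \<gamma> where *: "\<beta> \<in> B" "\<gamma> \<in> B" "x = v \<beta>" "x = v' \<gamma>" by blast
    then have "\<beta> = \<gamma>" using block_unique[OF \<psi>] by simp
    then have "\<beta> \<in> ?L" using * by simp
    then show "x \<in> v ` ?L" using * by blast
  qed
  then have "N (v, \<sigma>) \<inter> N (v', \<sigma>') \<subseteq> {e. e \<subseteq> v ` ?L \<and> card e = 2}"
    by (auto simp: N_def P_def)
  moreover have "finite {e. e \<subseteq> v ` ?L \<and> card e = 2}"
    by (rule finite_subset[of _ "Pow (v ` ?L)"]) auto
  ultimately have "card (N (v, \<sigma>) \<inter> N (v', \<sigma>')) \<le> card {e. e \<subseteq> v ` ?L \<and> card e = 2}"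
    by (intro card_mono)
  also have "\<dots> = card (v ` ?L) choose 2" by (rule n_subsets) simp
  also have "card (v ` ?L) = card ?L"
    using inj_on_v[OF \<psi>(1)] by (intro card_image) (auto simp: inj_on_def)
  finally show ?thesis .
qed

lemma finite_\<Psi>: "finite \<Psi>"
  unfolding \<Psi>_def
  by (intro finite_cartesian_product finite_PiE) (auto simp: finite_W finite_permutations)

lemma card_\<Psi>: "card \<Psi> = m ^ (k * t) * fact k ^ (t - 1)"
proof -
  have "card (PiE B W) = m ^ (k * t)"
    by (subst card_PiE) (auto simp: card_W card_cartesian_product)
  moreover have "card (PiE {1..<t} (\<lambda>_. {\<pi>. \<pi> permutes {..<k}})) = fact k ^ (t - 1)"
    by (subst card_PiE) (auto simp: card_permutations)
  ultimately show ?thesis by (simp add: \<Psi>_def card_cartesian_product)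
qed

text \<open>For a fixed second vertex choice the sum over permutations factorizes over the non-root
  \<open>i\<close>, and each factor is at most k! times 2 to the number of agreeing blocks of
  \<open>i\<close>. These numbers add up to at most the total number \<open>l\<close> of agreements,
  which produces 2^l. The sum over vertex choices then brings in the binomial coefficients and the
  powers of 1/m.\<close>

lemma sum_prob_Int_le:
  fixes p :: real
  assumes p: "0 < p" "p < 1" and kp: "exp 1 \<le> k * p" and \<phi>: "\<phi> \<in> \<Psi>"
  defines "M \<equiv> Pi_pmf {e. e \<subseteq> {1..n} \<and> card e = 2} False (\<lambda>_. bernoulli_pmf p)"
  defines "P0 \<equiv> p ^ (k * (t - 1)) * (1 - p) ^ (((k * t) choose 2) - k * (t - 1))"
  shows "(\<Sum>\<psi>\<in>\<Psi>. measure_pmf.prob M (pattern_event (R \<phi>) (N \<phi>) \<inter> pattern_event (R \<psi>) (N \<psi>)))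
    \<le> (\<Sum>l\<le>k * t. ((k * t) choose l) * (1 / m) ^ l * (2 ^ l * (1 / (1 - p)) ^ (l choose 2))) * card \<Psi> * P0\<^sup>2"
proof -
  obtain v \<sigma> where \<phi>_eq: "\<phi> = (v, \<sigma>)" by (cases \<phi>)
  note \<phi>' = \<phi>[unfolded \<phi>_eq]
  define K where "K = (\<lambda>w i \<pi>. {b \<in> {b. b < k \<and> v (b, i) = w (b, i)}. \<pi> b = \<sigma> i b})"
  define L where "L = (\<lambda>w. {\<beta> \<in> B. v \<beta> = w \<beta>})"
  let ?S = "PiE {1..<t} (\<lambda>_. {\<pi>. \<pi> permutes {..<k}})"
  have E: "finite {e :: nat set. e \<subseteq> {1..n} \<and> card e = 2}"
    by (rule finite_subset[of _ "Pow {1..n}"]) auto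
  have sub: "R \<psi> \<subseteq> {e. e \<subseteq> {1..n} \<and> card e = 2}" "N \<psi> \<subseteq> {e. e \<subseteq> {1..n} \<and> card e = 2}" if "\<psi> \<in> \<Psi>" for \<psi>
    using R_subset_P[OF that] P_subset[OF that] by (auto simp: N_def)
  have "(\<Sum>\<psi>\<in>\<Psi>. measure_pmf.prob M (pattern_event (R \<phi>) (N \<phi>) \<inter> pattern_event (R \<psi>) (N \<psi>)))
     \<le> (\<Sum>(w, \<tau>)\<in>\<Psi>. P0 * P0 * ((1 / p) ^ (\<Sum>i\<in>{1..<t}. card (K w i (\<tau> i))) *
          (1 / (1 - p)) ^ (card (L w) choose 2)))"
  proof (rule sum_mono, clarify)
    fix w \<tau> assume \<psi>: "(w, \<tau>) \<in> \<Psi>"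
    show "measure_pmf.prob M (pattern_event (R \<phi>) (N \<phi>) \<inter> pattern_event (R (w, \<tau>)) (N (w, \<tau>)))
      \<le> P0 * P0 * ((1 / p) ^ (\<Sum>i\<in>{1..<t}. card (K w i (\<tau> i))) * (1 / (1 - p)) ^ (card (L w) choose 2))"
      using prob_pattern_event_Int_le[OF E sub[OF \<phi>] sub[OF \<psi>] p
          card_R_Int[OF \<phi>' \<psi>, folded \<phi>_eq] card_N_Int[OF \<phi>' \<psi>, folded \<phi>_eq]]
      unfolding M_def K_def L_def P0_def card_R[OF \<phi>] card_R[OF \<psi>] card_N[OF \<phi>] card_N[OF \<psi>] .
  qed
  also have "\<dots> = P0\<^sup>2 * (\<Sum>w\<in>PiE B W. (1 / (1 - p)) ^ (card (L w) choose 2) *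
      (\<Sum>\<tau>\<in>?S. \<Prod>i\<in>{1..<t}. (1 / p) ^ card (K w i (\<tau> i))))"
    unfolding \<Psi>_def sum.cartesian_product[symmetric] sum_distrib_left power_sum
    by (intro sum.cong) (simp_all add: power2_eq_square mult_ac)
  also have "\<dots> \<le> P0\<^sup>2 * (\<Sum>w\<in>PiE B W. (1 / (1 - p)) ^ (card (L w) choose 2) *
      (fact k ^ (t - 1) * 2 ^ card (L w)))"
  proof (intro mult_left_mono sum_mono)
    fix w assume "w \<in> PiE B W"
    let ?A = "\<lambda>i. {b. b < k \<and> v (b, i) = w (b, i)}"
    have "(\<Sum>\<tau>\<in>?S. \<Prod>i\<in>{1..<t}. (1 / p) ^ card (K w i (\<tau> i)))
      = (\<Prod>i\<in>{1..<t}. \<Sum>\<pi> | \<pi> permutes {..<k}. (1 / p) ^ card (K w i \<pi>))"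
      by (rule prod_sum_PiE[symmetric]) (auto simp: finite_permutations)
    also have "\<dots> \<le> (\<Prod>i\<in>{1..<t}. fact k * 2 ^ card (?A i))"
    proof (rule prod_mono)
      fix i assume i: "i \<in> {1..<t}"
      have "(\<Sum>\<pi> | \<pi> permutes {..<k}. (1 / p) ^ card (K w i \<pi>)) \<le> fact (card {..<k}) * 2 ^ card (?A i)"
        unfolding K_def
        by (rule sum_permutes_agree_le) (use \<Psi>_D(2)[OF \<phi>', of i] i p kp in auto)
      then show "0 \<le> (\<Sum>\<pi> | \<pi> permutes {..<k}. (1 / p) ^ card (K w i \<pi>)) \<and>
          (\<Sum>\<pi> | \<pi> permutes {..<k}. (1 / p) ^ card (K w i \<pi>)) \<le> fact k * 2 ^ card (?A i)"
        using p by (simp add: sum_nonneg)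
    qed
    also have "\<dots> = fact k ^ (t - 1) * 2 ^ (\<Sum>i\<in>{1..<t}. card (?A i))"
      by (simp add: prod.distrib power_sum)
    also have "\<dots> \<le> fact k ^ (t - 1) * 2 ^ card (L w)"
    proof (intro mult_left_mono power_increasing)
      \<comment> \<open>The blocks of the root carry no permutation but count in \<open>L w\<close>,
        so only an inequality results.\<close>
      have "(\<Sum>i\<in>{1..<t}. card (?A i)) = card (SIGMA i:{1..<t}. ?A i)"
        by (subst card_SigmaI) auto
      also have "\<dots> \<le> card (L w)"
        by (rule card_inj_on_le[where f = prod.swap]) (auto simp: L_def)
      finally show "(\<Sum>i\<in>{1..<t}. card (?A i)) \<le> card (L w)" .
    qed auto
    finally show "(\<Sum>\<tau>\<in>?S. \<Prod>i\<in>{1..<t}. (1 / p) ^ card (K w i (\<tau> i))) \<le> fact k ^ (t - 1) * 2 ^ card (L w)" .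
  qed (use p in auto)
  also have "\<dots> = P0\<^sup>2 * fact k ^ (t - 1) *
      (\<Sum>w\<in>PiE B W. 2 ^ card (L w) * (1 / (1 - p)) ^ (card (L w) choose 2))"
    by (simp add: sum_distrib_left mult_ac)
  also have "\<dots> \<le> P0\<^sup>2 * fact k ^ (t - 1) * (m ^ card B *
      (\<Sum>l\<le>card B. (card B choose l) * (1 / m) ^ l * (2 ^ l * (1 / (1 - p)) ^ (l choose 2))))"
  proof (rule mult_left_mono)
    show "(\<Sum>w\<in>PiE B W. 2 ^ card (L w) * (1 / (1 - p)) ^ (card (L w) choose 2)) \<le> m ^ card B *
      (\<Sum>l\<le>card B. (card B choose l) * (1 / m) ^ l * (2 ^ l * (1 / (1 - p)) ^ (l choose 2)))"
      unfolding L_def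
      using sum_PiE_agree_le[where B = B and W = W and m = m and v = v and
          F = "\<lambda>l. 2 ^ l * (1 / (1 - p)) ^ (l choose 2)", OF _ finite_W card_W m_pos] p by simp
  qed (use p in auto)
  also have "\<dots> = (\<Sum>l\<le>k * t. ((k * t) choose l) * (1 / m) ^ l * (2 ^ l * (1 / (1 - p)) ^ (l choose 2)))
      * card \<Psi> * P0\<^sup>2"
    by (simp add: card_\<Psi> card_cartesian_product mult_ac)
  finally show ?thesis .
qed

lemma prob_some_pattern_ge:
  fixes p :: real
  assumes p: "0 < p" "p < 1" and kp: "exp 1 \<le> k * p"
  defines "M \<equiv> Pi_pmf {e. e \<subseteq> {1..n} \<and> card e = 2} False (\<lambda>_. bernoulli_pmf p)"
  shows "1 / (\<Sum>l\<le>k * t. ((k * t) choose l) * (1 / m) ^ l * (2 ^ l * (1 / (1 - p)) ^ (l choose 2)))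
    \<le> measure_pmf.prob M (\<Union>\<psi>\<in>\<Psi>. pattern_event (R \<psi>) (N \<psi>))"
proof (rule second_moment_union)
  have E: "finite {e :: nat set. e \<subseteq> {1..n} \<and> card e = 2}"
    by (rule finite_subset[of _ "Pow {1..n}"]) auto
  show "finite \<Psi>" by (rule finite_\<Psi>)
  have "card \<Psi> > 0" using m_pos by (simp add: card_\<Psi>)
  then show "\<Psi> \<noteq> {}" by auto
  show "finite (set_pmf M)"
    unfolding M_def using E by (simp add: set_Pi_pmf finite_PiE_dflt)
  show "0 < p ^ (k * (t - 1)) * (1 - p) ^ (((k * t) choose 2) - k * (t - 1))" using p by simp
  show "measure_pmf.prob M (pattern_event (R \<psi>) (N \<psi>)) =
      p ^ (k * (t - 1)) * (1 - p) ^ (((k * t) choose 2) - k * (t - 1))" if \<psi>: "\<psi> \<in> \<Psi>" for \<psi>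
    unfolding M_def
    by (subst prob_pattern_event[OF E])
       (use R_subset_P[OF \<psi>] P_subset[OF \<psi>] p in \<open>auto simp: N_def card_R[OF \<psi>] card_N[OF \<psi>, unfolded N_def]\<close>)
qed (unfold M_def, rule sum_prob_Int_le[OF p kp])

end

section \<open>Concentration of the largest transversal matching\<close>

lemma tree_matching_empty: "tree_matching t par X {}"
  unfolding tree_matching_def by (rule exI[of _ "{}"]) (simp add: tree_copies_def)

lemma tree_matching_cong:
  assumes "tree_matching t par X U"
    and eq: "\<And>u v. u \<in> U \<Longrightarrow> v \<in> U \<Longrightarrow> u \<noteq> v \<Longrightarrow> X {u, v} = Y {u, v}"
  shows "tree_matching t par Y U"
proof -
  obtain I :: "nat set" and g where g: "tree_copies t par (\<lambda>u v. u \<noteq> v \<and> X {u, v}) I g"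
    and U: "U = g ` (I \<times> {..<t})"
    using assms(1) unfolding tree_matching_def by (elim exE conjE)
  have "(g (a, i) \<noteq> g (b, j) \<and> Y {g (a, i), g (b, j)}) = (g (a, i) \<noteq> g (b, j) \<and> X {g (a, i), g (b, j)})"
    if "a \<in> I" "b \<in> I" "i < t" "j < t" for a b i j
    using eq[of "g (a, i)" "g (b, j)"] that by (auto simp: U)
  then have "tree_copies t par (\<lambda>u v. u \<noteq> v \<and> Y {u, v}) I g"
    using g unfolding tree_copies_def by simp
  then show ?thesis using U unfolding tree_matching_def by (intro exI conjI)
qed

text \<open>The whole copy containing \<open>x\<close> is discarded; the other copies still form an
  induced matching. This is the origin of the Lipschitz constant \<open>t\<close>.\<close>

lemma tree_matching_remove:
  assumes "tree_matching t par X U" "finite U" "x \<in> U"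
  obtains U' where "tree_matching t par X U'" "U' \<subseteq> U" "x \<notin> U'" "card U \<le> card U' + t"
proof -
  obtain I :: "nat set" and g where g: "tree_copies t par (\<lambda>u v. u \<noteq> v \<and> X {u, v}) I g"
    and U: "U = g ` (I \<times> {..<t})"
    using assms(1) unfolding tree_matching_def by (elim exE conjE)
  obtain a i where a: "a \<in> I" "i < t" "x = g (a, i)" using assms(3) by (auto simp: U)
  define U' where "U' = g ` ((I - {a}) \<times> {..<t})"
  have inj: "inj_on g (I \<times> {..<t})" using g by (simp add: tree_copies_def)
  have 1: "tree_copies t par (\<lambda>u v. u \<noteq> v \<and> X {u, v}) (I - {a}) g"
    using g inj_on_subset[OF inj, of "(I - {a}) \<times> {..<t}"] unfolding tree_copies_def by auto
  have 2: "U' \<subseteq> U" by (auto simp: U U'_def)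
  have 3: "x \<notin> U'"
  proof
    assume "x \<in> U'"
    then obtain z where z: "z \<in> (I - {a}) \<times> {..<t}" "x = g z" unfolding U'_def by (rule imageE) (rule that)
    have "z = (a, i)" using inj_onD[OF inj, of z "(a, i)"] z a by auto
    then show False using z by simp
  qed
  have "U \<subseteq> U' \<union> (\<lambda>j. g (a, j)) ` {..<t}" by (auto simp: U U'_def)
  then have "card U \<le> card (U' \<union> (\<lambda>j. g (a, j)) ` {..<t})"
    using finite_subset[OF 2 assms(2)] by (intro card_mono) auto
  also have "\<dots> \<le> card U' + card ((\<lambda>j. g (a, j)) ` {..<t})" by (rule card_Un_le)
  also have "\<dots> \<le> card U' + t" using card_image_le[of "{..<t}" "\<lambda>j. g (a, j)"] by simp
  finally show ?thesis using that[of U'] 1 2 3 unfolding tree_matching_def U'_def by blast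
qed

context par_tree
begin

text \<open>The index of the block holding vertex \<open>i\<close> of copy \<open>a\<close> is to be
  \<open>\<tau> i a\<close>. Starting from the identity at the root, \<open>\<tau> i\<close> has to
  be the inverse of \<open>\<sigma> i\<close> composed with the permutation of the parent, which is
  already known because parents come earlier.\<close>

lemma ex_copy_permutations:
  assumes "\<And>i. 0 < i \<Longrightarrow> i < t \<Longrightarrow> \<sigma> i permutes S"
  shows "\<exists>\<tau>. (\<forall>i<t. \<tau> i permutes S) \<and> (\<forall>i. 0 < i \<longrightarrow> i < t \<longrightarrow> \<sigma> i \<circ> \<tau> i = \<tau> (par i))"
proof -
  have "\<exists>\<tau>. (\<forall>i<s. \<tau> i permutes S) \<and> (\<forall>i. 0 < i \<longrightarrow> i < s \<longrightarrow> \<sigma> i \<circ> \<tau> i = \<tau> (par i))" if "s \<le> t" for s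
    using that
  proof (induction s)
    case (Suc s)
    from Suc.IH[OF Suc_leD[OF Suc.prems]] obtain \<tau> where \<tau>: "\<forall>i<s. \<tau> i permutes S"
      "\<forall>i. 0 < i \<longrightarrow> i < s \<longrightarrow> \<sigma> i \<circ> \<tau> i = \<tau> (par i)"
      by (elim exE conjE)
    show ?case
    proof (cases "s = 0")
      case True
      then show ?thesis by (intro exI[of _ "\<lambda>_. id"]) (simp add: permutes_id[unfolded id_def] id_def)
    next
      case False
      have \<sigma>: "\<sigma> s permutes S" using assms[of s] False Suc.prems by simp
      have ps: "par s < s" using par_less[of s] False Suc.prems by simp
      define \<tau>' where "\<tau>' = \<tau>(s := inv (\<sigma> s) \<circ> \<tau> (par s))"
      have "inv (\<sigma> s) \<circ> \<tau> (par s) permutes S"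
        using permutes_compose[of "\<tau> (par s)" S "inv (\<sigma> s)"] \<tau>(1) ps permutes_inv[OF \<sigma>] by blast
      then have "\<forall>i<Suc s. \<tau>' i permutes S" using \<tau>(1) by (simp add: \<tau>'_def less_Suc_eq)
      moreover have "\<sigma> i \<circ> \<tau>' i = \<tau>' (par i)" if i: "0 < i" "i < Suc s" for i
      proof (cases "i = s")
        case True
        then show ?thesis using permutes_inverses(1)[OF \<sigma>] ps by (simp add: \<tau>'_def fun_eq_iff)
      next
        case False
        then have "i < s" using i by simp
        then have "par i < s" using par_less[of i] i Suc.prems by simp
        then show ?thesis using \<open>i < s\<close> \<tau>(2) i by (simp add: \<tau>'_def)
      qed
      ultimately show ?thesis by blast
    qed
  qed simp
  then show ?thesis by simp
qed

end

context block_system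
begin

text \<open>Reindexing the blocks by \<tau> sorts the chosen vertices into copies, with the
  prescribed edges running along parents inside the copies. The pattern decides every pair of chosen
  vertices, so there are no further edges among them and the matching is induced.\<close>

lemma tree_matching_of_pattern:
  assumes \<psi>: "(v, \<sigma>) \<in> \<Psi>" and X: "X \<in> pattern_event (R (v, \<sigma>)) (N (v, \<sigma>))"
  shows "tree_matching t par X (v ` B)"
proof -
  have "\<exists>\<tau>. (\<forall>i<t. \<tau> i permutes {..<k}) \<and> (\<forall>i. 0 < i \<longrightarrow> i < t \<longrightarrow> \<sigma> i \<circ> \<tau> i = \<tau> (par i))"
    by (rule ex_copy_permutations) (rule \<Psi>_D(2)[OF \<psi>])
  then obtain \<tau> where "\<forall>i<t. \<tau> i permutes {..<k}"
    "\<forall>i. 0 < i \<longrightarrow> i < t \<longrightarrow> \<sigma> i \<circ> \<tau> i = \<tau> (par i)"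
    by (elim exE conjE)
  then have \<tau>: "\<And>i. i < t \<Longrightarrow> \<tau> i permutes {..<k}"
    "\<And>i. 0 < i \<Longrightarrow> i < t \<Longrightarrow> \<sigma> i \<circ> \<tau> i = \<tau> (par i)" by simp_all
  have \<tau>_less: "\<tau> i a < k" if "i < t" "a < k" for i a
    using permutes_in_image[OF \<tau>(1)[OF that(1)], of a] that by simp
  have \<tau>_inj: "a = b" if "i < t" "\<tau> i a = \<tau> i b" for i a b
    using permutes_inj[OF \<tau>(1)[OF that(1)]] that(2) by (simp add: inj_def)
  have \<sigma>\<tau>: "\<sigma> i (\<tau> i a) = \<tau> (par i) a" if "0 < i" "i < t" for i a
    using fun_cong[OF \<tau>(2)[OF that], of a] by simp
  define g where "g = (\<lambda>(a, i). v (\<tau> i a, i))"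
  have g_eqD: "a = b \<and> i = j" if "a < k" "b < k" "i < t" "j < t" "g (a, i) = g (b, j)" for a b i j
  proof -
    have "(\<tau> i a, i) = (\<tau> j b, j)"
      by (rule block_unique[OF \<psi> \<psi>]) (use that \<tau>_less in \<open>simp_all add: g_def\<close>)
    then show ?thesis using \<tau>_inj[of i a b] that by auto
  qed
  have edge_iff: "{g (a, i), g (b, j)} \<in> R (v, \<sigma>) \<longleftrightarrow> a = b \<and> par_edge par i j"
    if ab: "a < k" "b < k" "i < t" "j < t" for a b i j
  proof
    assume "{g (a, i), g (b, j)} \<in> R (v, \<sigma>)"
    then obtain c l where c: "c < k" "0 < l" "l < t" "{g (a, i), g (b, j)} = edge (v, \<sigma>) (c, l)"
      by (rule R_E)
    obtain c' where c': "c = \<tau> l c'" "c' < k"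
    proof -
      have "c \<in> \<tau> l ` {..<k}" using permutes_image[OF \<tau>(1)[OF c(3)]] c(1) by simp
      then show ?thesis using that by auto
    qed
    have pl: "par l < t" using par_less[OF c(2,3)] c(3) by simp
    have "edge (v, \<sigma>) (c, l) = {g (c', l), g (c', par l)}"
      using \<sigma>\<tau>[OF c(2,3)] by (simp add: edge_def g_def c')
    then have "g (a, i) = g (c', l) \<and> g (b, j) = g (c', par l) \<or> g (a, i) = g (c', par l) \<and> g (b, j) = g (c', l)"
      using c(4) by (simp add: doubleton_eq_iff)
    then show "a = b \<and> par_edge par i j"
    proof
      assume *: "g (a, i) = g (c', l) \<and> g (b, j) = g (c', par l)"
      show ?thesis using g_eqD[of a c' i l] g_eqD[of b c' j "par l"] * ab c' c(2,3) pl
        by (simp add: par_edge_def)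
    next
      assume *: "g (a, i) = g (c', par l) \<and> g (b, j) = g (c', l)"
      show ?thesis using g_eqD[of a c' i "par l"] g_eqD[of b c' j l] * ab c' c(2,3) pl
        by (simp add: par_edge_def)
    qed
  next
    have R_I: "{g (a, l), g (a, par l)} \<in> R (v, \<sigma>)" if "0 < l" "l < t" for l
    proof -
      have "{g (a, l), g (a, par l)} = edge (v, \<sigma>) (\<tau> l a, l)"
        using \<sigma>\<tau>[OF that] by (simp add: edge_def g_def)
      then show ?thesis unfolding R_def using \<tau>_less[OF that(2) ab(1)] that
        by (intro image_eqI[of _ _ "(\<tau> l a, l)"]) simp_all
    qed
    assume "a = b \<and> par_edge par i j"
    then show "{g (a, i), g (b, j)} \<in> R (v, \<sigma>)"
      using R_I[of i] R_I[of j] ab by (auto simp: par_edge_def insert_commute)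
  qed
  have vB: "v ` B = g ` ({..<k} \<times> {..<t})"
  proof (intro equalityI subsetI)
    fix x assume "x \<in> v ` B"
    then obtain b i where b: "b < k" "i < t" "x = v (b, i)" by auto
    have "b \<in> \<tau> i ` {..<k}" using permutes_image[OF \<tau>(1)[OF b(2)]] b(1) by simp
    then obtain a where "a < k" "b = \<tau> i a" by auto
    then show "x \<in> g ` ({..<k} \<times> {..<t})" using b by (intro image_eqI[of _ _ "(a, i)"]) (auto simp: g_def)
  next
    fix x assume "x \<in> g ` ({..<k} \<times> {..<t})"
    then show "x \<in> v ` B" using \<tau>_less by (auto simp: g_def)
  qed
  have XR: "X {x, y} \<longleftrightarrow> {x, y} \<in> R (v, \<sigma>)" if "x \<in> v ` B" "y \<in> v ` B" "x \<noteq> y" for x y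
  proof -
    have "{x, y} \<in> P (v, \<sigma>)" using that by (simp add: P_def)
    then show ?thesis using X by (auto simp: pattern_event_def N_def)
  qed
  have neq: "x \<noteq> y" if "{x, y} \<in> R (v, \<sigma>)" for x y
  proof
    assume "x = y"
    then have "card {x, y} = 1" by simp
    moreover have "card {x, y} = 2" using that R_subset_P[OF \<psi>] by (auto simp: P_def)
    ultimately show False by simp
  qed
  have "tree_copies t par (\<lambda>u v. u \<noteq> v \<and> X {u, v}) {..<k} g"
    unfolding tree_copies_def
  proof (intro conjI ballI allI impI)
    show "inj_on g ({..<k} \<times> {..<t})" using g_eqD by (auto simp: inj_on_def)
    fix a b i j assume "a \<in> {..<k}" "b \<in> {..<k}" "i < t" "j < t"
    then have *: "a < k" "b < k" "i < t" "j < t" by simp_all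
    have "g (a, i) \<in> v ` B" "g (b, j) \<in> v ` B" unfolding vB using * by simp_all
    then show "(g (a, i) \<noteq> g (b, j) \<and> X {g (a, i), g (b, j)}) \<longleftrightarrow> (a = b \<and> par_edge par i j)"
      using XR neq edge_iff[OF *] by blast
  qed
  then show ?thesis unfolding tree_matching_def vB by blast
qed

definition "transversal U \<longleftrightarrow> U \<subseteq> (\<Union>\<beta>\<in>B. W \<beta>) \<and> (\<forall>\<beta>\<in>B. card (U \<inter> W \<beta>) \<le> 1)"

definition "Y X = Max (card ` {U. tree_matching t par X U \<and> transversal U})"

lemma finite_blocks: "finite (\<Union>\<beta>\<in>B. W \<beta>)"
  using finite_W by blast

lemma finite_transversals: "finite {U. tree_matching t par X U \<and> transversal U}"
  by (rule finite_subset[of _ "Pow (\<Union>\<beta>\<in>B. W \<beta>)"]) (auto simp: transversal_def finite_W)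

lemma Y_ge: "tree_matching t par X U \<Longrightarrow> transversal U \<Longrightarrow> card U \<le> Y X"
  unfolding Y_def using finite_transversals by (intro Max_ge) auto

lemma Y_attained:
  obtains U where "tree_matching t par X U" "transversal U" "card U = Y X"
proof -
  have "{} \<in> {U. tree_matching t par X U \<and> transversal U}"
    by (simp add: tree_matching_empty transversal_def)
  then have "card ` {U. tree_matching t par X U \<and> transversal U} \<noteq> {}" by blast
  then have "Y X \<in> card ` {U. tree_matching t par X U \<and> transversal U}"
    unfolding Y_def using finite_transversals by (intro Max_in) auto
  then show ?thesis using that by auto
qed

lemma transversal_subset: "transversal U \<Longrightarrow> U' \<subseteq> U \<Longrightarrow> transversal U'"
proof -
  assume U: "transversal U" "U' \<subseteq> U"
  have "card (U' \<inter> W \<beta>) \<le> 1" if "\<beta> \<in> B" for \<beta>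
  proof -
    have "card (U' \<inter> W \<beta>) \<le> card (U \<inter> W \<beta>)" using U finite_W[OF that] by (intro card_mono) auto
    then show ?thesis using U that unfolding transversal_def by (meson order_trans)
  qed
  then show ?thesis using U unfolding transversal_def by blast
qed

text \<open>
  The edges are exposed in groups, each edge being assigned to one of the blocks that it meets; an edge
  meeting no block is irrelevant for \<open>Y\<close> and goes to an arbitrary group.
\<close>

definition "block_of e = (if \<exists>\<beta>\<in>B. e \<inter> W \<beta> \<noteq> {} then SOME \<beta>. \<beta> \<in> B \<and> e \<inter> W \<beta> \<noteq> {} else (0, 0))"

lemma block_of_in: "block_of e \<in> B"
proof (cases "\<exists>\<beta>\<in>B. e \<inter> W \<beta> \<noteq> {}")
  case True
  then have "\<exists>\<beta>. \<beta> \<in> B \<and> e \<inter> W \<beta> \<noteq> {}" by blast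
  from someI_ex[OF this] show ?thesis using True by (simp add: block_of_def)
next
  case False
  then show ?thesis using k_pos t_pos by (auto simp: block_of_def)
qed

lemma block_of_meets: "\<beta> \<in> B \<Longrightarrow> e \<inter> W \<beta> \<noteq> {} \<Longrightarrow> e \<inter> W (block_of e) \<noteq> {}"
proof -
  assume "\<beta> \<in> B" "e \<inter> W \<beta> \<noteq> {}"
  then have ex: "\<exists>\<beta>. \<beta> \<in> B \<and> e \<inter> W \<beta> \<noteq> {}" by blast
  then have "block_of e = (SOME \<beta>. \<beta> \<in> B \<and> e \<inter> W \<beta> \<noteq> {})" by (auto simp: block_of_def)
  then show ?thesis using someI_ex[OF ex] by simp
qed

text \<open>If an optimal \<open>U\<close> for \<open>X\<close> has a vertex in block \<beta>, the
  copy through it is discarded. Every pair of remaining vertices is assigned to a block that it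
  meets, hence not to \<beta>, so its status is the same in \<open>X'\<close> and the rest of
  \<open>U\<close> survives.\<close>

lemma Y_le_add:
  assumes \<beta>: "\<beta> \<in> B" and eq: "\<And>e. block_of e \<noteq> \<beta> \<Longrightarrow> X e = X' e"
  shows "Y X \<le> Y X' + t"
proof -
  obtain U where U: "tree_matching t par X U" "transversal U" "card U = Y X" by (rule Y_attained)
  have finU: "finite U" using U(2) finite_blocks finite_subset unfolding transversal_def by blast
  obtain U' where U': "tree_matching t par X U'" "U' \<subseteq> U" "U' \<inter> W \<beta> = {}" "card U \<le> card U' + t"
  proof (cases "U \<inter> W \<beta> = {}")
    case True
    then show ?thesis using that[of U] U(1) by simp
  next
    case False
    then obtain x where x: "x \<in> U" "x \<in> W \<beta>" by blast
    have "card (U \<inter> W \<beta>) \<le> 1" using U(2) \<beta> unfolding transversal_def by blast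
    then have "card (U \<inter> W \<beta>) = 1" using x finU by (metis False card_0_eq finite_Int le_neq_implies_less less_one)
    then obtain y where "U \<inter> W \<beta> = {y}" by (rule card_1_singletonE)
    then have single: "U \<inter> W \<beta> = {x}" using x by auto
    obtain U' where U': "tree_matching t par X U'" "U' \<subseteq> U" "x \<notin> U'" "card U \<le> card U' + t"
      using tree_matching_remove[OF U(1) finU x(1)] .
    have "U' \<inter> W \<beta> = {}" using U'(2,3) single by auto
    with U' show ?thesis by (intro that[of U'])
  qed
  have "tree_matching t par X' U'"
  proof (rule tree_matching_cong[OF U'(1)])
    fix u v assume uv: "u \<in> U'" "v \<in> U'" "u \<noteq> v"
    have "u \<in> (\<Union>\<beta>\<in>B. W \<beta>)" using uv U'(2) U(2) unfolding transversal_def by blast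
    then obtain \<gamma> where "\<gamma> \<in> B" "u \<in> W \<gamma>" by blast
    then have "{u, v} \<inter> W (block_of {u, v}) \<noteq> {}" by (intro block_of_meets[of \<gamma>]) auto
    then have "block_of {u, v} \<noteq> \<beta>" using U'(3) uv by auto
    then show "X {u, v} = X' {u, v}" by (rule eq)
  qed
  then have "card U' \<le> Y X'" using transversal_subset[OF U(2) U'(2)] by (rule Y_ge)
  then show ?thesis using U(3) U'(4) by simp
qed

lemma transversal_image:
  assumes "(v, \<sigma>) \<in> \<Psi>"
  shows "transversal (v ` B)"
proof -
  have "card (v ` B \<inter> W \<beta>) \<le> 1" if "\<beta> \<in> B" for \<beta>
  proof -
    have "v ` B \<inter> W \<beta> \<subseteq> {v \<beta>}"
    proof
      fix x assume "x \<in> v ` B \<inter> W \<beta>"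
      then obtain \<gamma> where "\<gamma> \<in> B" "x = v \<gamma>" "v \<gamma> \<in> W \<beta>" by blast
      then show "x \<in> {v \<beta>}" using disjoint_W[OF _ that \<Psi>_D(1)[OF assms]] by blast
    qed
    then show ?thesis using card_mono[of "{v \<beta>}" "v ` B \<inter> W \<beta>"] by simp
  qed
  moreover have "v ` B \<subseteq> (\<Union>\<beta>\<in>B. W \<beta>)" using \<Psi>_D(1)[OF assms] by blast
  ultimately show ?thesis by (simp add: transversal_def)
qed

text \<open>Two deviations of size l = \<delta> k t account for the 2\<delta>: the upper tail
  locates the mean, the lower tail places \<open>Y\<close> near it. The assumption on the sum says
  that the second moment bound exceeds the upper tail.\<close>

lemma prob_large_matching:
  fixes p \<delta> :: real
  assumes p: "0 < p" "p < 1" and kp: "exp 1 \<le> k * p" and \<delta>: "0 < \<delta>"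
    and S: "(\<Sum>l\<le>k * t. ((k * t) choose l) * (1 / m) ^ l * (2 ^ l * (1 / (1 - p)) ^ (l choose 2)))
      < exp (2 * \<delta>\<^sup>2 * k / t)"
  defines "M \<equiv> Pi_pmf {e. e \<subseteq> {1..n} \<and> card e = 2} False (\<lambda>_. bernoulli_pmf p)"
  shows "measure_pmf.prob M {X. \<exists>U\<subseteq>{1..n}. tree_matching t par X U \<and> (1 - 2 * \<delta>) * (k * t) \<le> card U}
    \<ge> 1 - exp (- 2 * \<delta>\<^sup>2 * k / t)"
proof -
  define E where "E = {e :: nat set. e \<subseteq> {1..n} \<and> card e = 2}"
  define A where "A = (\<lambda>\<beta>. {e \<in> E. block_of e = \<beta>})"
  define S' where "S' = (\<Sum>l\<le>k * t. real ((k * t) choose l) * (1 / real m) ^ l * (2 ^ l * (1 / (1 - p)) ^ (l choose 2)))"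
  have finE: "finite E" unfolding E_def by (rule finite_subset[of _ "Pow {1..n}"]) auto
  have UA: "(\<Union>\<beta>\<in>B. A \<beta>) = E" using block_of_in by (auto simp: A_def)
  have M: "M = Pi_pmf (\<Union>\<beta>\<in>B. A \<beta>) False (\<lambda>_. bernoulli_pmf p)" unfolding UA M_def E_def ..
  have finA: "finite (A \<beta>)" for \<beta> using finE by (simp add: A_def)
  have disjA: "disjoint_family_on A B" by (auto simp: disjoint_family_on_def A_def)
  have Bne: "B \<noteq> {}" "finite B" using block_of_in by auto
  have cB: "card B = k * t" by (simp add: card_cartesian_product)
  define f where "f = (\<lambda>X. real (Y (\<lambda>e. e \<in> E \<and> X e)))"
  have lip: "\<bar>f X - f X'\<bar> \<le> t" if "\<beta> \<in> B" "\<And>e. e \<notin> A \<beta> \<Longrightarrow> X e = X' e" for \<beta> X X'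
  proof -
    have eq: "(e \<in> E \<and> X e) = (e \<in> E \<and> X' e)" if "block_of e \<noteq> \<beta>" for e
      using \<open>\<And>e. e \<notin> A \<beta> \<Longrightarrow> X e = X' e\<close>[of e] that by (auto simp: A_def)
    have "Y (\<lambda>e. e \<in> E \<and> X e) \<le> Y (\<lambda>e. e \<in> E \<and> X' e) + t"
      by (rule Y_le_add[OF that(1)]) (rule eq)
    moreover have "Y (\<lambda>e. e \<in> E \<and> X' e) \<le> Y (\<lambda>e. e \<in> E \<and> X e) + t"
      by (rule Y_le_add[OF that(1)]) (rule eq[symmetric])
    ultimately show ?thesis unfolding f_def by linarith
  qed
  define l where "l = \<delta> * (k * t)"
  have l0: "l \<ge> 0" using \<delta> by (simp add: l_def)
  \<comment> \<open>There are kt groups with Lipschitz constant \<open>t\<close>.\<close>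
  have expo: "- 2 * l\<^sup>2 / (card B * (real t)\<^sup>2) = - 2 * \<delta>\<^sup>2 * k / t"
    using k_pos t_pos by (simp add: l_def cB power2_eq_square field_simps)
  \<comment> \<open>The default value \<open>False\<close> outside \<open>E\<close> makes the
    truncation in \<open>f\<close> invisible on the support of \<open>M\<close>.\<close>
  have XE: "(\<lambda>e. e \<in> E \<and> X e) = X" if "X \<in> set_pmf M" for X
    using that set_Pi_pmf_subset[OF finE] unfolding M UA by (fastforce simp: fun_eq_iff)
  let ?Ef = "measure_pmf.expectation M f"
  have up: "measure_pmf.prob M {X. f X \<ge> ?Ef + l} \<le> exp (- 2 * \<delta>\<^sup>2 * k / t)"
    unfolding expo[symmetric] M
    by (rule mcdiarmid_ge) (use Bne finA disjA t_pos l0 lip in auto)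
  have low: "measure_pmf.prob M {X. f X \<le> ?Ef - l} \<le> exp (- 2 * \<delta>\<^sup>2 * k / t)"
    unfolding expo[symmetric] M
    by (rule mcdiarmid_le) (use Bne finA disjA t_pos l0 lip in auto)
  have some: "1 / S' \<le> measure_pmf.prob M {X. f X \<ge> k * t}"
  proof -
    have "1 / S' \<le> measure_pmf.prob M (\<Union>\<psi>\<in>\<Psi>. pattern_event (R \<psi>) (N \<psi>))"
      unfolding S'_def M_def by (rule prob_some_pattern_ge[OF p kp])
    also have "\<dots> \<le> measure_pmf.prob M {X. f X \<ge> k * t}"
    proof (rule measure_pmf.finite_measure_mono_AE)
      show "AE X in M. X \<in> (\<Union>\<psi>\<in>\<Psi>. pattern_event (R \<psi>) (N \<psi>)) \<longrightarrow> X \<in> {X. f X \<ge> k * t}"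
      proof (rule AE_pmfI, rule impI)
        fix X assume XM: "X \<in> set_pmf M" and "X \<in> (\<Union>\<psi>\<in>\<Psi>. pattern_event (R \<psi>) (N \<psi>))"
        then obtain v \<sigma> where \<psi>: "(v, \<sigma>) \<in> \<Psi>" "X \<in> pattern_event (R (v, \<sigma>)) (N (v, \<sigma>))" by auto
        have "card (v ` B) \<le> Y X"
          by (rule Y_ge[OF tree_matching_of_pattern[OF \<psi>] transversal_image[OF \<psi>(1)]])
        also have "card (v ` B) = k * t" using card_image[OF inj_on_v[OF \<psi>(1)]] cB by simp
        finally show "X \<in> {X. f X \<ge> k * t}" using XE[OF XM] by (simp add: f_def flip: of_nat_mult)
      qed
    qed simp
    finally show ?thesis .
  qed
  have "S' > 0"
  proof -
    have "(\<Sum>l\<in>{0}. real ((k * t) choose l) * (1 / real m) ^ l * (2 ^ l * (1 / (1 - p)) ^ (l choose 2))) \<le> S'"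
      unfolding S'_def using p by (intro sum_mono2) auto
    then show ?thesis by (simp add: numeral_2_eq_2)
  qed
  then have "exp (- 2 * \<delta>\<^sup>2 * k / t) < 1 / S'"
    using S[folded S'_def] by (simp add: exp_minus field_simps)
  then have "measure_pmf.prob M {X. f X \<ge> ?Ef + l} < measure_pmf.prob M {X. f X \<ge> k * t}"
    using up some by linarith
  \<comment> \<open>Otherwise the event f >= kt would be contained in the upper tail event, although
    it is strictly more likely.\<close>
  then have Ef: "k * t < ?Ef + l"
    using measure_pmf.finite_measure_mono[of "{X. f X \<ge> k * t}" "{X. f X \<ge> ?Ef + l}" M] by fastforce
  have "1 - exp (- 2 * \<delta>\<^sup>2 * k / t) \<le> 1 - measure_pmf.prob M {X. f X \<le> ?Ef - l}"
    using low by simp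
  also have "\<dots> = measure_pmf.prob M {X. \<not> f X \<le> ?Ef - l}"
    using measure_pmf.prob_compl[of "{X. f X \<le> ?Ef - l}" M] by (simp add: Compl_eq[symmetric] Compl_eq_Diff_UNIV[symmetric] Collect_neg_eq)
  also have "\<dots> \<le> measure_pmf.prob M {X. \<exists>U\<subseteq>{1..n}. tree_matching t par X U \<and> (1 - 2 * \<delta>) * (k * t) \<le> card U}"
  proof (rule measure_pmf.finite_measure_mono_AE)
    show "AE X in M. X \<in> {X. \<not> f X \<le> ?Ef - l} \<longrightarrow>
        X \<in> {X. \<exists>U\<subseteq>{1..n}. tree_matching t par X U \<and> (1 - 2 * \<delta>) * (k * t) \<le> card U}"
    proof (rule AE_pmfI, rule impI)
      fix X assume XM: "X \<in> set_pmf M" and "X \<in> {X. \<not> f X \<le> ?Ef - l}"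
      then have *: "k * t - 2 * l < Y X" using Ef XE[OF XM] by (simp add: f_def)
      obtain U where U: "tree_matching t par X U" "transversal U" "card U = Y X" by (rule Y_attained)
      have "U \<subseteq> {1..n}" using U(2) W_subset unfolding transversal_def by blast
      moreover have "(1 - 2 * \<delta>) * (k * t) \<le> card U" using * U(3) by (simp add: l_def algebra_simps)
      ultimately show "X \<in> {X. \<exists>U\<subseteq>{1..n}. tree_matching t par X U \<and> (1 - 2 * \<delta>) * (k * t) \<le> card U}"
        using U(1) by blast
    qed
  qed simp
  finally show ?thesis .
qed

end

section \<open>First moment\<close>

context par_tree
begin

lemma inj_on_parent_edge:
  assumes inj: "inj_on g (A \<times> {..<t})"
  shows "inj_on (\<lambda>(a, i). {g (a, i), g (a, par i)}) (A \<times> {1..<t})"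
proof (rule inj_onI)
  fix x y assume xy: "x \<in> A \<times> {1..<t}" "y \<in> A \<times> {1..<t}"
    "(\<lambda>(a, i). {g (a, i), g (a, par i)}) x = (\<lambda>(a, i). {g (a, i), g (a, par i)}) y"
  obtain a i b j where [simp]: "x = (a, i)" "y = (b, j)" by (cases x, cases y)
  have ab: "a \<in> A" "b \<in> A" "0 < i" "i < t" "0 < j" "j < t" using xy by auto
  have par: "par i < i" "par j < j" using par_less ab by auto
  have eqD: "(c, l) = (c', l')" if "c \<in> A" "c' \<in> A" "l < t" "l' < t" "g (c, l) = g (c', l')" for c c' l l'
    using inj_onD[OF inj that(5)] that by simp
  have "g (a, i) = g (b, j) \<or> g (a, i) = g (b, par j) \<and> g (a, par i) = g (b, j)"
    using xy(3) by (auto simp: doubleton_eq_iff)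
  then show "x = y"
  proof
    assume "g (a, i) = g (b, j)"
    then show ?thesis using eqD[of a b i j] ab by simp
  next
    assume "g (a, i) = g (b, par j) \<and> g (a, par i) = g (b, j)"
    then have "i = par j" "par i = j" using eqD[of a b i "par j"] eqD[of a b "par i" j] ab par by auto
    then show ?thesis using par by simp
  qed
qed

text \<open>Requiring the root of copy \<open>v\<close> to be \<open>v\<close> makes the index set
  the set of roots. Families that differ by the order of the copies then coincide, and there are (n
  choose k) root sets instead of n^k lists of roots; the gain of about (e/k)^k compensates
  p^(-k).\<close>

definition rooted_copies :: "nat \<Rightarrow> nat \<Rightarrow> (nat set \<Rightarrow> bool) \<Rightarrow> bool" where
  "rooted_copies n k X \<longleftrightarrow> (\<exists>I g. I \<subseteq> {1..n} \<and> card I = k \<and> g ` (I \<times> {..<t}) \<subseteq> {1..n} \<and>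
     (\<forall>v\<in>I. g (v, 0) = v) \<and> tree_copies t par (\<lambda>u v. u \<noteq> v \<and> X {u, v}) I g)"

text \<open>Union bound over the pairs of a root set and a placement of the other t-1 vertices of
  each copy. A placement prescribes k(t-1) edges and the absence of all other pairs.\<close>

lemma prob_rooted_copies_le:
  fixes p :: real and n k :: nat
  assumes p: "0 < p" "p < 1"
  defines "M \<equiv> Pi_pmf {e. e \<subseteq> {1..n} \<and> card e = 2} False (\<lambda>_. bernoulli_pmf p)"
  shows "measure_pmf.prob M {X. rooted_copies n k X}
    \<le> (n choose k) * n ^ (k * (t - 1)) * (p ^ (k * (t - 1)) * (1 - p) ^ (((k * t) choose 2) - k * (t - 1)))"
proof -
  define Idx where "Idx = (SIGMA A:{A. A \<subseteq> {1..n} \<and> card A = k}. PiE (A \<times> {1..<t}) (\<lambda>_. {1..n}))"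
  define G :: "(nat \<times> nat \<Rightarrow> nat) \<Rightarrow> nat \<times> nat \<Rightarrow> nat"
    where "G = (\<lambda>h (v, i). if i = 0 then v else h (v, i))"
  define R where "R = (\<lambda>(A, h). (\<lambda>(a, i). {G h (a, i), G h (a, par i)}) ` (A \<times> {1..<t}))"
  define P where "P = (\<lambda>(A, h). {e. e \<subseteq> G h ` (A \<times> {..<t}) \<and> card e = 2})"
  \<comment> \<open>Placements that are not injective or leave the vertex set get the empty event,
    so one bound holds for every index and the indices can be counted as a full product.\<close>
  define Ev where "Ev = (\<lambda>(A, h). if inj_on (G h) (A \<times> {..<t}) \<and> G h ` (A \<times> {..<t}) \<subseteq> {1..n}
    then pattern_event (R (A, h)) (P (A, h) - R (A, h)) else {})"
  let ?P0 = "p ^ (k * (t - 1)) * (1 - p) ^ (((k * t) choose 2) - k * (t - 1))"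
  have finE: "finite {e :: nat set. e \<subseteq> {1..n} \<and> card e = 2}"
    by (rule finite_subset[of _ "Pow {1..n}"]) auto
  have finS: "finite {A :: nat set. A \<subseteq> {1..n} \<and> card A = k}"
    by (rule finite_subset[of _ "Pow {1..n}"]) auto
  have finA: "finite A" if "A \<subseteq> {1..n :: nat}" for A using that by (rule finite_subset) simp
  have finIdx: "finite Idx" unfolding Idx_def
    by (intro finite_SigmaI finS finite_PiE finite_cartesian_product) (auto intro: finite_subset[of _ "{Suc 0..n}"])
  have cardIdx: "card Idx = (n choose k) * n ^ (k * (t - 1))"
  proof -
    have "card Idx = (\<Sum>A | A \<subseteq> {1..n} \<and> card A = k. card (PiE (A \<times> {1..<t}) (\<lambda>_. {1..n})))"
      unfolding Idx_def
    proof (rule card_SigmaI[OF finS], rule ballI)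
      fix A assume "A \<in> {A. A \<subseteq> {1..n} \<and> card A = k}"
      then have "finite A" using finA by blast
      then show "finite (PiE (A \<times> {1..<t}) (\<lambda>_. {1..n}))" by (intro finite_PiE) auto
    qed
    also have "\<dots> = (\<Sum>A | A \<subseteq> {1..n} \<and> card A = k. n ^ (k * (t - 1)))"
    proof (rule sum.cong)
      fix A assume A: "A \<in> {A. A \<subseteq> {1..n} \<and> card A = k}"
      then have "finite (A \<times> {1..<t})" using finA by blast
      then show "card (PiE (A \<times> {1..<t}) (\<lambda>_. {1..n})) = n ^ (k * (t - 1))"
        using A by (simp add: card_PiE card_cartesian_product)
    qed simp
    also have "\<dots> = (n choose k) * n ^ (k * (t - 1))" using n_subsets[of "{1..n}" k] by simp
    finally show ?thesis .
  qed
  have R_E: "\<exists>a i. a \<in> A \<and> 0 < i \<and> i < t \<and> e = {G h (a, i), G h (a, par i)}"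
    if e: "e \<in> R (A, h)" for e A h
  proof -
    obtain z where "z \<in> A \<times> {1..<t}" "e = (\<lambda>(a, i). {G h (a, i), G h (a, par i)}) z"
      using e unfolding R_def prod.case by (rule imageE) (rule that)
    then show ?thesis by (intro exI[of _ "fst z"] exI[of _ "snd z"]) (auto simp: case_prod_beta)
  qed
  have prob: "measure_pmf.prob M (Ev z) \<le> ?P0" if z: "z \<in> Idx" for z
  proof -
    obtain A h where z_eq: "z = (A, h)" by (cases z)
    show ?thesis
    proof (cases "inj_on (G h) (A \<times> {..<t}) \<and> G h ` (A \<times> {..<t}) \<subseteq> {1..n}")
      case True
      have A: "finite A" "card A = k" using z finA by (auto simp: z_eq Idx_def)
      have cR: "card (R z) = k * (t - 1)"
        unfolding R_def z_eq using inj_on_parent_edge[of "G h" A] True A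
        by (simp add: card_image card_cartesian_product)
      have cP: "card (P z) = (k * t) choose 2"
        unfolding P_def z_eq using True A by (simp add: n_subsets card_image card_cartesian_product)
      have PE: "P z \<subseteq> {e. e \<subseteq> {1..n} \<and> card e = 2}"
        using True unfolding P_def z_eq by auto
      have RP: "R z \<subseteq> P z"
      proof
        fix e assume "e \<in> R z"
        then obtain a i where a: "a \<in> A" "0 < i" "i < t" "e = {G h (a, i), G h (a, par i)}"
          using R_E[of e A h] unfolding z_eq by blast
        have "par i < t" "par i \<noteq> i" using par_less[OF a(2,3)] a(3) by auto
        then have "G h (a, i) \<noteq> G h (a, par i)"
          using inj_onD[OF conjunct1[OF True], of "(a, i)" "(a, par i)"] a by auto
        moreover have "G h (a, i) \<in> G h ` (A \<times> {..<t})" "G h (a, par i) \<in> G h ` (A \<times> {..<t})"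
          using a \<open>par i < t\<close> by blast+
        ultimately show "e \<in> P z" unfolding P_def z_eq a(4) by simp
      qed
      have finR: "finite (R z)" by (rule finite_subset[OF RP finite_subset[OF PE finE]])
      have "Ev z = pattern_event (R z) (P z - R z)" using True by (simp add: Ev_def z_eq)
      moreover have "measure_pmf.prob M (pattern_event (R z) (P z - R z)) =
          p ^ card (R z) * (1 - p) ^ card (P z - R z)"
        unfolding M_def by (rule prob_pattern_event[OF finE]) (use RP PE p in auto)
      ultimately show ?thesis using card_Diff_subset[OF finR RP] by (simp add: cR cP)
    next
      case False
      then show ?thesis unfolding Ev_def z_eq prod.case if_not_P[OF False] using p by simp
    qed
  qed
  have cover: "X \<in> (\<Union>z\<in>Idx. Ev z)" if X: "rooted_copies n k X" for X
  proof -
    obtain I g where g: "I \<subseteq> {1..n}" "card I = k" "g ` (I \<times> {..<t}) \<subseteq> {1..n}" "\<forall>v\<in>I. g (v, 0) = v"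
      "tree_copies t par (\<lambda>u v. u \<noteq> v \<and> X {u, v}) I g"
      using X unfolding rooted_copies_def by (elim exE conjE)
    define h where "h = restrict g (I \<times> {1..<t})"
    have Gh: "G h (v, i) = g (v, i)" if "v \<in> I" "i < t" for v i
      using g(4) that by (simp add: G_def h_def)
    have im: "G h ` (I \<times> {..<t}) = g ` (I \<times> {..<t})"
      by (rule image_cong) (use Gh in auto)
    have inj: "inj_on (G h) (I \<times> {..<t})"
      using g(5) inj_on_cong[of "I \<times> {..<t}" "G h" g] Gh by (auto simp: tree_copies_def)
    have "h \<in> PiE (I \<times> {1..<t}) (\<lambda>_. {1..n})"
    proof (rule PiE_I)
      fix x assume x: "x \<in> I \<times> {1..<t}"
      then have "g x \<in> g ` (I \<times> {..<t})" by (intro imageI) auto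
      then show "h x \<in> {1..n}" using g(3) x by (auto simp: h_def)
    qed (simp add: h_def)
    then have Idx: "(I, h) \<in> Idx" using g(1,2) by (simp add: Idx_def)
    have adj: "(g (a, i) \<noteq> g (b, j) \<and> X {g (a, i), g (b, j)}) \<longleftrightarrow> a = b \<and> par_edge par i j"
      if "a \<in> I" "b \<in> I" "i < t" "j < t" for a b i j
      using g(5) that unfolding tree_copies_def by simp
    have "X e" if eR: "e \<in> R (I, h)" for e
    proof -
      obtain a i where a: "a \<in> I" "0 < i" "i < t" "e = {G h (a, i), G h (a, par i)}"
        using R_E[OF eR] by blast
      have pi: "par i < t" using par_less[OF a(2,3)] a(3) by simp
      have "X {g (a, i), g (a, par i)}" using adj[OF a(1,1,3) pi] a(2) by (simp add: par_edge_def)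
      then show ?thesis using Gh[OF a(1,3)] Gh[OF a(1) pi] a(4) by simp
    qed
    moreover have "\<not> X e" if e: "e \<in> P (I, h) - R (I, h)" for e
    proof
      assume Xe: "X e"
      have "e \<subseteq> g ` (I \<times> {..<t})" "card e = 2" using e im by (auto simp: P_def)
      then obtain x y where xy: "e = {x, y}" "x \<noteq> y" "x \<in> g ` (I \<times> {..<t})" "y \<in> g ` (I \<times> {..<t})"
        by (auto simp: card_2_iff)
      obtain a i b j where ab: "a \<in> I" "i < t" "x = g (a, i)" "b \<in> I" "j < t" "y = g (b, j)"
        using xy(3,4) by auto
      have E: "a = b \<and> par_edge par i j" using adj[OF ab(1,4,2,5)] xy Xe ab by simp
      have RI: "{g (a, l), g (a, par l)} \<in> R (I, h)" if "0 < l" "l < t" for l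
      proof -
        have "par l < t" using par_less[OF that] that by simp
        then have "{g (a, l), g (a, par l)} = {G h (a, l), G h (a, par l)}" using Gh ab(1) that by simp
        then show ?thesis unfolding R_def using ab(1) that by auto
      qed
      have "e \<in> R (I, h)" using E RI[of i] RI[of j] ab xy(1)
        by (auto simp: par_edge_def insert_commute)
      then show False using e by simp
    qed
    ultimately have "X \<in> pattern_event (R (I, h)) (P (I, h) - R (I, h))" by (simp add: pattern_event_def)
    then have "X \<in> Ev (I, h)" using inj im g(3) by (simp add: Ev_def)
    then show ?thesis using Idx by blast
  qed
  have "measure_pmf.prob M {X. rooted_copies n k X} \<le> measure_pmf.prob M (\<Union>z\<in>Idx. Ev z)"
    by (rule measure_pmf.finite_measure_mono) (use cover in auto)
  also have "\<dots> \<le> (\<Sum>z\<in>Idx. measure_pmf.prob M (Ev z))"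
    by (rule measure_pmf.finite_measure_subadditive_finite) (use finIdx in auto)
  also have "\<dots> \<le> (\<Sum>z\<in>Idx. ?P0)" by (rule sum_mono) (rule prob)
  finally show ?thesis by (simp add: cardIdx)
qed

end

section \<open>Numerical estimates\<close>

lemma binomial_le_exp_div: "real (n choose k) \<le> (real n * exp 1 / real k) ^ k"
proof (cases "k = 0 \<or> k > n")
  case False
  then have k: "0 < k" "k \<le> n" by auto
  have "fact n = fact (n - k) * (fact k * (n choose k))"
    using binomial_fact_lemma[OF k(2)] by (simp only: mult_ac)
  then have "fact n div fact (n - k) = fact k * (n choose k)" by (simp only:) simp
  then have "fact k * (n choose k) \<le> n ^ k" using fact_div_fact_le_pow[OF k(2)] by simp
  then have "real (fact k * (n choose k)) \<le> real (n ^ k)" by (simp only: of_nat_le_iff)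
  then have "real (n choose k) \<le> real n ^ k / fact k" by (simp add: field_simps)
  also have "\<dots> \<le> real n ^ k / (real k / exp 1) ^ k"
    using power_div_exp_le_fact[of k] k by (intro divide_left_mono) auto
  also have "\<dots> = (real n * exp 1 / real k) ^ k" by (simp add: power_divide power_mult_distrib)
  finally show ?thesis .
qed (auto simp: binomial_eq_0)

lemma real_choose_two: "real (n choose 2) = real n * (real n - 1) / 2"
  by (cases n) (auto simp: choose_two real_of_nat_div algebra_simps)

text \<open>Written as an n-th power, the quantity merges with the other n-th powers in the moment
  bounds, and only its base has to be estimated.\<close>

lemma power_choose_two_eq_powr:
  assumes "0 < x"
  shows "x ^ (n choose 2) = (x powr ((real n - 1) / 2)) ^ n"
proof -
  have "x ^ (n choose 2) = x powr (real (n choose 2))" using assms by (simp add: powr_realpow)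
  also have "\<dots> = (x powr ((real n - 1) / 2)) powr real n" by (simp add: real_choose_two powr_powr mult.commute)
  also have "\<dots> = (x powr ((real n - 1) / 2)) ^ n" using assms by (simp add: powr_realpow)
  finally show ?thesis .
qed

text \<open>Everything is collected into the k-th power of one factor per component, e/(kp) (npA)^t
  q^(t-1), where A^(kt) is (1-p)^((kt) choose 2). The quotient is at most 1. By the size of
  \<open>k\<close>, npA is at most q^(1/2) (np)^(-\<epsilon>/2) <= 1/200: one 100 in the constant 2
  * 100^2 pays for q^(1/2), the other, with the 2, beats q^(t-1) <= 100^(t-1).\<close>

lemma expected_copies_le:
  fixes p \<epsilon> :: real and n k t :: nat
  assumes p: "0 < p" "p \<le> 99/100" and t: "0 < t" and k: "0 < k" and \<epsilon>: "0 < \<epsilon>"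
    and kp: "exp 1 \<le> k * p"
    and large: "(2 + \<epsilon>) * log (1 / (1 - p)) (n * p) \<le> k * t"
    and d: "2 * 100\<^sup>2 \<le> (n * p) powr (\<epsilon> / 2)"
  shows "(n choose k) * n ^ (k * (t - 1)) * (p ^ (k * (t - 1)) * (1 - p) ^ (((k * t) choose 2) - k * (t - 1)))
    \<le> (1 / 2) ^ k"
proof -
  define q where "q = 1 / (1 - p)"
  have q: "1 < q" "q \<le> 100" using p by (simp_all add: q_def field_simps)
  have np: "n * p > 0" using d p by (cases "n = 0") auto
  define A where "A = (1 - p) powr ((real (k * t) - 1) / 2)"
  have A0: "A > 0" using p by (simp add: A_def)
  have kp0: "real k * p > 0" using k p by simp
  \<comment> \<open>Passing from the non-edges to all pairs costs q^(k(t-1)). Subtraction of natural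
    numbers is truncated; both cases lead to the same inequality.\<close>
  have "(1 - p) ^ (((k * t) choose 2) - k * (t - 1)) \<le> A ^ (k * t) * q ^ (k * (t - 1))"
  proof -
    let ?c = "(k * t) choose 2" and ?r = "k * (t - 1)"
    have "(1 - p) ^ (?c - ?r) * (1 - p) ^ ?r \<le> (1 - p) ^ ?c" if "?r \<le> ?c"
      using that by (simp add: power_add[symmetric])
    moreover have "(1 - p) ^ (?c - ?r) * (1 - p) ^ ?r \<le> (1 - p) ^ ?c" if "\<not> ?r \<le> ?c"
      using that p by (simp add: power_decreasing)
    ultimately have "(1 - p) ^ (?c - ?r) * (1 - p) ^ ?r \<le> (1 - p) ^ ?c" by blast
    moreover have "(1 - p) ^ ?c = A ^ (k * t)"
      unfolding A_def using p by (intro power_choose_two_eq_powr) simp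
    ultimately show ?thesis using p by (simp add: q_def power_divide field_simps)
  qed
  then have "(n choose k) * n ^ (k * (t - 1)) * (p ^ (k * (t - 1)) * (1 - p) ^ (((k * t) choose 2) - k * (t - 1)))
     \<le> (real n * exp 1 / real k) ^ k * real n ^ (k * (t - 1)) *
        (p ^ (k * (t - 1)) * (A ^ (k * t) * q ^ (k * (t - 1))))"
    using p by (simp add: mult_mono binomial_le_exp_div)
  also have "\<dots> = ((real n * exp 1 / real k) * real n ^ (t - 1) * (p ^ (t - 1) * (A ^ t * q ^ (t - 1)))) ^ k"
    by (simp only: power_mult_distrib mult.commute[of k] power_mult mult.assoc)
  also have "(real n * exp 1 / real k) * real n ^ (t - 1) * (p ^ (t - 1) * (A ^ t * q ^ (t - 1)))
      = exp 1 / (k * p) * ((n * p * A) ^ t * q ^ (t - 1))"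
  proof -
    obtain s where "t = Suc s" using t by (cases t) auto
    then show ?thesis using p by (simp add: power_mult_distrib field_simps)
  qed
  also have "\<dots> ^ k \<le> (1 / 2) ^ k"
  proof (rule power_mono)
    have "n * p * A \<le> 100 * (n * p) powr (- (\<epsilon> / 2))"
    proof -
      have "A = q powr (- ((real (k * t) - 1) / 2))"
        using p by (simp add: A_def q_def powr_minus powr_divide inverse_eq_divide)
      also have "\<dots> = q powr (1 / 2) * q powr (- (real (k * t) / 2))"
        unfolding powr_add[symmetric] by (rule arg_cong[of _ _ "\<lambda>x. q powr x"]) (simp add: field_simps)
      also have "\<dots> \<le> 100 * (n * p) powr (- (1 + \<epsilon> / 2))"
      proof (rule mult_mono)
        have "q powr (1 / 2) \<le> q powr 1" using q by (intro powr_mono) auto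
        then show "q powr (1 / 2) \<le> 100" using q by simp
        have "q powr (- (real (k * t) / 2)) \<le> q powr (- ((2 + \<epsilon>) * log q (n * p) / 2))"
          using q large unfolding q_def[symmetric] by (intro powr_mono) auto
        also have "\<dots> = (q powr (log q (n * p))) powr (- (1 + \<epsilon> / 2))"
          by (simp add: powr_powr field_simps)
        also have "q powr (log q (n * p)) = n * p" using q np by simp
        finally show "q powr (- (real (k * t) / 2)) \<le> (n * p) powr (- (1 + \<epsilon> / 2))" .
      qed auto
      finally have "n * p * A \<le> n * p * (100 * (n * p) powr (- (1 + \<epsilon> / 2)))"
        using np by (intro mult_left_mono) auto
      also have "\<dots> = 100 * ((n * p) powr 1 * (n * p) powr (- (1 + \<epsilon> / 2)))" using np by simp
      also have "(n * p) powr 1 * (n * p) powr (- (1 + \<epsilon> / 2)) = (n * p) powr (- (\<epsilon> / 2))"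
        by (simp only: powr_add[symmetric]) simp
      finally show ?thesis .
    qed
    also have "\<dots> = 100 / (n * p) powr (\<epsilon> / 2)" by (simp add: powr_minus_divide)
    also have "\<dots> \<le> 1 / 200" using d by (simp add: divide_le_eq)
    finally have npA: "n * p * A \<le> 1 / 200" .
    obtain s where s: "t = Suc s" using t by (cases t) auto
    have "(n * p * A) ^ t * q ^ (t - 1) \<le> (1 / 200) ^ t * 100 ^ (t - 1)"
      using np A0 q npA by (intro mult_mono power_mono) auto
    also have "\<dots> = 1 / 200 * (1 / 2) ^ s" by (simp add: s power_mult_distrib[symmetric])
    also have "\<dots> \<le> 1 / 200 * 1" by (intro mult_left_mono power_le_one) auto
    finally have 1: "(n * p * A) ^ t * q ^ (t - 1) \<le> 1 / 2" by simp
    have "exp 1 / (k * p) \<le> 1" using kp kp0 by simp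
    then have "exp 1 / (k * p) * ((n * p * A) ^ t * q ^ (t - 1)) \<le> 1 * (1 / 2)"
      using 1 np A0 q kp0 by (intro mult_mono) auto
    then show "exp 1 / (k * p) * ((n * p * A) ^ t * q ^ (t - 1)) \<le> 1 / 2" by simp
    show "0 \<le> exp 1 / (k * p) * ((n * p * A) ^ t * q ^ (t - 1))" using np A0 q kp0 by simp
  qed
  finally show ?thesis .
qed

lemma sum_half_powers_le: "(\<Sum>l\<in>{a..<b}. (1 / 2 :: real) ^ l) \<le> 2 * (1 / 2) ^ a"
proof -
  define r where "r = (1 / 2 :: real)"
  have r: "2 * (r * x) = x" "r * (2 * x) = x" for x by (simp_all add: r_def)
  have "(\<Sum>l\<in>{a..<b}. r ^ l) = 2 * (r ^ a - r ^ b)" if "a \<le> b"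
    using that by (induction b rule: dec_induct) (simp_all add: r algebra_simps)
  moreover have "0 \<le> r ^ b" "0 \<le> r ^ a" by (simp_all add: r_def)
  ultimately show ?thesis unfolding r_def[symmetric] by (cases "a \<le> b") simp_all
qed

text \<open>Here \<open>k\<close> stands for the total number of blocks; the sum is split at l =
  k/2. Below, q^((l-1)/2) <= q^(k/4) <= sqrt d, and the binomial theorem gives exp (\<eta> k / 2).
  Above, q^((l-1)/2) <= d^(1 - \<epsilon>/4) and (k choose l) <= 2^k <= 4^l, so the terms are at
  most 2^(-l), the 8 being 4 times 2. The exponent 1 - \<epsilon>/4 is where staying below order 2L
  matters: it leaves room for an \<open>m\<close> slightly smaller than \<open>d\<close>.\<close>

lemma overlap_sum_le:
  fixes q d \<epsilon> \<eta> :: real and k m :: nat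
  assumes q: "1 < q" and d: "1 < d" and \<epsilon>: "0 < \<epsilon>" "\<epsilon> \<le> 1" and m: "0 < m"
    and k: "k \<le> (2 - \<epsilon> / 2) * log q d"
    and m1: "2 * sqrt d / m \<le> \<eta> / 2" and m2: "8 * d powr (1 - \<epsilon> / 4) / m \<le> 1 / 2"
    and large: "2 \<le> \<eta> * k"
  shows "(\<Sum>l\<le>k. (k choose l) * (1 / m) ^ l * (2 ^ l * q ^ (l choose 2))) < exp (\<eta> * k)"
proof -
  let ?f = "\<lambda>l. (k choose l) * (1 / m) ^ l * (2 ^ l * q ^ (l choose 2))"
  let ?A = "{l. l \<le> k \<and> 2 * l \<le> k}" and ?B = "{l. l \<le> k \<and> \<not> 2 * l \<le> k}"
  have qk: "q powr (real k / 2) \<le> d powr (1 - \<epsilon> / 4)"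
  proof -
    have "q powr (real k / 2) \<le> q powr (log q d * (1 - \<epsilon> / 4))"
      using q k by (intro powr_mono) (auto simp: field_simps)
    also have "\<dots> = d powr (1 - \<epsilon> / 4)" using q d by (simp add: powr_powr[symmetric])
    finally show ?thesis .
  qed
  have "d powr (1 - \<epsilon> / 4) \<le> d powr 1" using d \<epsilon> by (intro powr_mono) auto
  then have qk': "q powr (real k / 2) \<le> d" using qk d by simp
  have small: "q powr ((real l - 1) / 2) \<le> sqrt d" if "2 * l \<le> k" for l
  proof -
    have "q powr ((real l - 1) / 2) \<le> q powr (real k / 4)"
      using q that by (intro powr_mono) auto
    also have "\<dots> = sqrt (q powr (real k / 2))"
      by (simp add: powr_half_sqrt[symmetric] powr_powr)
    also have "\<dots> \<le> sqrt d" using qk' by simp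
    finally show ?thesis .
  qed
  have "(\<Sum>l\<in>?A. ?f l) \<le> (\<Sum>l\<in>?A. (k choose l) * (2 * sqrt d / m) ^ l)"
  proof (rule sum_mono)
    fix l assume "l \<in> ?A"
    then have "(q powr ((real l - 1) / 2)) ^ l \<le> sqrt d ^ l" using small by (intro power_mono) auto
    then have "q ^ (l choose 2) \<le> sqrt d ^ l" using power_choose_two_eq_powr[of q l] q by simp
    then have "?f l \<le> (k choose l) * (1 / m) ^ l * (2 ^ l * sqrt d ^ l)"
      by (intro mult_left_mono) auto
    also have "\<dots> = (k choose l) * (2 * sqrt d / m) ^ l" by (simp add: power_mult_distrib power_divide)
    finally show "?f l \<le> (k choose l) * (2 * sqrt d / m) ^ l" .
  qed
  also have "\<dots> \<le> (\<Sum>l\<le>k. (k choose l) * (2 * sqrt d / m) ^ l)"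
    using d m by (intro sum_mono2) auto
  also have "\<dots> = (2 * sqrt d / m + 1) ^ k" by (simp add: binomial_ring)
  also have "\<dots> \<le> exp (2 * sqrt d / m) ^ k"
    using d m exp_ge_add_one_self[of "2 * sqrt d / m"] by (intro power_mono) (auto simp: add.commute)
  also have "\<dots> \<le> exp (\<eta> / 2) ^ k" using m1 d by (intro power_mono) auto
  also have "\<dots> = exp (\<eta> * k / 2)" by (simp add: exp_of_nat_mult[symmetric] mult.commute)
  finally have A: "(\<Sum>l\<in>?A. ?f l) \<le> exp (\<eta> * k / 2)" .
  have "(\<Sum>l\<in>?B. ?f l) \<le> (\<Sum>l\<in>?B. (1 / 2) ^ l)"
  proof (rule sum_mono)
    fix l assume l: "l \<in> ?B"
    have "q powr ((real l - 1) / 2) \<le> q powr (real k / 2)" using q l by (intro powr_mono) auto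
    then have "(q powr ((real l - 1) / 2)) ^ l \<le> (d powr (1 - \<epsilon> / 4)) ^ l"
      using qk by (intro power_mono) auto
    then have ql: "q ^ (l choose 2) \<le> (d powr (1 - \<epsilon> / 4)) ^ l"
      using power_choose_two_eq_powr[of q l] q by simp
    have "k choose l \<le> 2 ^ k" by (rule binomial_le_pow2)
    also have "(2 :: nat) ^ k \<le> 2 ^ (2 * l)" using l by (intro power_increasing) auto
    finally have "real (k choose l) \<le> real (2 ^ (2 * l))" by (simp only: of_nat_le_iff)
    then have "real (k choose l) \<le> 4 ^ l" by (simp add: power_mult)
    then have "?f l \<le> 4 ^ l * (1 / m) ^ l * (2 ^ l * (d powr (1 - \<epsilon> / 4)) ^ l)"
      using ql q by (intro mult_mono) auto
    also have "\<dots> = (4 * (1 / m) * (2 * d powr (1 - \<epsilon> / 4))) ^ l"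
      by (simp only: power_mult_distrib)
    also have "4 * (1 / m) * (2 * d powr (1 - \<epsilon> / 4)) = 8 * d powr (1 - \<epsilon> / 4) / m" by simp
    also have "(8 * d powr (1 - \<epsilon> / 4) / m) ^ l \<le> (1 / 2) ^ l" using m2 by (intro power_mono) auto
    finally show "?f l \<le> (1 / 2) ^ l" .
  qed
  also have "\<dots> \<le> (\<Sum>l\<in>{1..<Suc k}. (1 / 2) ^ l)" by (intro sum_mono2) auto
  also have "\<dots> \<le> 1" using sum_half_powers_le[of 1 "Suc k"] by simp
  finally have B: "(\<Sum>l\<in>?B. ?f l) \<le> 1" .
  have "(\<Sum>l\<le>k. ?f l) = (\<Sum>l\<in>?A \<union> ?B. ?f l)" by (intro sum.cong) auto
  also have "\<dots> = (\<Sum>l\<in>?A. ?f l) + (\<Sum>l\<in>?B. ?f l)" by (rule sum.union_disjoint) auto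
  also have "\<dots> \<le> exp (\<eta> * k / 2) + 1" using A B by linarith
  also have "\<dots> < exp (\<eta> * k / 2) * 2"
    using large exp_ge_add_one_self[of "\<eta> * k / 2"] by linarith
  also have "\<dots> \<le> exp (\<eta> * k / 2) * exp (\<eta> * k / 2)"
  proof (rule mult_left_mono)
    show "2 \<le> exp (\<eta> * k / 2)" using large exp_ge_add_one_self[of "\<eta> * k / 2"] by linarith
  qed simp
  also have "\<dots> = exp (\<eta> * k)" by (simp add: exp_add[symmetric])
  finally show ?thesis .
qed

text \<open>The block size will satisfy m >= d/(4 ln d), which turns the two hypotheses on
  \<open>m\<close> in the overlap estimate into the conditions with 8 = 2 * 4 and 32 = 8 * 4. By 4
  ln d <= d, rounding the block size down loses at most half. The bound on ln d yields kp >= e, and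
  the last condition is that of the first moment.\<close>

lemma degree_conditions:
  fixes \<epsilon> \<eta> c :: real
  assumes "0 < \<epsilon>" "0 < \<eta>"
  shows "eventually (\<lambda>d :: real. 1 < d \<and> c \<le> ln d \<and> 4 * ln d \<le> d \<and> 8 * sqrt d * ln d / d \<le> \<eta> / 2 \<and>
    32 * d powr (1 - \<epsilon> / 4) * ln d / d \<le> 1 / 2 \<and> 2 * 100\<^sup>2 \<le> d powr (\<epsilon> / 2)) at_top"
proof -
  have 1: "eventually (\<lambda>d :: real. 1 < d) at_top" by (rule eventually_gt_at_top)
  have 2: "eventually (\<lambda>d :: real. c \<le> ln d) at_top"
    using ln_at_top by (simp add: filterlim_at_top)
  have 3: "eventually (\<lambda>d :: real. 4 * ln d \<le> d) at_top" by real_asymp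
  have "((\<lambda>d :: real. 8 * sqrt d * ln d / d) \<longlongrightarrow> 0) at_top" by real_asymp
  then have 4: "eventually (\<lambda>d :: real. 8 * sqrt d * ln d / d < \<eta> / 2) at_top"
    using assms(2) by (intro order_tendstoD(2)) auto
  have "((\<lambda>d :: real. 32 * d powr (1 - \<epsilon> / 4) * ln d / d) \<longlongrightarrow> 0) at_top" using assms(1) by real_asymp
  then have 5: "eventually (\<lambda>d :: real. 32 * d powr (1 - \<epsilon> / 4) * ln d / d < 1 / 2) at_top"
    by (intro order_tendstoD(2)) auto
  have "filterlim (\<lambda>d :: real. d powr (\<epsilon> / 2)) at_top at_top" using assms(1) by real_asymp
  then have 6: "eventually (\<lambda>d :: real. 2 * 100\<^sup>2 \<le> d powr (\<epsilon> / 2)) at_top"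
    unfolding filterlim_at_top by blast
  from 1 2 3 4 5 6 show ?thesis by eventually_elim auto
qed

text \<open>The upper bound is ln x <= x - 1 at x = 1/(1-p), together with 1 - p >= 1/100. So (ln
  d)/(ln q) is of order (ln d)/p.\<close>

lemma ln_inverse_one_minus_bounds:
  fixes p :: real
  assumes "0 < p" "p \<le> 99/100"
  shows "p \<le> ln (1 / (1 - p))" "ln (1 / (1 - p)) \<le> 100 * p"
proof -
  have "1 - p \<le> exp (- p)" using exp_ge_add_one_self[of "- p"] by simp
  then have "ln (1 - p) \<le> ln (exp (- p))" using assms by (subst ln_le_cancel_iff) auto
  then show "p \<le> ln (1 / (1 - p))" using assms by (simp add: ln_div)
  have "ln (1 / (1 - p)) \<le> 1 / (1 - p) - 1" using assms by (intro ln_le_minus_one) simp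
  also have "\<dots> = p / (1 - p)" using assms by (simp add: field_simps)
  also have "\<dots> \<le> p / (1 / 100)" using assms by (intro divide_left_mono) auto
  finally show "ln (1 / (1 - p)) \<le> 100 * p" by simp
qed

text \<open>The function (ln x)/x decreases beyond \<open>e\<close> and np <= n, so p ln n <= ln
  (np); dividing by ln q <= 100 p gives a bound independent of \<open>p\<close>. It makes the error
  terms tend to 0 at a rate depending only on \<open>n\<close>.\<close>

lemma log_degree_ge:
  fixes p :: real and n :: nat
  assumes p: "0 < p" "p \<le> 99/100" and d: "exp 1 \<le> n * p"
  shows "ln n / 100 \<le> log (1 / (1 - p)) (n * p)"
proof -
  note b = ln_inverse_one_minus_bounds[OF p]
  have n: "n > 0" using d by (cases n) auto
  have np: "0 < n * p" "1 \<le> n * p" using d exp_gt_one[of "1::real"] exp_gt_zero[of 1] by linarith+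
  have "n * p \<le> n" using p n by simp
  then have "ln n / n \<le> ln (n * p) / (n * p)" using d by (intro ln_x_over_x_mono) auto
  then have "ln n * p \<le> ln (n * p)" using n p by (simp add: field_simps)
  then have "ln n / 100 * (100 * p) \<le> ln (n * p)" by simp
  moreover have "ln n / 100 * ln (1 / (1 - p)) \<le> ln n / 100 * (100 * p)"
    using b n by (intro mult_left_mono) auto
  ultimately show ?thesis using b p by (simp add: log_def le_divide_eq)
qed

section \<open>The random graph\<close>

lemma (in par_tree) ex_block_system:
  assumes "0 < k" "0 < m" "k * t * m \<le> n"
  obtains W where "block_system t par k n m W"
proof -
  define W where "W = (\<lambda>(b, i). {(b * t + i) * m + 1..(b * t + i) * m + m})"
  have "block_system t par k n m W"
  proof unfold_locales
    fix \<beta> assume "\<beta> \<in> {..<k} \<times> {..<t}"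
    then obtain b i where \<beta>: "\<beta> = (b, i)" "b < k" "i < t" by auto
    have "b * t + t \<le> k * t" using mult_le_mono1[of "Suc b" k t] \<beta>(2) by simp
    then have "Suc (b * t + i) \<le> k * t" using \<beta>(3) by simp
    then have "Suc (b * t + i) * m \<le> n" using assms(3) mult_le_mono1 order_trans by blast
    then show "W \<beta> \<subseteq> {1..n}" by (auto simp: W_def \<beta>)
    show "card (W \<beta>) = m" by (simp add: W_def \<beta>)
  next
    fix \<beta> \<gamma> x
    assume "\<beta> \<in> {..<k} \<times> {..<t}" "\<gamma> \<in> {..<k} \<times> {..<t}" and x: "x \<in> W \<beta>" "x \<in> W \<gamma>"
    then obtain b i c j where \<beta>: "\<beta> = (b, i)" "\<gamma> = (c, j)" "i < t" "j < t" by auto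
    \<comment> \<open>The blocks are consecutive intervals starting at multiples of \<open>m\<close>
      plus 1, as vertices are numbered from 1; hence the shift before dividing.\<close>
    have div: "(x - 1) div m = s" if "x \<in> {s * m + 1..s * m + m}" for s
      using that by (intro div_nat_eqI) (auto simp: mult.commute)
    have "(x - 1) div m = b * t + i" by (rule div) (use x in \<open>simp add: W_def \<beta>\<close>)
    moreover have "(x - 1) div m = c * t + j" by (rule div) (use x in \<open>simp add: W_def \<beta>\<close>)
    ultimately have eq: "b * t + i = c * t + j" by simp
    then have "(b * t + i) div t = (c * t + j) div t" "(b * t + i) mod t = (c * t + j) mod t" by simp_all
    then show "\<beta> = \<gamma>" using \<beta> by simp
  qed (use assms in auto)
  then show ?thesis by (rule that)
qed

text \<open>The map from edge indicators to graphs under which \<open>gnp\<close> is an image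
  measure.\<close>

definition graph_of :: "nat \<Rightarrow> (nat set \<Rightarrow> bool) \<Rightarrow> nat pair_pre_digraph" where
  "graph_of n X = \<lparr> pverts = {1..n},
     parcs = {(u, v). u \<in> {1..n} \<and> v \<in> {1..n} \<and> u \<noteq> v \<and> X {u, v}} \<rparr>"

lemma pair_pseudo_graph_graph_of: "pair_pseudo_graph (graph_of n X)"
proof unfold_locales
  show "finite (parcs (graph_of n X))"
    by (rule finite_subset[of _ "{1..n} \<times> {1..n}"]) (auto simp: graph_of_def)
  show "symmetric (graph_of n X)"
    by (auto simp: symmetric_def graph_of_def insert_commute intro!: symI)
qed (auto simp: graph_of_def)

section \<open>Transfer to the random graph and the two tail bounds\<close>

context enumerated_tree
begin

lemma induced_matching_of_tree_matching:
  assumes "U \<subseteq> {1..n}" "tree_matching t par X U"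
  shows "induced_matching T (graph_of n X) U"
proof -
  obtain I :: "nat set" and g where g: "tree_copies t par (\<lambda>u v. u \<noteq> v \<and> X {u, v}) I g"
    and U: "U = g ` (I \<times> {..<t})"
    using assms(2) unfolding tree_matching_def by (elim exE conjE)
  have "(g (a, i), g (b, j)) \<in> parcs (graph_of n X) \<longleftrightarrow> g (a, i) \<noteq> g (b, j) \<and> X {g (a, i), g (b, j)}"
    if "a \<in> I" "b \<in> I" "i < t" "j < t" for a b i j
  proof -
    have "g (a, i) \<in> {1..n}" "g (b, j) \<in> {1..n}" using that assms(1) U by blast+
    then show ?thesis by (simp add: graph_of_def)
  qed
  then have "tree_copies t par (\<lambda>u v. (u, v) \<in> parcs (graph_of n X)) I g"
    using g unfolding tree_copies_def by simp
  moreover have "U \<subseteq> pverts (graph_of n X)" using assms(1) by (simp add: graph_of_def)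
  ultimately show ?thesis
    unfolding induced_matching_def
    using is_matching_of_tree_copies[OF pair_pseudo_graph_graph_of U] by blast
qed

lemma rooted_copies_of_induced_matching:
  assumes "induced_matching T (graph_of n X) U"
  obtains k where "rooted_copies n k X" "card U = k * t" "k \<le> n"
proof -
  have U: "U \<subseteq> pverts (graph_of n X)" "is_matching_of T (with_proj (graph_of n X) \<restriction> U)"
    using assms by (simp_all add: induced_matching_def)
  have Un: "U \<subseteq> {1..n}" using U(1) by (simp add: graph_of_def)
  obtain I g where g: "I \<subseteq> U" "U = g ` (I \<times> {..<t})" "\<And>v. v \<in> I \<Longrightarrow> g (v, 0) = v"
    "tree_copies t par (\<lambda>u v. (u, v) \<in> parcs (graph_of n X)) I g"
    using tree_copies_of_is_matching[OF pair_pseudo_graph_graph_of U] by metis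
  have "(g (a, i), g (b, j)) \<in> parcs (graph_of n X) \<longleftrightarrow> g (a, i) \<noteq> g (b, j) \<and> X {g (a, i), g (b, j)}"
    if "a \<in> I" "b \<in> I" "i < t" "j < t" for a b i j
  proof -
    have "g (a, i) \<in> {1..n}" "g (b, j) \<in> {1..n}" using that Un g(2) by blast+
    then show ?thesis by (simp add: graph_of_def)
  qed
  then have c: "tree_copies t par (\<lambda>u v. u \<noteq> v \<and> X {u, v}) I g"
    using g(4) unfolding tree_copies_def by simp
  have In: "I \<subseteq> {1..n}" using g(1) Un by simp
  have "rooted_copies n (card I) X"
    unfolding rooted_copies_def using In c g(2,3) Un by (intro exI[of _ I] exI[of _ g]) auto
  moreover have "card U = card I * t"
    unfolding g(2) using g(4) by (simp add: tree_copies_def card_image card_cartesian_product)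
  moreover have "card I \<le> n" using card_mono[OF _ In] by simp
  ultimately show ?thesis by (rule that)
qed

lemma finite_induced_matchings: "finite {U. induced_matching T (graph_of n X) U}"
  by (rule finite_subset[of _ "Pow {1..n}"]) (auto simp: induced_matching_def graph_of_def)

lemma card_le_max_induced_matching_order:
  assumes "U \<subseteq> {1..n}" "tree_matching t par X U"
  shows "card U \<le> max_induced_matching_order T (graph_of n X)"
  unfolding max_induced_matching_order_def
  using induced_matching_of_tree_matching[OF assms] finite_induced_matchings by (intro Max_ge) auto

lemma max_induced_matching_order_attained:
  obtains k where "rooted_copies n k X" "max_induced_matching_order T (graph_of n X) = k * t" "k \<le> n"
proof -
  have "induced_matching T (graph_of n X) {}"
    by (rule induced_matching_of_tree_matching) (simp_all add: tree_matching_empty)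
  then have "card ` {U. induced_matching T (graph_of n X) U} \<noteq> {}" by blast
  then have "max_induced_matching_order T (graph_of n X) \<in> card ` {U. induced_matching T (graph_of n X) U}"
    unfolding max_induced_matching_order_def using finite_induced_matchings by (intro Max_in) auto
  then obtain U where U: "induced_matching T (graph_of n X) U"
    "max_induced_matching_order T (graph_of n X) = card U" by blast
  show ?thesis by (rule rooted_copies_of_induced_matching[OF U(1)]) (rule that, simp_all add: U(2))
qed

text \<open>The loss \<epsilon> is split in three: \<epsilon>/2 in the number of copies,
  \<epsilon>/4 (that is, 2\<delta> of 2L) in the two deviations, and \<epsilon>/4 for rounding
  \<open>k\<close> down, since t <= \<epsilon> L / 4. The value of \<eta> makes \<eta> k t equal to
  the exponent 2 \<delta>^2 k / t of the concentration bound, so the overlap estimate fits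
  \<open>prob_large_matching\<close> exactly.\<close>

lemma prob_order_large:
  fixes \<epsilon> p :: real and n :: nat
  defines "\<delta> \<equiv> \<epsilon> / 16" and "d \<equiv> n * p" and "L \<equiv> log (1 / (1 - p)) (n * p)"
  defines "\<eta> \<equiv> 2 * \<delta>\<^sup>2 / t\<^sup>2"
  assumes p: "0 < p" "p \<le> 99/100" and \<epsilon>: "0 < \<epsilon>" "\<epsilon> \<le> 1"
    and d: "1 < d" "100 * t * exp 1 \<le> ln d" "4 * ln d \<le> d" "8 * sqrt d * ln d / d \<le> \<eta> / 2"
      "32 * d powr (1 - \<epsilon> / 4) * ln d / d \<le> 1 / 2"
    and L: "4 * t / \<epsilon> \<le> L" "2 / \<eta> \<le> L"
  shows "1 - exp (- (2 * \<delta>\<^sup>2 / t\<^sup>2) * L) \<le>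
    measure_pmf.prob (Pi_pmf {e. e \<subseteq> {1..n} \<and> card e = 2} False (\<lambda>_. bernoulli_pmf p))
      {X. (2 - \<epsilon>) * L \<le> max_induced_matching_order T (graph_of n X)}"
proof -
  define q where "q = 1 / (1 - p)"
  have q: "1 < q" using p by (simp add: q_def field_simps)
  note lnq = ln_inverse_one_minus_bounds[OF p, folded q_def]
  have t: "0 < real t" using t_pos by simp
  have \<delta>: "0 < \<delta>" using \<epsilon> by (simp add: \<delta>_def)
  have \<eta>: "0 < \<eta>" using \<delta> t by (simp add: \<eta>_def)
  have "0 < ln q" using q by simp
  then have L_eq: "L * ln q = ln d" unfolding L_def q_def[symmetric] d_def log_def by simp
  have lnd: "0 < ln d" using d by simp
  have L2t: "2 * t \<le> L"
  proof -
    have "2 * t * \<epsilon> \<le> 4 * t" using \<epsilon> t by (simp add: mult_mono)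
    then have "2 * t \<le> 4 * t / \<epsilon>" using \<epsilon> by (simp add: field_simps)
    then show ?thesis using L by linarith
  qed
  have L0: "0 < L" using L2t t by linarith
  define k where "k = nat \<lfloor>(2 - \<epsilon> / 2) * L / t\<rfloor>"
  have pos: "0 \<le> (2 - \<epsilon> / 2) * L / t" using \<epsilon> L0 t by simp
  have k_le: "real k \<le> (2 - \<epsilon> / 2) * L / t" using pos by (simp add: k_def)
  have k_gt: "(2 - \<epsilon> / 2) * L / t - 1 < real k" using pos by (simp add: k_def)
  have kt_le: "k * t \<le> (2 - \<epsilon> / 2) * L" using k_le t by (simp add: field_simps)
  have kt_gt: "(2 - \<epsilon> / 2) * L - t < k * t" using k_gt t by (simp add: field_simps)
  have "\<epsilon> / 2 * L \<le> 1 / 2 * L" using \<epsilon> L0 by (intro mult_right_mono) auto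
  then have kt_ge: "L \<le> k * t" using kt_gt L2t by (simp add: algebra_simps)
  have k_pos: "0 < k" using kt_ge L0 by (cases k) auto
  have kL: "L / t \<le> k" using kt_ge t by (simp add: divide_le_eq)
  have kt0: "0 < real (k * t)" using k_pos t_pos by simp
  \<comment> \<open>From ln d = L ln q <= 100 L p and L <= kt.\<close>
  have kp: "exp 1 \<le> k * p"
  proof -
    have "100 * (t * exp 1) \<le> 100 * (L * p)"
      using mult_left_mono[OF lnq(2), of L] L_eq L0 d(2) by (simp add: mult_ac)
    then have "t * exp 1 \<le> L * p" by simp
    also have "\<dots> \<le> k * t * p" using kt_ge p by (intro mult_right_mono) auto
    finally show ?thesis using t by (simp add: mult_ac)
  qed
  define m where "m = n div (k * t)"
  have kt_lnd: "real (k * t) * p \<le> 2 * ln d"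
  proof -
    have "(2 - \<epsilon> / 2) * L \<le> 2 * L" using \<epsilon> L0 by (intro mult_right_mono) auto
    then have "k * t * p \<le> 2 * L * p" using kt_le p by (intro mult_right_mono) auto
    also have "\<dots> \<le> 2 * (L * ln q)" using mult_left_mono[OF lnq(1), of L] L0 by simp
    finally show ?thesis by (simp add: L_eq)
  qed
  have n_ge: "d / (2 * ln d) \<le> n / (k * t)"
  proof -
    have "d * (k * t) \<le> n * (2 * ln d)"
      using mult_left_mono[OF kt_lnd, of n] by (simp add: d_def mult_ac)
    then show ?thesis using lnd kt0 by (simp add: field_simps)
  qed
  have m_gt: "n / (k * t) - 1 < m"
  proof -
    have "real m = of_int \<lfloor>real n / real (k * t)\<rfloor>" unfolding m_def floor_divide_of_nat_eq by simp
    then show ?thesis by linarith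
  qed
  have "2 \<le> d / (2 * ln d)" using d lnd by (simp add: le_divide_eq)
  \<comment> \<open>With x = d/(2 ln d) >= 2, rounding down leaves more than x - 1 >= x/2.\<close>
  then have m_ge: "d / (4 * ln d) \<le> m" using n_ge m_gt by (simp add: field_simps)
  have "0 < d / (4 * ln d)" using d lnd by simp
  then have m_pos: "0 < m" using m_ge by (cases m) auto
  have inv_m: "1 / m \<le> 4 * ln d / d" using m_ge m_pos lnd d by (simp add: field_simps)
  have m1: "2 * sqrt d / m \<le> \<eta> / 2"
  proof -
    have "2 * sqrt d * (1 / m) \<le> 2 * sqrt d * (4 * ln d / d)"
      using inv_m d by (intro mult_left_mono) auto
    then show ?thesis using d(4) by simp
  qed
  have m2: "8 * d powr (1 - \<epsilon> / 4) / m \<le> 1 / 2"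
  proof -
    have "8 * d powr (1 - \<epsilon> / 4) * (1 / m) \<le> 8 * d powr (1 - \<epsilon> / 4) * (4 * ln d / d)"
      using inv_m by (intro mult_left_mono) auto
    then show ?thesis using d(5) by simp
  qed
  have large: "2 \<le> \<eta> * real (k * t)"
  proof -
    have "2 \<le> \<eta> * L" using L(2) \<eta> by (simp add: field_simps)
    also have "\<dots> \<le> \<eta> * real (k * t)" using kt_ge \<eta> by (intro mult_left_mono) auto
    finally show ?thesis .
  qed
  have "k * t * m \<le> n" by (simp add: m_def)
  then obtain W where "block_system t par k n m W"
    using ex_block_system[OF k_pos m_pos] by blast
  then interpret block_system t par k n m W .
  have exponent: "\<eta> * real (k * t) = 2 * \<delta>\<^sup>2 * k / t" using t by (simp add: \<eta>_def power2_eq_square)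
  have S: "(\<Sum>l\<le>k * t. ((k * t) choose l) * (1 / m) ^ l * (2 ^ l * (1 / (1 - p)) ^ (l choose 2)))
      < exp (2 * \<delta>\<^sup>2 * k / t)"
    unfolding exponent[symmetric] q_def[symmetric]
    by (rule overlap_sum_le[where d = d and \<epsilon> = \<epsilon>])
       (use q d \<epsilon> m_pos kt_le m1 m2 large in \<open>simp_all add: L_def q_def d_def\<close>)
  have order: "(2 - \<epsilon>) * L \<le> (1 - 2 * \<delta>) * (k * t)"
  proof -
    have "t \<le> \<epsilon> / 4 * L" using L(1) \<epsilon> by (simp add: field_simps)
    moreover have "(1 - \<epsilon> / 8) * ((2 - \<epsilon> / 2) * L - t) = (2 - 3 / 4 * \<epsilon>) * L - t + (\<epsilon>\<^sup>2 / 16 * L + \<epsilon> / 8 * t)"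
      by (simp add: algebra_simps power2_eq_square)
    moreover have "0 \<le> \<epsilon>\<^sup>2 / 16 * L + \<epsilon> / 8 * t" using \<epsilon> L0 t by simp
    moreover have "(2 - \<epsilon>) * L = (2 - 3 / 4 * \<epsilon>) * L - \<epsilon> / 4 * L" by (simp add: algebra_simps)
    ultimately have "(2 - \<epsilon>) * L \<le> (1 - \<epsilon> / 8) * ((2 - \<epsilon> / 2) * L - t)" by linarith
    also have "\<dots> \<le> (1 - \<epsilon> / 8) * (k * t)"
      using kt_gt \<epsilon> by (intro mult_left_mono) auto
    also have "1 - \<epsilon> / 8 = 1 - 2 * \<delta>" by (simp add: \<delta>_def)
    finally show ?thesis .
  qed
  have "- (2 * \<delta>\<^sup>2 * k / t) \<le> - (2 * \<delta>\<^sup>2 / t\<^sup>2) * L"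
  proof -
    have "2 * \<delta>\<^sup>2 / t * (L / t) \<le> 2 * \<delta>\<^sup>2 / t * k" using kL t by (intro mult_left_mono) auto
    then show ?thesis by (simp add: power2_eq_square)
  qed
  then have "1 - exp (- (2 * \<delta>\<^sup>2 / t\<^sup>2) * L) \<le> 1 - exp (- 2 * \<delta>\<^sup>2 * k / t)" by simp
  also have "\<dots> \<le> measure_pmf.prob (Pi_pmf {e. e \<subseteq> {1..n} \<and> card e = 2} False (\<lambda>_. bernoulli_pmf p))
      {X. \<exists>U\<subseteq>{1..n}. tree_matching t par X U \<and> (1 - 2 * \<delta>) * (k * t) \<le> card U}"
    by (rule prob_large_matching[OF p(1) _ kp \<delta> S]) (use p in auto)
  also have "\<dots> \<le> measure_pmf.prob (Pi_pmf {e. e \<subseteq> {1..n} \<and> card e = 2} False (\<lambda>_. bernoulli_pmf p))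
      {X. (2 - \<epsilon>) * L \<le> max_induced_matching_order T (graph_of n X)}"
  proof (rule measure_pmf.finite_measure_mono)
    show "{X. \<exists>U\<subseteq>{1..n}. tree_matching t par X U \<and> (1 - 2 * \<delta>) * (k * t) \<le> card U}
      \<subseteq> {X. (2 - \<epsilon>) * L \<le> max_induced_matching_order T (graph_of n X)}"
    proof (rule Collect_mono, rule impI, elim exE conjE)
      fix X U assume U: "U \<subseteq> {1..n}" "tree_matching t par X U" "(1 - 2 * \<delta>) * (k * t) \<le> card U"
      have "real (card U) \<le> max_induced_matching_order T (graph_of n X)"
        using card_le_max_induced_matching_order[OF U(1,2)] by simp
      then show "(2 - \<epsilon>) * L \<le> max_induced_matching_order T (graph_of n X)"
        using order U(3) by linarith
    qed
  qed simp
  finally show ?thesis .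
qed

text \<open>The maximum is kt for some \<open>k\<close> between \<open>k0\<close> and
  \<open>n\<close>. The first moment is at most 2^(-k) for each such \<open>k\<close>, so the union
  bound is a geometric series, at most twice its first term.\<close>

lemma prob_order_too_large:
  fixes \<epsilon> p :: real and n :: nat
  defines "d \<equiv> n * p" and "L \<equiv> log (1 / (1 - p)) (n * p)"
  assumes p: "0 < p" "p \<le> 99/100" and \<epsilon>: "0 < \<epsilon>"
    and d: "1 < d" "100 * t * exp 1 \<le> ln d" "2 * 100\<^sup>2 \<le> d powr (\<epsilon> / 2)"
  shows "measure_pmf.prob (Pi_pmf {e. e \<subseteq> {1..n} \<and> card e = 2} False (\<lambda>_. bernoulli_pmf p))
      {X. (2 + \<epsilon>) * L < max_induced_matching_order T (graph_of n X)} \<le> 2 * (1 / 2) powr (L / t)"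
proof -
  let ?M = "Pi_pmf {e. e \<subseteq> {1..n} \<and> card e = 2} False (\<lambda>_. bernoulli_pmf p)"
  define q where "q = 1 / (1 - p)"
  have q: "1 < q" using p by (simp add: q_def field_simps)
  note lnq = ln_inverse_one_minus_bounds[OF p, folded q_def]
  have t: "0 < real t" using t_pos by simp
  have "0 < ln q" using q by simp
  then have L_eq: "L * ln q = ln d" unfolding L_def q_def[symmetric] d_def log_def by simp
  have L0: "0 < L" using L_eq q d(1) by (metis ln_gt_zero zero_less_mult_pos2)
  define k0 where "k0 = nat \<lceil>(2 + \<epsilon>) * L / t\<rceil>"
  have k0: "(2 + \<epsilon>) * L / t \<le> k0" by (simp add: k0_def real_nat_ceiling_ge)
  have "L / t \<le> (2 + \<epsilon>) * L / t" using \<epsilon> L0 t by (intro divide_right_mono) auto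
  then have k0L: "L / t \<le> k0" using k0 by linarith
  have bound: "measure_pmf.prob ?M {X. rooted_copies n k X} \<le> (1 / 2) ^ k" if k: "k0 \<le> k" for k
  proof -
    have kL: "L / t \<le> k" "(2 + \<epsilon>) * L / t \<le> k" using k0 k0L k by linarith+
    have "0 < L / t" using L0 t by simp
    then have k_pos: "0 < k" using kL by (cases k) auto
    have kt_ge: "L \<le> k * t" "(2 + \<epsilon>) * L \<le> k * t" using kL t by (simp_all add: divide_le_eq)
    have "100 * (t * exp 1) \<le> 100 * (L * p)"
      using mult_left_mono[OF lnq(2), of L] L_eq L0 d(2) by (simp add: mult_ac)
    then have "t * exp 1 \<le> L * p" by simp
    also have "\<dots> \<le> k * t * p" using kt_ge p by (intro mult_right_mono) auto
    finally have kp: "exp 1 \<le> k * p" using t by (simp add: mult_ac)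
    have "measure_pmf.prob ?M {X. rooted_copies n k X} \<le> (n choose k) * n ^ (k * (t - 1)) *
        (p ^ (k * (t - 1)) * (1 - p) ^ (((k * t) choose 2) - k * (t - 1)))"
      by (rule prob_rooted_copies_le) (use p in auto)
    also have "\<dots> \<le> (1 / 2) ^ k"
      by (rule expected_copies_le[OF p t_pos k_pos \<epsilon> kp])
         (use kt_ge(2) d(3) in \<open>simp_all add: L_def d_def\<close>)
    finally show ?thesis .
  qed
  have "{X. (2 + \<epsilon>) * L < max_induced_matching_order T (graph_of n X)} \<subseteq>
      (\<Union>k\<in>{k0..<Suc n}. {X. rooted_copies n k X})"
  proof
    fix X assume X: "X \<in> {X. (2 + \<epsilon>) * L < max_induced_matching_order T (graph_of n X)}"
    obtain k where k: "rooted_copies n k X" "max_induced_matching_order T (graph_of n X) = k * t" "k \<le> n"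
      by (rule max_induced_matching_order_attained)
    have "(2 + \<epsilon>) * L < real k * t" using X k(2) by simp
    then have "(2 + \<epsilon>) * L / t \<le> real k" using t by (simp add: divide_le_eq)
    then have "k0 \<le> k" by (simp add: k0_def ceiling_le_iff)
    then show "X \<in> (\<Union>k\<in>{k0..<Suc n}. {X. rooted_copies n k X})" using k(1,3) by auto
  qed
  then have "measure_pmf.prob ?M {X. (2 + \<epsilon>) * L < max_induced_matching_order T (graph_of n X)}
      \<le> measure_pmf.prob ?M (\<Union>k\<in>{k0..<Suc n}. {X. rooted_copies n k X})"
    by (rule measure_pmf.finite_measure_mono) simp
  also have "\<dots> \<le> (\<Sum>k\<in>{k0..<Suc n}. measure_pmf.prob ?M {X. rooted_copies n k X})"
    by (rule measure_pmf.finite_measure_subadditive_finite) auto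
  also have "\<dots> \<le> (\<Sum>k\<in>{k0..<Suc n}. (1 / 2) ^ k)" by (intro sum_mono bound) simp
  also have "\<dots> \<le> 2 * (1 / 2) ^ k0" by (rule sum_half_powers_le)
  also have "\<dots> = 2 * (1 / 2) powr k0" by (simp add: powr_realpow)
  also have "\<dots> \<le> 2 * (1 / 2) powr (L / t)"
    using k0L by (intro mult_left_mono powr_mono') auto
  finally show ?thesis .
qed

end

theorem theorem1p2:
  fixes \<epsilon> :: real and T :: "'a pair_pre_digraph"
  assumes "\<epsilon> > 0" and "undirected_tree T"
  shows "\<exists>d\<^sub>0 > (0::real). \<forall>p :: nat \<Rightarrow> real.
           (\<forall>\<^sub>F n in sequentially. d\<^sub>0 / real n \<le> p n \<and> p n \<le> 0.99) \<longrightarrow>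
           (\<lambda>n. measure_pmf.prob (gnp n (p n))
                  {G. let q = 1 / (1 - p n);
                          N = real (max_induced_matching_order T G)
                      in (2 - \<epsilon>) * log q (real n * p n) \<le> N \<and>
                         N \<le> (2 + \<epsilon>) * log q (real n * p n)}) \<longlonglongrightarrow> 1"
proof -
  obtain t par h where enum: "0 < t" "\<And>i. 0 < i \<Longrightarrow> i < t \<Longrightarrow> par i < i"
    "bij_betw h {..<t} (pverts T)"
    "\<And>i j. i < t \<Longrightarrow> j < t \<Longrightarrow> (h i, h j) \<in> parcs T \<longleftrightarrow> par_edge par i j"
    using undirected_tree_enumeration[OF assms(2)] by metis
  interpret pair_graph T using assms(2) by (simp add: undirected_tree_def)
  interpret enumerated_tree t par T h
    by unfold_locales (use enum arc_fst_in_verts arc_snd_in_verts in auto)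
  \<comment> \<open>The lower bound is available for parameters up to 1; since L >= 0, the smaller
    parameter gives the stronger statement.\<close>
  define \<epsilon>' where "\<epsilon>' = min \<epsilon> 1"
  have \<epsilon>': "0 < \<epsilon>'" "\<epsilon>' \<le> 1" "\<epsilon>' \<le> \<epsilon>" using assms(1) by (auto simp: \<epsilon>'_def)
  define \<eta> where "\<eta> = 2 * (\<epsilon>' / 16)\<^sup>2 / t\<^sup>2"
  have \<eta>: "0 < \<eta>" using \<epsilon>' enum(1) by (simp add: \<eta>_def)
  obtain d0 where d0: "\<And>d. d0 \<le> d \<Longrightarrow> 1 < d \<and> 100 * t * exp 1 \<le> ln d \<and> 4 * ln d \<le> d \<and>
      8 * sqrt d * ln d / d \<le> \<eta> / 2 \<and> 32 * d powr (1 - \<epsilon>' / 4) * ln d / d \<le> 1 / 2 \<and>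
      2 * 100\<^sup>2 \<le> d powr (\<epsilon>' / 2)"
    using degree_conditions[OF \<epsilon>'(1) \<eta>, of "100 * t * exp 1"] unfolding eventually_at_top_linorder by blast
  \<comment> \<open>The maximum with \<open>e\<close> serves \<open>log_degree_ge\<close>, which
    needs np >= e.\<close>
  define c where "c = max d0 (exp 1)"
  have c: "0 < c" "d0 \<le> c" "exp 1 \<le> c" by (simp_all add: c_def less_max_iff_disj)
  show ?thesis
  proof (intro exI[of _ c] conjI allI impI c(1))
    fix p :: "nat \<Rightarrow> real"
    assume ev: "\<forall>\<^sub>F n in sequentially. c / real n \<le> p n \<and> p n \<le> 0.99"
    define L where "L = (\<lambda>n. log (1 / (1 - p n)) (real n * p n))"
    define F where "F = (\<lambda>n. measure_pmf.prob (gnp n (p n))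
                  {G. let q = 1 / (1 - p n);
                          N = real (max_induced_matching_order T G)
                      in (2 - \<epsilon>) * log q (real n * p n) \<le> N \<and>
                         N \<le> (2 + \<epsilon>) * log q (real n * p n)})"
    \<comment> \<open>\<open>H\<close> is what the two tail bounds give once \<open>L n\<close> is
      replaced by its lower bound (ln n)/100; it no longer involves \<open>p\<close>.\<close>
    define H where "H = (\<lambda>n :: nat. 1 - exp (- \<eta> * (ln (real n) / 100)) - 2 * (1 / 2) powr (ln (real n) / 100 / t))"
    have lim_ln: "filterlim (\<lambda>n :: nat. ln (real n) / 100) at_top sequentially" by real_asymp
    have lower: "\<forall>\<^sub>F n in sequentially. H n \<le> F n"
      using ev eventually_gt_at_top[of 0]
        lim_ln[unfolded filterlim_at_top, rule_format, of "4 * t / \<epsilon>'"]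
        lim_ln[unfolded filterlim_at_top, rule_format, of "2 / \<eta>"]
    proof eventually_elim
      case (elim n)
      define d where "d = real n * p n"
      have n: "0 < real n" using elim by simp
      have dc: "c \<le> d" using elim(1) n by (simp add: d_def field_simps)
      have p: "0 < p n" "p n \<le> 99 / 100"
        using elim(1) divide_pos_pos[OF c(1) n] by (linarith, simp)
      have D: "1 < d" "100 * t * exp 1 \<le> ln d" "4 * ln d \<le> d" "8 * sqrt d * ln d / d \<le> \<eta> / 2"
        "32 * d powr (1 - \<epsilon>' / 4) * ln d / d \<le> 1 / 2" "2 * 100\<^sup>2 \<le> d powr (\<epsilon>' / 2)"
        using d0[of d] dc c(2) by auto
      have Lge: "ln (real n) / 100 \<le> L n"
        unfolding L_def by (rule log_degree_ge[OF p]) (use dc c(3) in \<open>simp add: d_def\<close>)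
      have L0: "0 \<le> L n"
        using Lge n elim(2) by (intro order_trans[OF _ Lge]) auto
      let ?M = "Pi_pmf {e. e \<subseteq> {1..n} \<and> card e = 2} False (\<lambda>_. bernoulli_pmf (p n))"
      let ?N = "\<lambda>X. max_induced_matching_order T (graph_of n X)"
      have LL: "4 * t / \<epsilon>' \<le> L n" "2 / \<eta> \<le> L n" using elim(3,4) Lge by linarith+
      have lo: "1 - exp (- \<eta> * L n) \<le> measure_pmf.prob ?M {X. (2 - \<epsilon>') * L n \<le> ?N X}"
        unfolding L_def \<eta>_def
        by (rule prob_order_large)
           (fact p \<epsilon>' D[unfolded d_def \<eta>_def] LL[unfolded L_def \<eta>_def])+
      have up: "measure_pmf.prob ?M {X. (2 + \<epsilon>') * L n < ?N X} \<le> 2 * (1 / 2) powr (L n / t)"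
        unfolding L_def
        by (rule prob_order_too_large) (use p \<epsilon>' D in \<open>auto simp: d_def\<close>)
      have gnp: "gnp n (p n) = map_pmf (graph_of n) ?M" by (simp add: gnp_def graph_of_def[abs_def])
      have "H n \<le> 1 - exp (- \<eta> * L n) - 2 * (1 / 2) powr (L n / t)"
      proof -
        have "- \<eta> * L n \<le> - \<eta> * (ln (real n) / 100)" using Lge \<eta> by (intro mult_left_mono_neg) auto
        moreover have "(1 / 2 :: real) powr (L n / t) \<le> (1 / 2) powr (ln (real n) / 100 / t)"
          using Lge by (intro powr_mono' divide_right_mono) auto
        ultimately show ?thesis unfolding H_def by (intro diff_mono) auto
      qed
      also have "\<dots> \<le> measure_pmf.prob ?M {X. (2 - \<epsilon>') * L n \<le> ?N X} - measure_pmf.prob ?M {X. (2 + \<epsilon>') * L n < ?N X}"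
        using lo up by linarith
      also have "\<dots> \<le> measure_pmf.prob ?M ({X. (2 - \<epsilon>') * L n \<le> ?N X} - {X. (2 + \<epsilon>') * L n < ?N X})"
      proof -
        have "measure_pmf.prob ?M {X. (2 - \<epsilon>') * L n \<le> ?N X} \<le>
            measure_pmf.prob ?M (({X. (2 - \<epsilon>') * L n \<le> ?N X} - {X. (2 + \<epsilon>') * L n < ?N X}) \<union> {X. (2 + \<epsilon>') * L n < ?N X})"
          by (rule measure_pmf.finite_measure_mono) auto
        also have "\<dots> \<le> measure_pmf.prob ?M ({X. (2 - \<epsilon>') * L n \<le> ?N X} - {X. (2 + \<epsilon>') * L n < ?N X})
            + measure_pmf.prob ?M {X. (2 + \<epsilon>') * L n < ?N X}"
          by (rule measure_Un_le) auto
        finally show ?thesis by linarith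
      qed
      also have "\<dots> \<le> F n"
        unfolding F_def gnp measure_map_pmf
      proof (rule measure_pmf.finite_measure_mono)
        have mono: "(2 - \<epsilon>) * L n \<le> (2 - \<epsilon>') * L n" "(2 + \<epsilon>') * L n \<le> (2 + \<epsilon>) * L n"
          using L0 \<epsilon>'(3) by (intro mult_right_mono; simp)+
        show "{X. (2 - \<epsilon>') * L n \<le> ?N X} - {X. (2 + \<epsilon>') * L n < ?N X} \<subseteq> graph_of n -`
            {G. let q = 1 / (1 - p n); N = real (max_induced_matching_order T G)
                in (2 - \<epsilon>) * log q (real n * p n) \<le> N \<and> N \<le> (2 + \<epsilon>) * log q (real n * p n)}"
        proof
          fix X assume "X \<in> {X. (2 - \<epsilon>') * L n \<le> ?N X} - {X. (2 + \<epsilon>') * L n < ?N X}"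
          then have "(2 - \<epsilon>') * L n \<le> ?N X" "?N X \<le> (2 + \<epsilon>') * L n" by simp_all
          then have "(2 - \<epsilon>) * L n \<le> ?N X \<and> ?N X \<le> (2 + \<epsilon>) * L n" using mono by linarith
          then show "X \<in> graph_of n -` {G. let q = 1 / (1 - p n); N = real (max_induced_matching_order T G)
                in (2 - \<epsilon>) * log q (real n * p n) \<le> N \<and> N \<le> (2 + \<epsilon>) * log q (real n * p n)}"
            unfolding Let_def L_def by simp
        qed
      qed simp
      finally show ?case .
    qed
    have decay: "((\<lambda>y. exp (- (c * y))) \<longlongrightarrow> 0) at_top" if "0 < c" for c :: real
      using that by real_asymp
    have "((\<lambda>y. 1 - exp (- (\<eta> * y)) - 2 * exp (- (ln 2 / t * y))) \<longlongrightarrow> 1 - 0 - 2 * 0) at_top"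
      by (intro tendsto_intros decay) (use \<eta> enum(1) in auto)
    from filterlim_compose[OF this lim_ln] have "H \<longlonglongrightarrow> 1"
      by (simp add: H_def powr_def ln_div mult.commute)
    moreover have "\<forall>\<^sub>F n in sequentially. F n \<le> 1" by (simp add: F_def)
    ultimately have "F \<longlonglongrightarrow> 1" using lower by (intro tendsto_sandwich[of H F _ "\<lambda>_. 1"]) auto
    then show "(\<lambda>n. measure_pmf.prob (gnp n (p n))
                  {G. let q = 1 / (1 - p n);
                          N = real (max_induced_matching_order T G)
                      in (2 - \<epsilon>) * log q (real n * p n) \<le> N \<and>
                         N \<le> (2 + \<epsilon>) * log q (real n * p n)}) \<longlonglongrightarrow> 1"
      unfolding F_def .
  qed
qed

end
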